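(* Let $\mathbb{H}^{Cl}_n$ be the degenerate affine Hecke-Clifford algebra of type $A_{n-1}$ with parameter $\mathbf{k}\in\mathbb{C}$. Then the algebra homomorphism $\zeta:Z(\mathbb{H}^{Cl}_n)\to Z(\mathrm{Seg}_n)_0$ is surjective.
   Context: Everything is over $\mathbb{C}$; $\mathbf{k}\in\mathbb{C}$. $\mathbb{H}^{Cl}_n$ is the unital superalgebra generated by $x_i$ (even), $c_i$ (odd), $1\le i\le n$, and $w\in S_n$ (even) such that $\mathbb{C}[S_n]$ embeds, with relations: $x_ix_j=x_jx_i$; $x_ic_j=c_jx_i$ ($i\ne j$), $x_ic_i=-c_ix_i$; $c_ic_j=-c_jc_i$ ($i\neq j$), $c_i^2=-1$; $wc_i=c_{w(i)}w$; $s_{i,i+1}x_i-x_{i+1}s_{i,i+1}=\mathbf{k}(-1+c_ic_{i+1})$; $s_{i,i+1}x_j=x_js_{i,i+1}$ for $j\ne i,i+1$ (here $s_{i,j}$ is the transposition of $i,j$). $\mathrm{Seg}_n$ (the Sergeev algebra) is the subalgebra generated by $S_n$ and the $c_i$. $Z(\cdot)$ is the center and $Z(\cdot)_0$ its even part; $Z(\mathbb{H}^{Cl}_n)$ is the algebra of symmetric polynomials in $x_1^2,\dots,x_n^2$, so it consists of even elements. Let $D=\sum_{i=1}^nx_ic_i+\sqrt2\,\mathbf{k}\sum_{i<j}s_{i,j}\frac{\sqrt2}{2}(c_i-c_j)$ and $d(h)=Dh-(-1)^{\deg h}hD$ for homogeneous $h\in\mathbb{H}^{Cl}_n$ (extended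 linearly). For $z\in Z(\mathbb{H}^{Cl}_n)$, $\zeta(z)$ is the unique element of $Z(\mathrm{Seg}_n)_0$ with $z-\zeta(z)\in\mathrm{im}\,d$.
   Formalization: The case k = 0 with n ≥ 3 is excluded, because there the claim is false: im d lies in positive x-degree, so ζ has image ℂ·1, while Z(Seg_n)_0 has dimension at least 2; the formal theorem assumes k ≠ 0 or n ≤ 2. *)

theory Defs
  imports
    "HOL-Algebra.Algebra"
    "HOL-Combinatorics.Permutations"
    "HOL-Library.Poly_Mapping"
    Complex_Main
begin

section \<open>The free algebra\<close>

text \<open>
  Words in the generators form the free monoid, written additively so that the convolution
  product of finitely supported functions \<^typ>\<open>'a \<Rightarrow>\<^sub>0 complex\<close> is the product of the free algebra.
\<close>

datatype hc_gen = GX nat | GC nat | GW "nat \<Rightarrow> nat"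

datatype hc_word = Word (letters: "hc_gen list")

instantiation hc_word :: monoid_add
begin

definition "0 = Word []"
definition "u + v = Word (letters u @ letters v)"

instance
  by intro_classes (simp_all add: zero_hc_word_def plus_hc_word_def)

end

type_synonym hc_free = "hc_word \<Rightarrow>\<^sub>0 complex"

definition gens :: "nat \<Rightarrow> hc_gen set" where
  "gens n = GX ` {1..n} \<union> GC ` {1..n} \<union> GW ` {w. w permutes {1..n}}"

definition free_alg :: "nat \<Rightarrow> hc_free ring" where
  "free_alg n = \<lparr>carrier = {f. \<forall>u \<in> Poly_Mapping.keys f. set (letters u) \<subseteq> gens n},
     monoid.mult = (*), one = 1, ring.zero = 0, add = (+)\<rparr>"

definition scal :: "complex \<Rightarrow> hc_free" where
  "scal a = Poly_Mapping.single 0 a"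

definition gen :: "hc_gen \<Rightarrow> hc_free" where
  "gen g = Poly_Mapping.single (Word [g]) 1"

abbreviation xg :: "nat \<Rightarrow> hc_free" where "xg i \<equiv> gen (GX i)"
abbreviation cg :: "nat \<Rightarrow> hc_free" where "cg i \<equiv> gen (GC i)"
abbreviation wg :: "(nat \<Rightarrow> nat) \<Rightarrow> hc_free" where "wg w \<equiv> gen (GW w)"
abbreviation sg :: "nat \<Rightarrow> nat \<Rightarrow> hc_free" where "sg i j \<equiv> wg (transpose i j)"


section \<open>The degenerate affine Hecke-Clifford algebra\<close>

text \<open>Every relation \<open>l = r\<close> is recorded as the element \<open>l - r\<close>.\<close>

inductive_set hc_rels :: "nat \<Rightarrow> complex \<Rightarrow> hc_free set" for n k where
  W_one: "wg id - 1 \<in> hc_rels n k"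
| W_mult: "\<lbrakk>u permutes {1..n}; v permutes {1..n}\<rbrakk> \<Longrightarrow> wg u * wg v - wg (u \<circ> v) \<in> hc_rels n k"
| XX: "\<lbrakk>i \<in> {1..n}; j \<in> {1..n}\<rbrakk> \<Longrightarrow> xg i * xg j - xg j * xg i \<in> hc_rels n k"
| XC: "\<lbrakk>i \<in> {1..n}; j \<in> {1..n}; i \<noteq> j\<rbrakk> \<Longrightarrow> xg i * cg j - cg j * xg i \<in> hc_rels n k"
| XC_same: "i \<in> {1..n} \<Longrightarrow> xg i * cg i - (- (cg i * xg i)) \<in> hc_rels n k"
| CC: "\<lbrakk>i \<in> {1..n}; j \<in> {1..n}; i \<noteq> j\<rbrakk> \<Longrightarrow> cg i * cg j - (- (cg j * cg i)) \<in> hc_rels n k"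
| C_square: "i \<in> {1..n} \<Longrightarrow> cg i * cg i - (- 1) \<in> hc_rels n k"
| WC: "\<lbrakk>w permutes {1..n}; i \<in> {1..n}\<rbrakk> \<Longrightarrow> wg w * cg i - cg (w i) * wg w \<in> hc_rels n k"
| SX: "\<lbrakk>1 \<le> i; i + 1 \<le> n\<rbrakk> \<Longrightarrow>
    (sg i (i + 1) * xg i - xg (i + 1) * sg i (i + 1)) - scal k * (- 1 + cg i * cg (i + 1)) \<in> hc_rels n k"
| SX_far: "\<lbrakk>1 \<le> i; i + 1 \<le> n; j \<in> {1..n}; j \<noteq> i; j \<noteq> i + 1\<rbrakk> \<Longrightarrow>
    sg i (i + 1) * xg j - xg j * sg i (i + 1) \<in> hc_rels n k"

definition hc_ideal :: "nat \<Rightarrow> complex \<Rightarrow> hc_free set" where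
  "hc_ideal n k = Idl\<^bsub>free_alg n\<^esub> (hc_rels n k)"

definition HCl :: "nat \<Rightarrow> complex \<Rightarrow> hc_free set ring" where
  "HCl n k = free_alg n Quot hc_ideal n k"

definition cls :: "nat \<Rightarrow> complex \<Rightarrow> hc_free \<Rightarrow> hc_free set" where
  "cls n k f = hc_ideal n k +>\<^bsub>free_alg n\<^esub> f"

definition hc_smult :: "nat \<Rightarrow> complex \<Rightarrow> complex \<Rightarrow> hc_free set \<Rightarrow> hc_free set" where
  "hc_smult n k a h = cls n k (scal a) \<otimes>\<^bsub>HCl n k\<^esub> h"

text \<open>The superalgebra structure: the \<open>c\<^sub>i\<close> are odd, all other generators are even.\<close>

fun odd_letter :: "hc_gen \<Rightarrow> bool" where
  "odd_letter (GC i) = True"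
| "odd_letter (GX i) = False"
| "odd_letter (GW w) = False"

definition odd_word :: "hc_word \<Rightarrow> bool" where
  "odd_word u \<longleftrightarrow> odd (length (filter odd_letter (letters u)))"

definition hc_even :: "nat \<Rightarrow> complex \<Rightarrow> hc_free set set" where
  "hc_even n k = cls n k ` {f \<in> carrier (free_alg n). \<forall>u \<in> Poly_Mapping.keys f. \<not> odd_word u}"

definition hc_odd :: "nat \<Rightarrow> complex \<Rightarrow> hc_free set set" where
  "hc_odd n k = cls n k ` {f \<in> carrier (free_alg n). \<forall>u \<in> Poly_Mapping.keys f. odd_word u}"


section \<open>The Sergeev algebra and centers\<close>

text \<open>The scalars are included so that the generated subring is the generated subalgebra.\<close>

definition Seg :: "nat \<Rightarrow> complex \<Rightarrow> hc_free set ring" where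
  "Seg n k = (HCl n k)\<lparr>carrier := generate_ring (HCl n k)
     (range (\<lambda>a. cls n k (scal a)) \<union> (\<lambda>w. cls n k (wg w)) ` {w. w permutes {1..n}} \<union>
      (\<lambda>i. cls n k (cg i)) ` {1..n})\<rparr>"

definition ring_center :: "('a, 'b) ring_scheme \<Rightarrow> 'a set" where
  "ring_center R = {z \<in> carrier R. \<forall>h \<in> carrier R. z \<otimes>\<^bsub>R\<^esub> h = h \<otimes>\<^bsub>R\<^esub> z}"

definition ZH :: "nat \<Rightarrow> complex \<Rightarrow> hc_free set ring" where
  "ZH n k = (HCl n k)\<lparr>carrier := ring_center (HCl n k)\<rparr>"

definition ZSeg0 :: "nat \<Rightarrow> complex \<Rightarrow> hc_free set ring" where
  "ZSeg0 n k = (HCl n k)\<lparr>carrier := ring_center (Seg n k) \<inter> hc_even n k\<rparr>"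


section \<open>The Dirac element, the map d and the map \<open>\<zeta>\<close>\<close>

definition Dirac :: "nat \<Rightarrow> complex \<Rightarrow> hc_free set" where
  "Dirac n k = cls n k
     ((\<Sum>i\<in>{1..n}. xg i * cg i) +
      scal (complex_of_real (sqrt 2) * k) *
        (\<Sum>(i, j) \<in> {(i, j). i \<in> {1..n} \<and> j \<in> {1..n} \<and> i < j}.
           sg i j * (scal (complex_of_real (sqrt 2 / 2)) * (cg i - cg j))))"

text \<open>
  The graded commutator with the Dirac element: \<open>Dh - hD\<close> on even and \<open>Dh + hD\<close> on odd elements,
  extended linearly through the decomposition into homogeneous components.
\<close>

definition dmap :: "nat \<Rightarrow> complex \<Rightarrow> hc_free set \<Rightarrow> hc_free set" where
  "dmap n k h = (THE y. \<exists>h0 \<in> hc_even n k. \<exists>h1 \<in> hc_odd n k. h = h0 \<oplus>\<^bsub>HCl n k\<^esub> h1 \<and>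
     y = (Dirac n k \<otimes>\<^bsub>HCl n k\<^esub> h0 \<ominus>\<^bsub>HCl n k\<^esub> h0 \<otimes>\<^bsub>HCl n k\<^esub> Dirac n k) \<oplus>\<^bsub>HCl n k\<^esub>
         (Dirac n k \<otimes>\<^bsub>HCl n k\<^esub> h1 \<oplus>\<^bsub>HCl n k\<^esub> h1 \<otimes>\<^bsub>HCl n k\<^esub> Dirac n k))"

definition is_zeta :: "nat \<Rightarrow> complex \<Rightarrow> hc_free set \<Rightarrow> hc_free set \<Rightarrow> bool" where
  "is_zeta n k z y \<longleftrightarrow> y \<in> carrier (ZSeg0 n k) \<and>
     z \<ominus>\<^bsub>HCl n k\<^esub> y \<in> dmap n k ` carrier (HCl n k)"

definition zeta :: "nat \<Rightarrow> complex \<Rightarrow> hc_free set \<Rightarrow> hc_free set" where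
  "zeta n k z = (THE y. is_zeta n k z y)"


section \<open>Well-definedness\<close>

text \<open>
  The relations lie in the free algebra and are homogeneous, so the quotient is a ring, it is the
  direct sum of its even and odd parts, and \<^const>\<open>dmap\<close> is given by the graded commutator.
\<close>

lemma free_alg_simps [simp]:
  "f \<in> carrier (free_alg n) \<longleftrightarrow> (\<forall>u \<in> Poly_Mapping.keys f. set (letters u) \<subseteq> gens n)"
  "monoid.mult (free_alg n) f g = f * g" "one (free_alg n) = 1" "ring.zero (free_alg n) = 0" "add (free_alg n) f g = f + g"
  by (simp_all add: free_alg_def)

lemma keys_mult': "u \<in> Poly_Mapping.keys (f * g) \<Longrightarrow> \<exists>a\<in>Poly_Mapping.keys f. \<exists>b\<in>Poly_Mapping.keys g. u = a + b"
  using keys_mult[of f g] by blast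

lemma free_add: "f \<in> carrier (free_alg n) \<Longrightarrow> g \<in> carrier (free_alg n) \<Longrightarrow> f + g \<in> carrier (free_alg n)"
  using keys_add[of f g] by auto
lemma free_mult: "f \<in> carrier (free_alg n) \<Longrightarrow> g \<in> carrier (free_alg n) \<Longrightarrow> f * g \<in> carrier (free_alg n)"
  by (force dest!: keys_mult' simp: plus_hc_word_def)
lemma free_uminus: "f \<in> carrier (free_alg n) \<Longrightarrow> - f \<in> carrier (free_alg n)"
  by auto
lemma free_diff: "f \<in> carrier (free_alg n) \<Longrightarrow> g \<in> carrier (free_alg n) \<Longrightarrow> f - g \<in> carrier (free_alg n)"
  using free_add[of f n "-g"] free_uminus[of g n] by simp
lemma free_scal: "scal a \<in> carrier (free_alg n)"
  by (auto simp: scal_def zero_hc_word_def)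
lemma free_one: "1 \<in> carrier (free_alg n)"
  by (auto simp: zero_hc_word_def)
lemma free_gen: "g \<in> gens n \<Longrightarrow> gen g \<in> carrier (free_alg n)"
  by (auto simp: gen_def)

lemma ring_free_alg: "ring (free_alg n)"
proof (rule ringI)
  show "abelian_group (free_alg n)"
  proof (rule abelian_groupI)
    fix x assume x: "x \<in> carrier (free_alg n)"
    show "\<exists>y\<in>carrier (free_alg n). y \<oplus>\<^bsub>free_alg n\<^esub> x = \<zero>\<^bsub>free_alg n\<^esub>"
      using free_uminus[OF x] by (intro bexI[of _ "-x"]) (auto simp del: free_alg_simps(1))
  qed (auto simp: add.assoc add.commute simp del: free_alg_simps(1) intro: free_add, auto)
  show "Group.monoid (free_alg n)"
    by (rule monoidI) (auto simp: mult.assoc simp del: free_alg_simps(1) intro: free_mult free_one)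
qed (auto simp: algebra_simps)

lemma hc_rels_carrier: "hc_rels n k \<subseteq> carrier (free_alg n)"
proof -
  have t: "gen (GW (transpose i j)) \<in> carrier (free_alg n)" if "i \<in> {1..n}" "j \<in> {1..n}" for i j
    using that by (intro free_gen) (auto simp: gens_def permutes_swap_id)
  have w: "gen (GW w) \<in> carrier (free_alg n)" if "w permutes {1..n}" for w
    using that by (intro free_gen) (auto simp: gens_def)
  have xc: "gen (GX i) \<in> carrier (free_alg n)" "gen (GC i) \<in> carrier (free_alg n)" if "i \<in> {1..n}" for i
    using that by (auto intro!: free_gen simp: gens_def simp del: free_alg_simps(1))
  show ?thesis
  proof
    fix r assume "r \<in> hc_rels n k"
    then show "r \<in> carrier (free_alg n)"
    proof cases
      case (WC w i)
      then have "w i \<in> {1..n}" using permutes_in_image by metis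
      then show ?thesis unfolding WC(1) by (intro free_diff free_mult w xc WC)
    next
      case (W_mult u v)
      show ?thesis unfolding W_mult(1)
        by (intro free_diff free_mult w permutes_compose W_mult)
    qed (auto simp del: free_alg_simps(1) simp: permutes_id permutes_swap_id
          intro!: free_add free_diff free_mult free_uminus free_scal free_one w t xc)
  qed
qed

lemma ideal_hc: "ideal (hc_ideal n k) (free_alg n)"
  unfolding hc_ideal_def by (rule ring.genideal_ideal[OF ring_free_alg hc_rels_carrier])

lemma ring_HCl: "ring (HCl n k)"
  unfolding HCl_def by (rule ideal.quotient_is_ring[OF ideal_hc])

lemma cls_hom: "cls n k \<in> ring_hom (free_alg n) (HCl n k)"
  using ideal.rcos_ring_hom[OF ideal_hc] unfolding HCl_def cls_def[abs_def] by (simp add: eta_contract_eq)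

definition sgn_aut :: "hc_free \<Rightarrow> hc_free" where
  "sgn_aut f = Poly_Mapping.mapp (\<lambda>u a. if odd_word u then - a else a) f"

lemma lookup_sgn_aut: "Poly_Mapping.lookup (sgn_aut f) u = (if odd_word u then - Poly_Mapping.lookup f u else Poly_Mapping.lookup f u)"
  by (auto simp: sgn_aut_def mapp.rep_eq when_def in_keys_iff)

lemma sgn_add: "sgn_aut (f + g) = sgn_aut f + sgn_aut g"
  by (rule poly_mapping_eqI) (simp add: lookup_sgn_aut lookup_add)

lemma sgn_single: "sgn_aut (Poly_Mapping.single u a) = Poly_Mapping.single u (if odd_word u then -a else a)"
  by (rule poly_mapping_eqI) (auto simp: lookup_sgn_aut lookup_single when_def)

lemma odd_word_add: "odd_word (u + v) \<longleftrightarrow> odd_word u \<noteq> odd_word v"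
  by (simp add: odd_word_def plus_hc_word_def)

lemma poly_ind: assumes "P 0" "\<And>u a f. P f \<Longrightarrow> P (Poly_Mapping.single u a + f)" shows "P (f :: hc_free)"
proof (induction f rule: update_induct)
  case const then show ?case by (simp add: assms)
next
  case (update f a b)
  have "Poly_Mapping.update a b f = Poly_Mapping.single a b + f"
    using update(1) by (intro poly_mapping_eqI) (auto simp: lookup_update lookup_add lookup_single when_def in_keys_iff)
  with update assms(2) show ?case by simp
qed

lemma sgn_mult: "sgn_aut (f * g) = sgn_aut f * sgn_aut g"
proof -
  have 0: "sgn_aut 0 = 0" by (rule poly_mapping_eqI) (simp add: lookup_sgn_aut)
  have 1: "sgn_aut (Poly_Mapping.single u a * g) = sgn_aut (Poly_Mapping.single u a) * sgn_aut g" for u a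
  proof (induction g rule: poly_ind)
    case (2 v b h)
    then show ?case by (simp add: distrib_left sgn_add mult_single sgn_single odd_word_add)
  qed (simp add: 0)
  show ?thesis
  proof (induction f rule: poly_ind)
    case (2 v b h)
    then show ?case by (simp add: distrib_right sgn_add 1)
  qed (simp add: 0)
qed

lemma keys_sgn: "Poly_Mapping.keys (sgn_aut f) = Poly_Mapping.keys f"
  by (auto simp: in_keys_iff lookup_sgn_aut split: if_splits)
lemma sgn_free: "sgn_aut f \<in> carrier (free_alg n) \<longleftrightarrow> f \<in> carrier (free_alg n)"
  by (simp add: keys_sgn)
lemma sgn_uminus: "sgn_aut (-f) = - sgn_aut f"
  by (rule poly_mapping_eqI) (simp add: lookup_sgn_aut)
lemma sgn_diff: "sgn_aut (f - g) = sgn_aut f - sgn_aut g"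
  by (rule poly_mapping_eqI) (simp add: lookup_sgn_aut lookup_minus)
lemma sgn_one: "sgn_aut 1 = 1"
  using sgn_single[of 0 1] by (simp add: odd_word_def) (simp add: zero_hc_word_def)
lemma sgn_scal: "sgn_aut (scal a) = scal a"
  using sgn_single[of 0 a] by (simp add: scal_def odd_word_def zero_hc_word_def)
lemma sgn_gen: "sgn_aut (gen g) = (if odd_letter g then - gen g else gen g)"
  by (simp add: gen_def sgn_single odd_word_def single_uminus)

lemma sgn_rels: "r \<in> hc_rels n k \<Longrightarrow> sgn_aut r = r \<or> sgn_aut r = - r"
  by (induction rule: hc_rels.induct) (simp_all add: sgn_add sgn_diff sgn_mult sgn_uminus sgn_one sgn_scal sgn_gen)

lemma free_minus: "a_inv (free_alg n) f = - f" if "f \<in> carrier (free_alg n)"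
proof -
  have "(- f) \<oplus>\<^bsub>free_alg n\<^esub> f = \<zero>\<^bsub>free_alg n\<^esub>" by simp
  from abelian_group.minus_equality[OF ring.is_abelian_group[OF ring_free_alg] this that free_uminus[OF that]]
  show ?thesis .
qed

lemma idealD:
  shows "f \<in> hc_ideal n k \<Longrightarrow> f \<in> carrier (free_alg n)"
   "f \<in> hc_ideal n k \<Longrightarrow> g \<in> hc_ideal n k \<Longrightarrow> f + g \<in> hc_ideal n k"
   "f \<in> hc_ideal n k \<Longrightarrow> - f \<in> hc_ideal n k"
   "f \<in> hc_ideal n k \<Longrightarrow> x \<in> carrier (free_alg n) \<Longrightarrow> x * f \<in> hc_ideal n k"
   "f \<in> hc_ideal n k \<Longrightarrow> x \<in> carrier (free_alg n) \<Longrightarrow> f * x \<in> hc_ideal n k"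
   "0 \<in> hc_ideal n k"
proof -
  note I = ideal_hc[of n k]
  note A = ideal.axioms(1)[OF I]
  show c: "f \<in> hc_ideal n k \<Longrightarrow> f \<in> carrier (free_alg n)" by (rule additive_subgroup.a_Hcarr[OF A])
  show "f \<in> hc_ideal n k \<Longrightarrow> g \<in> hc_ideal n k \<Longrightarrow> f + g \<in> hc_ideal n k"
    by (rule additive_subgroup.a_closed[OF A, unfolded free_alg_simps])
  show "- f \<in> hc_ideal n k" if "f \<in> hc_ideal n k"
    using additive_subgroup.a_inv_closed[OF A that]
    unfolding free_minus[OF c[OF that]] .
  show "x * f \<in> hc_ideal n k" if "f \<in> hc_ideal n k" "x \<in> carrier (free_alg n)"
    using ideal.I_l_closed[OF I that] by (simp del: free_alg_simps(1))
  show "f * x \<in> hc_ideal n k" if "f \<in> hc_ideal n k" "x \<in> carrier (free_alg n)"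
    using ideal.I_r_closed[OF I that] by (simp del: free_alg_simps(1))
  show "0 \<in> hc_ideal n k"
    by (rule additive_subgroup.zero_closed[OF A, unfolded free_alg_simps])
qed

lemma sgn_ideal: assumes "f \<in> hc_ideal n k" shows "sgn_aut f \<in> hc_ideal n k"
proof -
  let ?J = "{f \<in> carrier (free_alg n). sgn_aut f \<in> hc_ideal n k}"
  have add: "subgroup ?J (add_monoid (free_alg n))"
  proof -
    interpret R: ring "free_alg n" by (rule ring_free_alg)
    show ?thesis
    proof (rule R.add.subgroupI, goal_cases)
      case 2
      have "sgn_aut 0 = 0" by (rule poly_mapping_eqI) (simp add: lookup_sgn_aut)
      then have "0 \<in> ?J" by (simp add: idealD)
      then show ?case by blast
    next
      case (3 a)
      then show ?case using free_uminus[of a n]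
        by (simp add: free_minus sgn_uminus idealD del: free_alg_simps(1))
    next
      case (4 a b)
      then show ?case using free_add[of a n b] by (simp add: sgn_add idealD del: free_alg_simps(1))
    qed blast
  qed
  have "ideal ?J (free_alg n)"
  proof (rule idealI[OF ring_free_alg add], goal_cases)
    case (1 a x) then show ?case by (simp add: sgn_mult idealD sgn_free free_mult del: free_alg_simps(1))
  next
    case (2 a x) then show ?case by (simp add: sgn_mult idealD sgn_free free_mult del: free_alg_simps(1))
  qed
  moreover have "hc_rels n k \<subseteq> ?J"
    using hc_rels_carrier[of n k] sgn_rels[of _ n k] ring.genideal_self[OF ring_free_alg hc_rels_carrier, of n k]
      idealD(3)[of _ n k] unfolding hc_ideal_def[symmetric]
    by (auto simp del: free_alg_simps(1)) (metis subsetD)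
  ultimately have "hc_ideal n k \<subseteq> ?J"
    unfolding hc_ideal_def by (rule ring.genideal_minimal[OF ring_free_alg])
  with assms show ?thesis by blast
qed

lemma cls_eq: assumes "f \<in> carrier (free_alg n)" "g \<in> carrier (free_alg n)"
  shows "cls n k f = cls n k g \<longleftrightarrow> f - g \<in> hc_ideal n k"
  using ring.quotient_eq_iff_same_a_r_cos[OF ring_free_alg ideal_hc assms, of k] assms(2)
  by (simp add: cls_def a_minus_def free_minus del: free_alg_simps(1))

lemma even_odd_zero: assumes "f \<in> carrier (free_alg n)" "g \<in> carrier (free_alg n)"
  "\<forall>u \<in> Poly_Mapping.keys f. \<not> odd_word u" "\<forall>u \<in> Poly_Mapping.keys g. odd_word u"
  "f + g \<in> hc_ideal n k" shows "f \<in> hc_ideal n k \<and> g \<in> hc_ideal n k"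
proof -
  have "sgn_aut f = f" using assms(3) by (intro poly_mapping_eqI) (auto simp: lookup_sgn_aut in_keys_iff)
  moreover have "sgn_aut g = - g" using assms(4) by (intro poly_mapping_eqI) (auto simp: lookup_sgn_aut in_keys_iff)
  ultimately have d: "f - g \<in> hc_ideal n k" using sgn_ideal[OF assms(5)] by (simp add: sgn_add)
  have e: "scal (1/2) * (f + f) = f" "scal (1/2) * (g + g) = g"
  proof -
    have "scal (1/2) + scal (1/2) = 1" by (simp add: scal_def single_add[symmetric])
    then show "scal (1/2) * (f + f) = f" "scal (1/2) * (g + g) = g"
      by (metis distrib_left distrib_right mult_1)+
  qed
  have "f + f \<in> hc_ideal n k" using idealD(2)[OF assms(5) d] by (simp add: algebra_simps)
  moreover have "g + g \<in> hc_ideal n k" using idealD(2)[OF assms(5) idealD(3)[OF d]] by (simp add: algebra_simps)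
  ultimately show ?thesis using e idealD(4)[OF _ free_scal] by metis
qed

lemma HCl_cls: 
  "carrier (HCl n k) = cls n k ` carrier (free_alg n)"
  by (auto simp: HCl_def FactRing_def A_RCOSETS_defs cls_def a_r_coset_def simp del: free_alg_simps(1))

lemma cls_ops:
  assumes "f \<in> carrier (free_alg n)" "g \<in> carrier (free_alg n)"
  shows "cls n k f \<otimes>\<^bsub>HCl n k\<^esub> cls n k g = cls n k (f * g)" 
    "cls n k f \<oplus>\<^bsub>HCl n k\<^esub> cls n k g = cls n k (f + g)"
  using cls_hom[of n k] assms by (auto simp: ring_hom_def simp del: free_alg_simps(1))

lemma decomp_unique:
  assumes "a \<in> hc_even n k" "a' \<in> hc_even n k" "b \<in> hc_odd n k" "b' \<in> hc_odd n k"
    "a \<oplus>\<^bsub>HCl n k\<^esub> b = a' \<oplus>\<^bsub>HCl n k\<^esub> b'"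
  shows "a = a' \<and> b = b'"
proof -
  obtain f f' g g' where *: "a = cls n k f" "a' = cls n k f'" "b = cls n k g" "b' = cls n k g'"
    "f \<in> carrier (free_alg n)" "f' \<in> carrier (free_alg n)"
    "g \<in> carrier (free_alg n)" "g' \<in> carrier (free_alg n)" 
    "\<forall>u \<in> Poly_Mapping.keys f. \<not> odd_word u" "\<forall>u \<in> Poly_Mapping.keys g. odd_word u"
    "\<forall>u \<in> Poly_Mapping.keys f'. \<not> odd_word u" "\<forall>u \<in> Poly_Mapping.keys g'. odd_word u"
    using assms(1-4) unfolding hc_even_def hc_odd_def by (auto simp del: free_alg_simps(1))
  have "(f + g) - (f' + g') \<in> hc_ideal n k"
    using assms(5) * by (simp add: cls_ops cls_eq free_add del: free_alg_simps(1))
  then have "(f - f') + (g - g') \<in> hc_ideal n k" by (simp add: algebra_simps)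
  then have "f - f' \<in> hc_ideal n k \<and> g - g' \<in> hc_ideal n k"
    by (rule even_odd_zero[rotated 4]) (use * keys_diff[of f f'] keys_diff[of g g'] in \<open>auto simp del: free_alg_simps(1) intro: free_diff\<close>)
  then show ?thesis using * by (simp add: cls_eq del: free_alg_simps(1))
qed

lemma decomp_exists:
  assumes "h \<in> carrier (HCl n k)"
  shows "\<exists>h0 \<in> hc_even n k. \<exists>h1 \<in> hc_odd n k. h = h0 \<oplus>\<^bsub>HCl n k\<^esub> h1"
proof -
  obtain f where f: "f \<in> carrier (free_alg n)" "h = cls n k f"
    using assms unfolding HCl_cls by blast
  define f0 where "f0 = Poly_Mapping.mapp (\<lambda>u a. if odd_word u then 0 else a) f"
  define f1 where "f1 = Poly_Mapping.mapp (\<lambda>u a. if odd_word u then a else 0) f"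
  have "f = f0 + f1"
    by (rule poly_mapping_eqI) (auto simp: f0_def f1_def lookup_add mapp.rep_eq in_keys_iff)
  moreover have "f0 \<in> carrier (free_alg n)" "f1 \<in> carrier (free_alg n)"
    "\<forall>u \<in> Poly_Mapping.keys f0. \<not> odd_word u" "\<forall>u \<in> Poly_Mapping.keys f1. odd_word u"
    using f(1) by (auto simp: f0_def f1_def in_keys_iff mapp.rep_eq split: if_splits)
  ultimately show ?thesis
    using f(2) cls_ops(2)[of f0 n f1 k] unfolding hc_even_def hc_odd_def by blast
qed

lemma dmap_eq:
  assumes "h0 \<in> hc_even n k" "h1 \<in> hc_odd n k"
  shows "dmap n k (h0 \<oplus>\<^bsub>HCl n k\<^esub> h1) = 
    (Dirac n k \<otimes>\<^bsub>HCl n k\<^esub> h0 \<ominus>\<^bsub>HCl n k\<^esub> h0 \<otimes>\<^bsub>HCl n k\<^esub> Dirac n k) \<oplus>\<^bsub>HCl n k\<^esub>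
         (Dirac n k \<otimes>\<^bsub>HCl n k\<^esub> h1 \<oplus>\<^bsub>HCl n k\<^esub> h1 \<otimes>\<^bsub>HCl n k\<^esub> Dirac n k)"
  unfolding dmap_def using assms by (intro the_equality) (blast dest: decomp_unique | metis decomp_unique)+

declare free_alg_simps [simp del]

end

theory Submission
  imports Defs "HOL-Library.Function_Algebras"
begin

text \<open>
  The Jucys-Murphy elements \<open>M\<^sub>i = k \<Sum>\<^bsub>j<i\<^esub> (1 - c\<^sub>j c\<^sub>i) s\<^bsub>ji\<^esub>\<close> of the Sergeev algebra satisfy the relations of
  the \<open>x\<^sub>i\<close>, so \<open>x\<^sub>i \<mapsto> M\<^sub>i\<close> extends to a retraction \<open>\<phi>\<close> of \<open>H\<close> onto the Sergeev algebra. Since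
  \<open>D = \<Sum>\<^sub>i (x\<^sub>i - M\<^sub>i) c\<^sub>i\<close>, it kills \<open>D\<close> and the image of \<open>d\<close>; hence \<open>\<zeta>(z)\<close> can only be \<open>\<phi>(z)\<close>, and \<open>\<zeta>\<close> is
  multiplicative. Conversely a central \<open>z\<close> is congruent to an element of the Sergeev algebra by
  induction on the degree in the \<open>x\<^sub>i\<close>: \<open>D\<close> anticommutes with the \<open>c\<^sub>i\<close> and commutes with
  \<open>S\<^sub>n\<close>, the leading part of \<open>d\<close> is exact in positive degree on the PBW basis, and primitives can
  be averaged over \<open>S\<^sub>n\<close> and the Clifford group.

  For surjectivity, the even center of the Sergeev algebra is spanned by the averages of the
  permutations; those of permutations with an even cycle vanish. An odd cycle with \<open>2a + 1\<close>
  letters can be split off a permutation, because the central element \<open>\<Sum>\<^sub>i x\<^sub>i\<^sup>2\<^sup>a\<close> is sent to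
  \<open>\<Sum>\<^sub>i M\<^sub>i\<^sup>2\<^sup>a\<close>, whose part moving the most points is made of such cycles; one concludes by induction
  on the number of moved points.
\<close>

text \<open>The restriction on \<open>k\<close> and \<open>n\<close> is genuine. For k = 0 all
  \<open>M i\<close> vanish, so \<phi> sends every x_i to 0 and zeta takes only scalar values, while
  for n >= 3 the average of a 3-cycle is an even central Sergeev element that is not a scalar. For n
  <= 2 no nontrivial odd cycle exists.

  The obstacle in the degree induction is that the square of D is not central: it is the central sum
  of the x_i^2 minus an element of the Sergeev algebra. So d need not square to zero, and after an
  exact term has been subtracted the remainder need not commute with D. The averaging repairs this:
  D^2 does commute with primitives that commute with S_n and anticommute with all c_i, and
  subtracting their images also keeps the remainder invariant.

  Averages behave like a trace: Clifford generators may be moved cyclically. This kills the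
  permutations with an even cycle, reduces every even Clifford multiple of a permutation to the
  permutation itself, and gives all leading terms of a power sum the same nonzero coefficient, so
  that they cannot cancel.\<close>

declare atLeastAtMost_iff [simp del] One_nat_def [simp del] comp_def [simp del] id_def [simp del]

section \<open>Commutation up to sign\<close>

definition sgn_mult :: "bool \<Rightarrow> 'a::ring \<Rightarrow> 'a" where
  "sgn_mult p a = (if p then - a else a)"

text \<open>The flag records whether exchanging the factors costs a sign. Flags of products combine
  by exclusive or, so supercommutation is derived from the generators by introduction rules
  alone.\<close>

definition scomm :: "bool \<Rightarrow> 'a::ring \<Rightarrow> 'a \<Rightarrow> bool" where
  "scomm p a b \<longleftrightarrow> a * b = sgn_mult p (b * a)"

lemma scomm_sym: "scomm p a b \<Longrightarrow> scomm p b a"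
  by (auto simp: scomm_def sgn_mult_def)

lemma scomm_mult: "scomm p a b \<Longrightarrow> scomm q a b' \<Longrightarrow> r = (p \<noteq> q) \<Longrightarrow> scomm r a (b * b')"
  unfolding scomm_def sgn_mult_def
  by (metis (full_types) minus_minus mult.assoc mult_minus_left mult_minus_right)

lemma scomm_add: "scomm p a b \<Longrightarrow> scomm p a b' \<Longrightarrow> scomm p a (b + b')"
  by (auto simp: scomm_def sgn_mult_def distrib_left distrib_right)

lemma scomm_diff: "scomm p a b \<Longrightarrow> scomm p a b' \<Longrightarrow> scomm p a (b - b')"
  by (auto simp: scomm_def sgn_mult_def left_diff_distrib right_diff_distrib)

lemma scomm_minus: "scomm p a b \<Longrightarrow> scomm p a (- b)"
  by (auto simp: scomm_def sgn_mult_def)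

lemma scomm_0: "scomm p a 0"
  by (auto simp: scomm_def sgn_mult_def)

lemma scomm_mult_left: "scomm p b a \<Longrightarrow> scomm q b' a \<Longrightarrow> r = (p \<noteq> q) \<Longrightarrow> scomm r (b * b') a"
  by (blast intro: scomm_sym[OF scomm_mult[OF scomm_sym scomm_sym]])

lemma scomm_0_left: "scomm p 0 a"
  by (rule scomm_sym[OF scomm_0])

lemma scomm_add_left: "scomm p b a \<Longrightarrow> scomm p b' a \<Longrightarrow> scomm p (b + b') a"
  by (rule scomm_sym[OF scomm_add[OF scomm_sym scomm_sym]])

lemma scomm_sum: "(\<And>i. i \<in> A \<Longrightarrow> scomm p a (f i)) \<Longrightarrow> scomm p a (\<Sum>i\<in>A. f i)"
  by (induction A rule: infinite_finite_induct) (auto simp: scomm_0 scomm_add)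

lemma scommD: "scomm True a b \<Longrightarrow> a * b = - (b * a)" "scomm False a b \<Longrightarrow> a * b = b * a"
  by (auto simp: scomm_def sgn_mult_def)

lemma scommI: "a * b = - (b * a) \<Longrightarrow> scomm True a b" "a * b = b * a \<Longrightarrow> scomm False a b"
  by (auto simp: scomm_def sgn_mult_def)

section \<open>Permutations generated by adjacent transpositions\<close>

text \<open>Conjugation by (b, b + 1) turns (a, b) into (a, b + 1), which gives an induction on the
  distance. In this way relations stated only for adjacent transpositions reach all of S_n.\<close>

lemma transpose_adjacent_closed:
  fixes n :: nat
  assumes adj: "\<And>l v. 1 \<le> l \<Longrightarrow> l + 1 \<le> n \<Longrightarrow> v \<in> Q \<Longrightarrow> transpose l (l + 1) \<circ> v \<in> Q"
    and "1 \<le> a" "a + d + 1 \<le> n" "v \<in> Q"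
  shows "transpose a (a + d + 1) \<circ> v \<in> Q"
  using assms(3,4)
proof (induction d arbitrary: v)
  case 0
  then show ?case using adj[of a v] assms(2) by (simp add: comp_def)
next
  case (Suc d)
  let ?b = "a + d + 1"
  have eq: "transpose a (?b + 1) = transpose ?b (?b + 1) \<circ> (transpose a ?b \<circ> transpose ?b (?b + 1))"
    by (rule ext) (auto simp: transpose_def)
  have "transpose ?b (?b + 1) \<circ> v \<in> Q"
    by (rule adj) (use Suc.prems assms(2) in simp_all)
  then have "transpose a ?b \<circ> (transpose ?b (?b + 1) \<circ> v) \<in> Q"
    by (rule Suc.IH[rotated]) (use Suc.prems in simp)
  then have "transpose ?b (?b + 1) \<circ> (transpose a ?b \<circ> (transpose ?b (?b + 1) \<circ> v)) \<in> Q"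
    by (rule adj[rotated 2]) (use Suc.prems assms(2) in simp_all)
  then have "transpose a (?b + 1) \<circ> v \<in> Q" using eq by (simp add: comp_def)
  moreover have "a + Suc d + 1 = ?b + 1" by simp
  ultimately show ?case by (simp only: comp_def)
qed

lemma permutes_adjacent_induct [consumes 1, case_names id adjacent]:
  assumes "u permutes {1..n::nat}" "P id"
    and adj: "\<And>l u. 1 \<le> l \<Longrightarrow> l + 1 \<le> n \<Longrightarrow> u permutes {1..n} \<Longrightarrow> P u \<Longrightarrow> P (transpose l (l + 1) \<circ> u)"
  shows "P u"
proof -
  let ?Q = "{u. u permutes {1..n} \<and> P u}"
  have "u \<in> ?Q"
    using assms(1) finite_atLeastAtMost[of 1 n]
  proof (induction rule: permutes_induct)
    case id
    then show ?case using assms(2) permutes_id by (simp add: id_def[symmetric])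
  next
    case (swap a b p)
    have step: "transpose l (l + 1) \<circ> v \<in> ?Q" if "1 \<le> l" "l + 1 \<le> n" "v \<in> ?Q" for l v
      using that adj[of l v] by (auto intro!: permutes_compose permutes_swap_id simp: atLeastAtMost_iff)
    have *: "transpose a b \<circ> p \<in> ?Q" if "a < b" "a \<in> {1..n}" "b \<in> {1..n}" for a b
      using transpose_adjacent_closed[where Q = ?Q and n = n and a = a and d = "b - a - 1" and v = p] that swap step
      by (auto simp: atLeastAtMost_iff)
    show ?case
      using *[of a b] *[of b a] swap by (cases "a < b") (auto simp: transpose_commute comp_def)
  qed
  then show ?thesis by simp
qed

section \<open>The relations of the degenerate affine Hecke-Clifford algebra\<close>

text \<open>
  The ambient type is only assumed to be a ring without unit: \<open>S 1\<close> plays the role of the unit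
  of the algebra, which sits as a corner in a product of rings.
\<close>

locale hc_alg =
  fixes n :: nat and k :: complex and S :: "complex \<Rightarrow> 'a::ring"
    and x c :: "nat \<Rightarrow> 'a" and w :: "(nat \<Rightarrow> nat) \<Rightarrow> 'a"
  assumes S_add: "S (a + b) = S a + S b"
    and S_mult: "S (a * b) = S a * S b"
    and S_x: "i \<in> {1..n} \<Longrightarrow> S a * x i = x i * S a"
    and S_c: "i \<in> {1..n} \<Longrightarrow> S a * c i = c i * S a"
    and S_w: "u permutes {1..n} \<Longrightarrow> S a * w u = w u * S a"
    and one_x: "i \<in> {1..n} \<Longrightarrow> S 1 * x i = x i"
    and one_c: "i \<in> {1..n} \<Longrightarrow> S 1 * c i = c i"
    and one_w: "u permutes {1..n} \<Longrightarrow> S 1 * w u = w u"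
    and w_id: "w id = S 1"
    and w_mult: "u permutes {1..n} \<Longrightarrow> v permutes {1..n} \<Longrightarrow> w u * w v = w (u \<circ> v)"
    and xx: "i \<in> {1..n} \<Longrightarrow> j \<in> {1..n} \<Longrightarrow> x i * x j = x j * x i"
    and xc: "i \<in> {1..n} \<Longrightarrow> j \<in> {1..n} \<Longrightarrow> scomm (i = j) (x i) (c j)"
    and cc: "i \<in> {1..n} \<Longrightarrow> j \<in> {1..n} \<Longrightarrow> i \<noteq> j \<Longrightarrow> scomm True (c i) (c j)"
    and cc_same: "i \<in> {1..n} \<Longrightarrow> c i * c i = - S 1"
    and wc: "u permutes {1..n} \<Longrightarrow> i \<in> {1..n} \<Longrightarrow> w u * c i = c (u i) * w u"
    and sx: "1 \<le> i \<Longrightarrow> i + 1 \<le> n \<Longrightarrow>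
      w (transpose i (i + 1)) * x i =
        x (i + 1) * w (transpose i (i + 1)) + S k * (- S 1 + c i * c (i + 1))"
    and sx_far: "1 \<le> i \<Longrightarrow> i + 1 \<le> n \<Longrightarrow> j \<in> {1..n} \<Longrightarrow> j \<noteq> i \<Longrightarrow> j \<noteq> i + 1 \<Longrightarrow>
      w (transpose i (i + 1)) * x j = x j * w (transpose i (i + 1))"
begin

abbreviation I :: "nat set" where "I \<equiv> {1..n}"
abbreviation E :: 'a where "E \<equiv> S 1"

lemma S_0 [simp]: "S 0 = 0"
  using S_add[of 0 0] by simp

lemma S_minus: "S (- a) = - S a"
  using S_add[of a "- a"] by (simp add: eq_neg_iff_add_eq_0 add.commute)

lemma swap_permutes [simp]: "i \<in> I \<Longrightarrow> j \<in> I \<Longrightarrow> transpose i j permutes I"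
  by (rule permutes_swap_id)

lemma permutes_mem [simp]: "u permutes I \<Longrightarrow> u i \<in> I \<longleftrightarrow> i \<in> I"
  by (rule permutes_in_image)

lemma less_mem: "l \<in> I \<Longrightarrow> j \<in> {1..<l} \<Longrightarrow> j \<in> I"
  by (simp add: atLeastAtMost_iff)

text \<open>
  In \<open>Fl p m h\<close> and \<open>Cl p h\<close> the index \<open>p\<close> is the parity (\<open>True\<close> for odd) and \<open>m\<close> bounds the degree in
  the \<open>x\<^sub>i\<close>; the two parities need not be independent here.
\<close>

inductive Fl :: "bool \<Rightarrow> nat \<Rightarrow> 'a \<Rightarrow> bool" where
  Fl_S: "Fl False m (S a)"
| Fl_0: "Fl p m 0"
| Fl_add: "Fl p m g \<Longrightarrow> Fl p m h \<Longrightarrow> Fl p m (g + h)"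
| Fl_x: "i \<in> {1..n} \<Longrightarrow> Fl p m h \<Longrightarrow> Fl p (Suc m) (x i * h)"
| Fl_c: "i \<in> {1..n} \<Longrightarrow> Fl p m h \<Longrightarrow> Fl (\<not> p) m (c i * h)"
| Fl_w: "u permutes {1..n} \<Longrightarrow> Fl p m h \<Longrightarrow> Fl p m (w u * h)"

inductive Cl :: "bool \<Rightarrow> 'a \<Rightarrow> bool" where
  Cl_S: "Cl False (S a)"
| Cl_0: "Cl p 0"
| Cl_add: "Cl p g \<Longrightarrow> Cl p h \<Longrightarrow> Cl p (g + h)"
| Cl_c: "i \<in> {1..n} \<Longrightarrow> Cl p h \<Longrightarrow> Cl (\<not> p) (c i * h)"

text \<open>\<open>E\<close> is neutral on what the generators produce but not on the ambient ring,
  so the unit laws come from an induction on \<open>Fl\<close>.\<close>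

lemma Fl_one: "Fl p m h \<Longrightarrow> E * h = h" and Fl_one': "Fl p m h \<Longrightarrow> h * E = h"
  and Fl_central: "Fl p m h \<Longrightarrow> S a * h = h * S a"
proof -
  have "E * h = h \<and> h * E = h \<and> S a * h = h * S a" if "Fl p m h"
    using that
  proof induction
    case (Fl_S m b)
    then show ?case by (simp flip: S_mult add: mult.commute)
  qed (simp_all add: distrib_left distrib_right mult.assoc,
      simp_all flip: mult.assoc add: one_x one_c one_w S_x S_c S_w,
      simp_all add: mult.assoc)
  then show "Fl p m h \<Longrightarrow> E * h = h" "Fl p m h \<Longrightarrow> h * E = h" "Fl p m h \<Longrightarrow> S a * h = h * S a"
    by auto
qed

lemma Fl_mono: "Fl p m h \<Longrightarrow> m \<le> m' \<Longrightarrow> Fl p m' h"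
proof (induction arbitrary: m' rule: Fl.induct)
  case (Fl_x i p m h)
  then obtain l where "m' = Suc l" "m \<le> l" by (cases m') auto
  then show ?case using Fl_x by (auto intro: Fl.Fl_x)
qed (auto intro: Fl.intros)

lemma Fl_smult: "Fl p m h \<Longrightarrow> Fl p m (S a * h)"
proof (induction rule: Fl.induct)
  case (Fl_S m b)
  then show ?case by (simp flip: S_mult add: Fl.Fl_S)
next
  case (Fl_add p m g h)
  then show ?case by (simp add: distrib_left Fl.Fl_add)
next
  case (Fl_x i p m h)
  then show ?case by (simp flip: mult.assoc add: S_x) (simp add: mult.assoc Fl.Fl_x)
next
  case (Fl_c i p m h)
  then show ?case by (simp flip: mult.assoc add: S_c) (simp add: mult.assoc Fl.Fl_c)
next
  case (Fl_w u p m h)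
  then show ?case by (simp flip: mult.assoc add: S_w) (simp add: mult.assoc Fl.Fl_w)
qed (auto intro: Fl.intros)

lemma Fl_mult: "Fl p m g \<Longrightarrow> Fl q l h \<Longrightarrow> Fl (p \<noteq> q) (m + l) (g * h)"
proof (induction rule: Fl.induct)
  case (Fl_S m a)
  then show ?case using Fl_mono[OF Fl_smult[of q l h a], of "m + l"] by simp
next
  case (Fl_c i p m h')
  then show ?case using Fl.Fl_c[of i "p \<noteq> q" "m + l" "h' * h"] by (auto simp: mult.assoc)
qed (auto simp: distrib_right mult.assoc intro: Fl.intros)

lemma Fl_mult': "Fl p m g \<Longrightarrow> Fl q l h \<Longrightarrow> r = (p \<noteq> q) \<Longrightarrow> m + l \<le> t \<Longrightarrow> Fl r t (g * h)"
  using Fl_mult Fl_mono by blast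

lemma Fl_minus: "Fl p m h \<Longrightarrow> Fl p m (- h)"
  using Fl_smult[of p m h "-1"] by (simp add: S_minus Fl_one)

lemma Fl_diff: "Fl p m g \<Longrightarrow> Fl p m h \<Longrightarrow> Fl p m (g - h)"
  using Fl_add[OF _ Fl_minus, of p m g h] by simp

lemma Fl_sum: "(\<And>i. i \<in> A \<Longrightarrow> Fl p m (f i)) \<Longrightarrow> Fl p m (\<Sum>i\<in>A. f i)"
  by (induction A rule: infinite_finite_induct) (auto intro: Fl.intros)

lemma x_one: "i \<in> I \<Longrightarrow> x i * E = x i" and c_one: "i \<in> I \<Longrightarrow> c i * E = c i"
  and w_one: "u permutes I \<Longrightarrow> w u * E = w u"
  using S_x[of i 1] S_c[of i 1] S_w[of u 1] one_x one_c one_w by auto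

lemma Fl_x1: "i \<in> I \<Longrightarrow> Fl False 1 (x i)" and Fl_c1: "i \<in> I \<Longrightarrow> Fl True m (c i)"
  and Fl_w1: "u permutes I \<Longrightarrow> Fl False m (w u)"
  using Fl_x[OF _ Fl_S[of 0 1], of i] Fl_c[OF _ Fl_S[of m 1], of i] Fl_w[OF _ Fl_S[of m 1], of u]
  by (auto simp: x_one c_one w_one One_nat_def)

lemma Cl_Fl: "Cl p b \<Longrightarrow> Fl p m b"
  by (induction rule: Cl.induct) (auto intro: Fl.intros)

lemma Cl_smult: "Cl p b \<Longrightarrow> Cl p (S a * b)"
proof (induction rule: Cl.induct)
  case (Cl_S b)
  then show ?case by (simp flip: S_mult add: Cl.Cl_S)
next
  case (Cl_add p g h)
  then show ?case by (simp add: distrib_left Cl.Cl_add)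
next
  case (Cl_c i p h)
  then show ?case by (simp flip: mult.assoc add: S_c) (simp add: mult.assoc Cl.Cl_c)
qed (auto intro: Cl.intros)

lemma Cl_mult: "Cl p g \<Longrightarrow> Cl q h \<Longrightarrow> Cl (p \<noteq> q) (g * h)"
proof (induction rule: Cl.induct)
  case (Cl_S a)
  then show ?case using Cl_smult[of q h a] by simp
next
  case (Cl_c i p h')
  then show ?case using Cl.Cl_c[of i "p \<noteq> q" "h' * h"] by (auto simp: mult.assoc)
qed (auto simp: distrib_right mult.assoc intro: Cl.intros)

lemma Cl_mult': "Cl p g \<Longrightarrow> Cl q h \<Longrightarrow> r = (p \<noteq> q) \<Longrightarrow> Cl r (g * h)"
  using Cl_mult by blast

lemma Cl_minus: "Cl p h \<Longrightarrow> Cl p (- h)"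
  using Cl_smult[of p h "-1"] Fl_one[OF Cl_Fl] by (simp add: S_minus)

lemma Cl_diff: "Cl p g \<Longrightarrow> Cl p h \<Longrightarrow> Cl p (g - h)"
  using Cl_add[OF _ Cl_minus, of p g h] by simp

lemma Cl_sum: "(\<And>i. i \<in> A \<Longrightarrow> Cl p (f i)) \<Longrightarrow> Cl p (\<Sum>i\<in>A. f i)"
  by (induction A rule: infinite_finite_induct) (auto intro: Cl.intros)

lemma Cl_c1: "i \<in> I \<Longrightarrow> Cl True (c i)"
  using Cl_c[OF _ Cl_S[of 1], of i] by (simp add: c_one)

lemma scomm_S: "Fl p m h \<Longrightarrow> scomm False h (S a)"
  by (simp add: Fl_central scommI)

lemma c_c_cancel: "i \<in> I \<Longrightarrow> Fl p m h \<Longrightarrow> c i * (c i * h) = - h"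
  by (simp flip: mult.assoc add: cc_same Fl_one)

abbreviation pinv :: "(nat \<Rightarrow> nat) \<Rightarrow> nat \<Rightarrow> nat" where "pinv u \<equiv> inv_into UNIV u"

lemma w_cancel_right: "u permutes I \<Longrightarrow> Fl p m h \<Longrightarrow> h * w u * w (pinv u) = h"
  "u permutes I \<Longrightarrow> Fl p m h \<Longrightarrow> h * w (pinv u) * w u = h"
  by (simp_all add: mult.assoc w_mult permutes_inv permutes_inv_o w_id Fl_one')

subsection \<open>Jucys-Murphy elements\<close>

definition T :: "nat \<Rightarrow> nat \<Rightarrow> 'a" where
  "T j i = (E - c j * c i) * w (transpose j i)"

definition M :: "nat \<Rightarrow> 'a" where
  "M i = S k * (\<Sum>j\<in>{1..<i}. T j i)"

lemma Fl_T: "i \<in> I \<Longrightarrow> j \<in> I \<Longrightarrow> Fl False m (T j i)"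
  unfolding T_def
  by (intro Fl_mult'[where p = False and q = False and m = m and l = 0] Fl_diff Fl_w1 Fl_S
      Fl_mult'[where p = True and q = True and m = m and l = 0 and r = False and g = "c j"] Fl_c1) auto

lemma Fl_M: "i \<in> I \<Longrightarrow> Fl False m (M i)"
  unfolding M_def by (intro Fl_smult Fl_sum Fl_T) (auto simp: atLeastAtMost_iff)

lemma T_times_c:
  assumes "i \<in> I" "j \<in> I" "i \<noteq> j"
  shows "T j i * c i = (c j - c i) * w (transpose j i)" "c i * T j i = (c i - c j) * w (transpose j i)"
    "T j i * c j = (c i + c j) * w (transpose j i)" "c j * T j i = (c j + c i) * w (transpose j i)"
proof -
  let ?s = "w (transpose j i)"
  have s: "?s * c i = c j * ?s" "?s * c j = c i * ?s"
    using assms by (simp_all add: wc)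
  have a: "c i * c j = - (c j * c i)" using cc[of i j] assms scommD by blast
  have r1: "c j * c i * c j = c i" using assms a
    by (simp add: mult.assoc, simp flip: mult.assoc add: cc_same one_c)
  have r2: "c i * c j * c i = c j" using assms a
    by (simp add: mult.assoc cc_same c_one)
  have r3: "c j * c i * c i = - c j" "c j * (c j * c i) = - c i" using assms
    by (simp_all add: mult.assoc cc_same c_one, simp flip: mult.assoc add: cc_same one_c)
  show "T j i * c i = (c j - c i) * ?s" using assms
    by (simp add: T_def mult.assoc s) (simp flip: mult.assoc add: left_diff_distrib one_c r1)
  show "c i * T j i = (c i - c j) * ?s" using assms
    by (simp add: T_def flip: mult.assoc) (simp add: right_diff_distrib c_one r2 flip: mult.assoc)
  show "T j i * c j = (c i + c j) * ?s" using assms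
    by (simp add: T_def mult.assoc s) (simp flip: mult.assoc add: left_diff_distrib one_c r3)
  show "c j * T j i = (c j + c i) * ?s" using assms
    by (simp add: T_def flip: mult.assoc) (simp add: right_diff_distrib c_one r3)
qed

text \<open>The sign pattern is that of \<open>x i\<close> in the relation \<open>xc\<close>. The
  factor 1 - c_j c_i achieves it, whereas the bare transposition would only exchange c_i and
  c_j.\<close>

lemma T_c: "i \<in> I \<Longrightarrow> j \<in> I \<Longrightarrow> l \<in> I \<Longrightarrow> i \<noteq> j \<Longrightarrow> scomm (l = i) (T j i) (c l)"
proof (goal_cases)
  case 1
  consider "l = i" | "l = j" "l \<noteq> i" | "l \<noteq> i" "l \<noteq> j" by blast
  then show ?case
  proof cases
    case 1
    then show ?thesis using \<open>i \<in> I\<close> \<open>j \<in> I\<close> \<open>i \<noteq> j\<close>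
      by (auto simp: T_times_c scomm_def sgn_mult_def left_diff_distrib)
  next
    case 2
    then show ?thesis using \<open>i \<in> I\<close> \<open>j \<in> I\<close> \<open>i \<noteq> j\<close>
      by (auto simp: T_times_c scomm_def sgn_mult_def distrib_right)
  next
    case 3
    have "scomm False (c l) (w (transpose j i))"
      using 3 wc[of "transpose j i" l] \<open>i \<in> I\<close> \<open>j \<in> I\<close> \<open>l \<in> I\<close>
      by (auto intro!: scommI simp: transpose_def)
    moreover have "scomm False (c l) (c j * c i)"
      by (rule scomm_mult[of True _ _ True]) (use 3 1 in \<open>auto intro!: cc\<close>)
    moreover have "scomm False (c l) E"
      by (rule scomm_S[OF Fl_c1[OF \<open>l \<in> I\<close>]])
    ultimately show ?thesis unfolding T_def using 3
      by (auto intro!: scomm_sym[of _ "c l"] intro: scomm_mult[of False _ _ False] scomm_diff)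
  qed
qed

lemma w_T: "u permutes I \<Longrightarrow> i \<in> I \<Longrightarrow> j \<in> I \<Longrightarrow> w u * T j i = T (u j) (u i) * w u"
proof -
  assume a: "u permutes I" "i \<in> I" "j \<in> I"
  have "w u * (c j * c i) = c (u j) * c (u i) * w u"
    using a by (simp flip: mult.assoc add: wc) (simp add: mult.assoc wc)
  moreover have "u \<circ> transpose j i = transpose (u j) (u i) \<circ> u"
    using permutes_inj[OF a(1)] by (auto simp: fun_eq_iff transpose_def inj_eq)
  then have "w u * w (transpose j i) = w (transpose (u j) (u i)) * w u"
    using a by (simp add: w_mult)
  ultimately have "w u * ((E - c j * c i) * w (transpose j i)) =
      (E - c (u j) * c (u i)) * (w u * w (transpose j i))"
    using a by (simp flip: mult.assoc add: right_diff_distrib left_diff_distrib w_one one_w)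
      (simp add: mult.assoc)
  also have "w u * w (transpose j i) = w (transpose (u j) (u i)) * w u" by fact
  finally show ?thesis by (simp add: T_def mult.assoc)
qed

text \<open>Such a \<open>u\<close> merely permutes the summands \<open>T j l\<close> of
  \<open>M l\<close>.\<close>

lemma w_M: assumes u: "u permutes I" and l: "l \<in> I" and b: "\<And>j. j \<in> {1..<l} \<Longrightarrow> u j \<in> {1..<l}"
    and "u l = l"
  shows "w u * M l = M l * w u"
proof -
  have "w u * M l = S k * (\<Sum>j\<in>{1..<l}. w u * T j l)"
    unfolding M_def using S_w[OF u] by (simp flip: mult.assoc add: sum_distrib_left)
  also have "(\<Sum>j\<in>{1..<l}. w u * T j l) = (\<Sum>j\<in>{1..<l}. T (u j) l * w u)"
    using assms(1,2,4) by (intro sum.cong refl) (simp add: w_T less_mem[OF l])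
  also have "\<dots> = (\<Sum>j\<in>{1..<l}. T j l) * w u"
  proof -
    have "u ` {1..<l} = {1..<l}"
      using b by (intro endo_inj_surj) (auto intro: inj_on_subset[OF permutes_inj[OF u]])
    then have "bij_betw u {1..<l} {1..<l}"
      by (auto simp: bij_betw_def intro: inj_on_subset[OF permutes_inj[OF u]])
    from sum.reindex_bij_betw[OF this, of "\<lambda>j. T j l * w u"] show ?thesis
      by (simp add: sum_distrib_right)
  qed
  finally show ?thesis by (simp add: M_def mult.assoc)
qed

lemma M_c: assumes i: "i \<in> I" and l: "l \<in> I" shows "scomm (i = l) (M i) (c l)"
proof -
  have "scomm (i = l) (c l) (T j i)" if "j \<in> {1..<i}" for j
    using T_c[OF i less_mem[OF i that] l] that by (auto simp: eq_commute[of i l] intro: scomm_sym)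
  then have "scomm (i = l) (c l) (\<Sum>j\<in>{1..<i}. T j i)" by (rule scomm_sum)
  from scomm_mult[OF scomm_S[OF Fl_c1[OF l]] this] show ?thesis
    unfolding M_def by (rule scomm_sym) simp
qed

text \<open>Conjugation carries the summands of \<open>M l\<close> to those of
  \<open>M (l + 1)\<close> except \<open>T l (l + 1)\<close>. The product of that one with the
  transposition is 1 - c_l c_(l+1), whence the inhomogeneous term.\<close>

lemma s_M: assumes "1 \<le> l" "l + 1 \<le> n"
  shows "w (transpose l (l + 1)) * M l =
    M (l + 1) * w (transpose l (l + 1)) + S k * (- E + c l * c (l + 1))"
proof -
  let ?s = "transpose l (l + 1)"
  have s: "?s permutes I" using assms by (intro swap_permutes) (auto simp: atLeastAtMost_iff)
  have "w ?s * M l = S k * (\<Sum>j\<in>{1..<l}. w ?s * T j l)"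
    unfolding M_def using S_w[OF s] by (simp flip: mult.assoc add: sum_distrib_left)
  also have "(\<Sum>j\<in>{1..<l}. w ?s * T j l) = (\<Sum>j\<in>{1..<l}. T j (l + 1) * w ?s)"
    using assms s by (intro sum.cong refl) (auto simp: w_T atLeastAtMost_iff transpose_def)
  also have "\<dots> = (\<Sum>j\<in>{1..<l + 1}. T j (l + 1) * w ?s) - T l (l + 1) * w ?s"
    using assms by (simp add: atLeastLessThanSuc flip: Suc_eq_plus1)
  also have "T l (l + 1) * w ?s = E - c l * c (l + 1)"
    using s assms by (simp add: T_def mult.assoc w_mult w_id right_diff_distrib left_diff_distrib c_one atLeastAtMost_iff flip: S_mult)
  also have "S k * ((\<Sum>j\<in>{1..<l + 1}. T j (l + 1) * w ?s) - (E - c l * c (l + 1))) =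
      M (l + 1) * w ?s + S k * (- E + c l * c (l + 1))"
    by (simp add: M_def right_diff_distrib distrib_left mult.assoc sum_distrib_right)
  finally show ?thesis .
qed

lemma s_M_far: assumes "1 \<le> l" "l + 1 \<le> n" "j \<in> I" "j \<noteq> l" "j \<noteq> l + 1"
  shows "w (transpose l (l + 1)) * M j = M j * w (transpose l (l + 1))"
  by (rule w_M) (use assms in \<open>auto simp: transpose_def atLeastAtMost_iff intro!: swap_permutes\<close>)

text \<open>For i < j already each \<open>T a i\<close> with a < i commutes with \<open>M j\<close>:
  the transposition of a and i permutes {1..<j} and fixes j, and neither c_a nor c_i is c_j.\<close>

lemma M_M: assumes "i \<in> I" "j \<in> I" shows "M i * M j = M j * M i"
proof -
  have "M i * M j = M j * M i" if ij: "i < j" "i \<in> I" "j \<in> I" for i j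
  proof -
    have "scomm False (M j) (T a i)" if a: "a \<in> {1..<i}" for a
    proof -
      have "scomm False (M j) (w (transpose a i))"
        using a ij by (intro scommI(2) w_M[symmetric]) (auto simp: transpose_def atLeastAtMost_iff intro!: swap_permutes)
      moreover have "scomm False (M j) (c a * c i)"
        using M_c[of j a] M_c[of j i] a ij by (intro scomm_mult[of False _ _ False]) (auto simp: atLeastAtMost_iff)
      moreover have "scomm False (M j) E" by (rule scomm_S[OF Fl_M]) (use ij in auto)
      ultimately show ?thesis unfolding T_def
        by (intro scomm_mult[of False _ "E - c a * c i" False] scomm_diff) auto
    qed
    then have "scomm False (M j) (\<Sum>a\<in>{1..<i}. T a i)" by (rule scomm_sum)
    then have "scomm False (M j) (M i)" unfolding M_def[of i]
      by (intro scomm_mult[of False _ _ False] scomm_S[OF Fl_M[OF ij(3)]]) auto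
    then show ?thesis by (simp add: scommD)
  qed
  from this[of i j] this[of j i] assms show ?thesis by (cases i j rule: linorder_cases) auto
qed

text \<open>The elements \<open>N\<^sub>i\<close> do not commute, but \<open>S\<^sub>n\<close> permutes them.\<close>

definition N :: "nat \<Rightarrow> 'a" where "N i = x i - M i"

lemma Fl_N: "i \<in> I \<Longrightarrow> Fl False 1 (N i)"
  unfolding N_def by (intro Fl_diff Fl_x1 Fl_M)

lemma N_c: "i \<in> I \<Longrightarrow> l \<in> I \<Longrightarrow> scomm (i = l) (N i) (c l)"
  unfolding N_def
  by (intro scomm_sym[of _ "c l"] scomm_diff) (auto intro: scomm_sym xc M_c)

text \<open>\<open>x\<close> and \<open>M\<close> satisfy the adjacent exchange relation with the
  same inhomogeneous term, which therefore cancels in \<open>N\<close>.\<close>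

lemma w_N: "u permutes I \<Longrightarrow> i \<in> I \<Longrightarrow> w u * N i = N (u i) * w u"
proof (induction arbitrary: i rule: permutes_adjacent_induct)
  case id
  then show ?case using Fl_one[OF Fl_N] Fl_one'[OF Fl_N] w_id by (metis id_apply)
next
  case (adjacent l u)
  let ?s = "transpose l (l + 1)"
  have s: "?s permutes I" using adjacent by (intro swap_permutes) (auto simp: atLeastAtMost_iff)
  have sN: "w ?s * N j = N (?s j) * w ?s" if "j \<in> I" for j
  proof -
    have 1: "w ?s * N l = N (l + 1) * w ?s"
      using adjacent sx[of l] s_M[of l] by (simp add: N_def right_diff_distrib left_diff_distrib)
    have ss: "w ?s * w ?s = E" using s by (simp add: w_mult w_id)
    have 2: "w ?s * N (l + 1) = N l * w ?s"
    proof -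
      have "w ?s * (w ?s * N l) * w ?s = w ?s * (N (l + 1) * w ?s) * w ?s" by (simp add: 1)
      then show ?thesis using adjacent ss Fl_one[OF Fl_N, of l] Fl_one'[OF Fl_N, of "l + 1"]
        by (simp add: mult.assoc atLeastAtMost_iff) (simp flip: mult.assoc add: ss)
    qed
    show ?thesis
    proof (cases "j = l \<or> j = l + 1")
      case True
      then show ?thesis using 1 2 by auto
    next
      case False
      then show ?thesis using adjacent that sx_far[of l j] s_M_far[of l j]
        by (simp add: N_def right_diff_distrib left_diff_distrib transpose_def)
    qed
  qed
  have "w (?s \<circ> u) * N i = w ?s * (w u * N i)"
    using s adjacent by (simp flip: w_mult add: mult.assoc)
  also have "\<dots> = w ?s * N (u i) * w u" using adjacent by (simp add: mult.assoc)
  also have "\<dots> = N (?s (u i)) * (w ?s * w u)" using adjacent sN by (simp add: mult.assoc)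
  finally show ?case using s adjacent by (simp add: w_mult comp_def)
qed

subsection \<open>The Dirac element\<close>

definition Dd :: 'a where "Dd = (\<Sum>i\<in>I. N i * c i)"

lemma Fl_D: "Fl True 1 Dd"
  unfolding Dd_def by (intro Fl_sum Fl_mult'[of False 1 _ True 0] Fl_N Fl_c1) auto

text \<open>Ties \<open>Dd\<close> to the Dirac element of the statement: the transposition part is
  the sum of the - M_j c_j, because \<open>T i j * c j\<close> is the negative of s (c_i -
  c_j).\<close>

lemma Dd_eq: "Dd = (\<Sum>i\<in>I. x i * c i) +
    S k * (\<Sum>(i, j) \<in> {(i, j). i \<in> I \<and> j \<in> I \<and> i < j}. w (transpose i j) * (c i - c j))"
proof -
  have t: "T i j * c j = - (w (transpose i j) * (c i - c j))" if "j \<in> I" "i \<in> {1..<j}" for i j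
    using that T_times_c(1)[of j i]
    by (simp add: atLeastAtMost_iff right_diff_distrib wc left_diff_distrib)
  have "(\<Sum>j\<in>I. M j * c j) = S k * (\<Sum>j\<in>I. \<Sum>i\<in>{1..<j}. T i j * c j)"
    by (simp add: M_def mult.assoc sum_distrib_left sum_distrib_right)
  also have "(\<Sum>j\<in>I. \<Sum>i\<in>{1..<j}. T i j * c j) =
      - (\<Sum>j\<in>I. \<Sum>i\<in>{1..<j}. w (transpose i j) * (c i - c j))"
    by (simp only: sum_negf[symmetric]) (intro sum.cong refl t)
  also have "(\<Sum>j\<in>I. \<Sum>i\<in>{1..<j}. w (transpose i j) * (c i - c j)) =
      (\<Sum>(j, i) \<in> Sigma I (\<lambda>j. {1..<j}). w (transpose i j) * (c i - c j))"
    by (rule sum.Sigma) auto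
  also have "\<dots> = (\<Sum>(i, j) \<in> {(i, j). i \<in> I \<and> j \<in> I \<and> i < j}. w (transpose i j) * (c i - c j))"
    by (rule sum.reindex_bij_witness[of _ "\<lambda>(i, j). (j, i)" "\<lambda>(i, j). (j, i)"]) (auto simp: atLeastAtMost_iff)
  finally have "(\<Sum>j\<in>I. M j * c j) =
    - (S k * (\<Sum>(i, j) \<in> {(i, j). i \<in> I \<and> j \<in> I \<and> i < j}. w (transpose i j) * (c i - c j)))"
    by simp
  then show ?thesis
    by (simp add: Dd_def N_def left_diff_distrib sum_subtractf)
qed

text \<open>In each summand exactly one factor anticommutes with c_l: \<open>N l\<close> if i = l,
  and c_i otherwise.\<close>

lemma D_c: "l \<in> I \<Longrightarrow> scomm True Dd (c l)"
proof -
  assume l: "l \<in> I"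
  have "scomm True (c l) (N i * c i)" if "i \<in> I" for i
  proof (cases "i = l")
    case True
    then show ?thesis using N_c[of l l] l
      by (intro scomm_mult[of True _ _ False]) (auto intro: scomm_sym scommI)
  next
    case False
    then show ?thesis using N_c[of i l] cc[of l i] l that
      by (intro scomm_mult[of False _ _ True]) (auto intro: scomm_sym)
  qed
  then show ?thesis unfolding Dd_def by (intro scomm_sym[OF scomm_sum]) auto
qed

lemma D_w: "u permutes I \<Longrightarrow> Dd * w u = w u * Dd"
proof -
  assume u: "u permutes I"
  have "w u * Dd = (\<Sum>i\<in>I. N (u i) * c (u i) * w u)"
    unfolding Dd_def sum_distrib_left
    by (intro sum.cong refl) (use u in \<open>simp flip: mult.assoc add: w_N\<close>, use u in \<open>simp add: mult.assoc wc\<close>)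
  also have "\<dots> = (\<Sum>i\<in>I. N i * c i * w u)"
    using sum.reindex_bij_betw[OF permutes_imp_bij[OF u], of "\<lambda>i. N i * c i * w u"] .
  finally show ?thesis by (simp add: Dd_def sum_distrib_right)
qed

lemma D_Sg: "Fl p 0 h \<Longrightarrow> scomm p Dd h"
proof (induction p "0::nat" h rule: Fl.induct)
  case (Fl_S a)
  then show ?case by (rule scomm_S[OF Fl_D])
next
  case (Fl_c i p h)
  then show ?case by (intro scomm_mult[of True _ _ p] D_c) auto
next
  case (Fl_w u p h)
  then show ?case by (intro scomm_mult[of False _ _ p] scommI D_w) auto
qed (auto intro: scomm_0 scomm_add)

subsection \<open>Power sums in the squares are central\<close>

text \<open>Powers in a ring without unit: the zeroth power is the corner unit
  \<open>E\<close>.\<close>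

primrec pw :: "'a \<Rightarrow> nat \<Rightarrow> 'a" where
  "pw y 0 = E"
| "pw y (Suc a) = y * pw y a"

lemma scomm_sq: "scomm p a b \<Longrightarrow> scomm False a (b * b)"
  by (rule scomm_mult) auto

lemma Fl_pw: "Fl False m y \<Longrightarrow> Fl False (a * m) (pw y a)"
  by (induction a) (auto intro: Fl_S Fl_mult')

lemma scomm_pw: "scomm False h y \<Longrightarrow> Fl p m h \<Longrightarrow> scomm False h (pw y a)"
  by (induction a) (auto intro: scomm_S scomm_mult)

definition xsq :: "nat \<Rightarrow> 'a" where "xsq i = x i * x i"

definition psum :: "nat \<Rightarrow> 'a" where "psum a = (\<Sum>i\<in>I. pw (xsq i) a)"

lemma Fl_xsq: "i \<in> I \<Longrightarrow> Fl False 2 (xsq i)"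
  unfolding xsq_def by (rule Fl_mult'[OF Fl_x1 Fl_x1]) auto

lemma Fl_psum: "Fl False (a * 2) (psum a)"
  unfolding psum_def by (intro Fl_sum Fl_pw Fl_xsq)

lemma xsq_x: "i \<in> I \<Longrightarrow> j \<in> I \<Longrightarrow> scomm False (x j) (xsq i)"
  unfolding xsq_def by (rule scomm_mult[of False _ _ False]) (auto intro: scommI xx)

lemma xsq_c: "i \<in> I \<Longrightarrow> j \<in> I \<Longrightarrow> scomm False (c j) (xsq i)"
  unfolding xsq_def by (rule scomm_mult[of "i = j" _ _ "i = j"]) (auto intro: scomm_sym xc)

lemma adjacent_mem: "1 \<le> l \<Longrightarrow> l + 1 \<le> n \<Longrightarrow> l \<in> I \<and> l + 1 \<in> I \<and> transpose l (l + 1) permutes I"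
  by (auto simp: atLeastAtMost_iff intro!: swap_permutes)

text \<open>Conjugate of \<open>sx\<close> by the transposition, which sends c_l c_(l+1) to its
  negative; hence the changed signs.\<close>

lemma sx': assumes "1 \<le> l" "l + 1 \<le> n"
  shows "w (transpose l (l + 1)) * x (l + 1) =
    x l * w (transpose l (l + 1)) + S k * (E + c l * c (l + 1))"
proof -
  let ?s = "w (transpose l (l + 1))"
  note m = adjacent_mem[OF assms]
  have ss: "?s * ?s = E" using m by (simp add: w_mult w_id)
  have "x (l + 1) * ?s = ?s * x l - S k * (- E + c l * c (l + 1))" using sx[OF assms] by simp
  then have "?s * x (l + 1) * (?s * ?s) = (?s * ?s) * x l * ?s - ?s * S k * (- E + c l * c (l + 1)) * ?s"
    by (simp add: mult.assoc right_diff_distrib left_diff_distrib flip: mult.assoc[of "x (l + 1)"])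
  also have "?s * S k * (- E + c l * c (l + 1)) * ?s = S k * (- (?s * E * ?s) + ?s * c l * c (l + 1) * ?s)"
    using S_w[of "transpose l (l + 1)" k] m by (simp add: algebra_simps) (simp flip: mult.assoc)
  also have "?s * c l * c (l + 1) * ?s = - (c l * c (l + 1))"
  proof -
    have "?s * c l * c (l + 1) * ?s = c (l + 1) * c l * (?s * ?s)"
      using m by (simp add: wc mult.assoc)
    then show ?thesis using ss m cc[of "l + 1" l] by (simp add: mult.assoc c_one scomm_def sgn_mult_def)
  qed
  finally show ?thesis using ss m by (simp add: mult.assoc one_x x_one w_one)
      (simp add: distrib_left right_diff_distrib)
qed

text \<open>The corrections for the two squares are opposite. This is the reason for passing to
  squares: for x_l and x_(l+1) themselves the terms k c_l c_(l+1) add up instead of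
  cancelling.\<close>

lemma s_xsq: assumes "1 \<le> l" "l + 1 \<le> n"
  obtains g where "w (transpose l (l + 1)) * xsq l = xsq (l + 1) * w (transpose l (l + 1)) + g"
    "w (transpose l (l + 1)) * xsq (l + 1) = xsq l * w (transpose l (l + 1)) - g"
    "g * xsq (l + 1) = xsq (l + 1) * g"
proof -
  let ?s = "w (transpose l (l + 1))" and ?y = "x (l + 1)" and ?x = "x l"
  let ?b = "- E + c l * c (l + 1)" and ?b' = "E + c l * c (l + 1)"
  note m = adjacent_mem[OF assms]
  define g where "g = S k * (?y * ?b + ?b * ?x)"
  have Ky: "S k * ?y = ?y * S k" "S k * ?x = ?x * S k" using m by (auto intro: S_x)
  have "?s * xsq l = ?y * ?s * ?x + S k * ?b * ?x"
    using sx[OF assms] by (simp add: xsq_def flip: mult.assoc) (simp add: distrib_right)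
  also have "?y * ?s * ?x = ?y * (?y * ?s + S k * ?b)"
    using sx[OF assms] by (simp add: mult.assoc)
  also have "\<dots> + S k * ?b * ?x = xsq (l + 1) * ?s + g"
    unfolding g_def xsq_def distrib_left[of ?y] distrib_left[of "S k"] mult.assoc[symmetric] Ky
    by (simp only: add.assoc)
  finally have 1: "?s * xsq l = xsq (l + 1) * ?s + g" .
  have "?s * xsq (l + 1) = ?x * ?s * ?y + S k * ?b' * ?y"
    using sx'[OF assms] by (simp add: xsq_def flip: mult.assoc) (simp add: distrib_right)
  also have "?x * ?s * ?y = ?x * (?x * ?s + S k * ?b')"
    using sx'[OF assms] by (simp add: mult.assoc)
  also have "\<dots> + S k * ?b' * ?y = xsq l * ?s + S k * (?x * ?b' + ?b' * ?y)"
    unfolding xsq_def distrib_left[of ?x] distrib_left[of "S k"] mult.assoc[symmetric] Ky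
    by (simp only: add.assoc)
  also have "?x * ?b' + ?b' * ?y = - (?y * ?b + ?b * ?x)"
  proof -
    have "scomm True ?y (c l * c (l + 1))" "scomm True ?x (c l * c (l + 1))"
      using m xc[of "l + 1" l] xc[of "l + 1" "l + 1"] xc[of l l] xc[of l "l + 1"]
      by (auto intro: scomm_mult)
    then show ?thesis using m
      by (simp add: distrib_left distrib_right x_one one_x scommD right_diff_distrib left_diff_distrib)
  qed
  finally have 2: "?s * xsq (l + 1) = xsq l * ?s - g"
    by (simp only: g_def mult_minus_right diff_conv_add_uminus)
  have "scomm False (xsq (l + 1)) g"
  proof -
    have "scomm False (xsq (l + 1)) ?b"
      using m xsq_c[of "l + 1"] by (intro scomm_add scomm_minus scomm_S[OF Fl_xsq] scomm_mult[of False _ _ False])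
        (auto intro: scomm_sym)
    then show ?thesis unfolding g_def
      using m xsq_x[of "l + 1"]
      by (intro scomm_mult[of False _ "S k" False] scomm_add scomm_S[OF Fl_xsq])
        (auto intro: scomm_sym scomm_mult[of False _ _ False])
  qed
  then show thesis using that[OF 1 2] by (simp add: scommD)
qed

text \<open>Newton's recursion in two variables. It reduces commutation with all two-variable power
  sums to commutation with A + B and A B.\<close>

lemma pw_recursion:
  assumes "A * B = B * A"
  shows "pw A (Suc (Suc a)) + pw B (Suc (Suc a)) =
    (A + B) * (pw A (Suc a) + pw B (Suc a)) - A * B * (pw A a + pw B a)"
  using assms by (simp add: algebra_simps) (simp flip: mult.assoc)

lemma s_pw: assumes l: "1 \<le> l" "l + 1 \<le> n"
  shows "scomm False (w (transpose l (l + 1))) (pw (xsq l) a + pw (xsq (l + 1)) a)"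
proof -
  let ?s = "w (transpose l (l + 1))"
  note m = adjacent_mem[OF l]
  obtain g where g: "?s * xsq l = xsq (l + 1) * ?s + g" "?s * xsq (l + 1) = xsq l * ?s - g"
    "g * xsq (l + 1) = xsq (l + 1) * g" using s_xsq[OF l] .
  have AB: "xsq l * xsq (l + 1) = xsq (l + 1) * xsq l"
    using m scomm_mult[of False "xsq (l + 1)" "x l" False "x l" False] scomm_sym[OF xsq_x[of "l + 1" l]]
    by (simp add: scommD flip: xsq_def)
  have sum: "scomm False ?s (xsq l + xsq (l + 1))"
    by (rule scommI) (simp add: g distrib_left distrib_right)
  have prod: "scomm False ?s (xsq l * xsq (l + 1))"
  proof (rule scommI)
    have "?s * (xsq l * xsq (l + 1)) = xsq (l + 1) * (?s * xsq (l + 1)) + g * xsq (l + 1)"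
      by (simp flip: mult.assoc add: g(1)) (simp add: distrib_right mult.assoc)
    also have "\<dots> = xsq l * xsq (l + 1) * ?s"
      by (simp add: g(2,3) right_diff_distrib AB flip: mult.assoc)
    finally show "?s * (xsq l * xsq (l + 1)) = xsq l * xsq (l + 1) * ?s" .
  qed
  have E: "scomm False ?s E" using m by (intro scomm_S[OF Fl_w1]) auto
  \<comment> \<open>Two consecutive exponents are treated at once, since the recursion reaches back
    two steps.\<close>
  have "scomm False ?s (pw (xsq l) a + pw (xsq (l + 1)) a) \<and>
    scomm False ?s (pw (xsq l) (Suc a) + pw (xsq (l + 1)) (Suc a))"
  proof (induction a)
    case 0
    then show ?case using sum E m
      by (auto intro!: scomm_add[of _ _ E] simp: Fl_one'[OF Fl_xsq])
  next
    case (Suc a)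
    then show ?case unfolding pw_recursion[OF AB]
      by (auto intro!: scomm_diff scomm_mult[of False _ _ False] sum prod simp del: pw.simps)
  qed
  then show ?thesis by blast
qed

text \<open>An adjacent transposition interacts only with the summands at l and l + 1, and their sum
  is covered by \<open>s_pw\<close>.\<close>

lemma psum_central: "Fl p m h \<Longrightarrow> scomm False (psum a) h"
proof (induction rule: Fl.induct)
  case (Fl_S m b)
  then show ?case by (rule scomm_S[OF Fl_psum])
next
  case (Fl_x i p m h)
  have "scomm False (x i) (psum a)" unfolding psum_def
    using Fl_x by (intro scomm_sum scomm_pw[OF xsq_x Fl_x1])
  with Fl_x show ?case by (intro scomm_mult[of False _ _ False]) (auto intro: scomm_sym)
next
  case (Fl_c i p m h)
  have "scomm False (c i) (psum a)" unfolding psum_def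
    using Fl_c by (intro scomm_sum scomm_pw[OF xsq_c Fl_c1])
  with Fl_c show ?case by (intro scomm_mult[of False _ _ False]) (auto intro: scomm_sym)
next
  case (Fl_w u p m h)
  from Fl_w(1) have "scomm False (w u) (psum a)"
  proof (induction rule: permutes_adjacent_induct)
    case id
    then show ?case by (simp only: w_id) (rule scomm_sym[OF scomm_S[OF Fl_psum]])
  next
    case (adjacent l u)
    let ?s = "transpose l (l + 1)"
    note m = adjacent_mem[OF adjacent(1,2)]
    have "scomm False (w ?s) (pw (xsq j) a)" if j: "j \<in> I - {l, l + 1}" for j
    proof -
      have "scomm False (w ?s) (x j)"
        using sx_far[of l j] adjacent(1,2) j by (intro scommI(2)) simp
      then have "scomm False (w ?s) (xsq j)" unfolding xsq_def by (rule scomm_sq)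
      then show ?thesis by (rule scomm_pw[OF _ Fl_w1[of _ 0]]) (use m in simp)
    qed
    then have "scomm False (w ?s) (\<Sum>j\<in>I - {l, l + 1}. pw (xsq j) a)" by (rule scomm_sum)
    moreover have "psum a = (\<Sum>j\<in>I - {l, l + 1}. pw (xsq j) a) + (pw (xsq l) a + pw (xsq (l + 1)) a)"
      unfolding psum_def using m by (subst sum.subset_diff[of "{l, l + 1}"]) auto
    ultimately have "scomm False (w ?s) (psum a)"
      using s_pw[OF adjacent(1,2), of a] by (simp add: scomm_add)
    then have "scomm False (psum a) (w ?s * w u)"
      using adjacent by (intro scomm_mult[of False _ _ False]) (auto intro: scomm_sym)
    then show ?case using m adjacent by (simp add: w_mult scomm_sym comp_def)
  qed
  with Fl_w show ?case by (intro scomm_mult[of False _ _ False]) (auto intro: scomm_sym)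
qed (auto intro: scomm_0 scomm_add)

subsection \<open>The square of the Dirac element\<close>

definition Dx :: 'a where "Dx = (\<Sum>i\<in>I. x i * c i)"
definition Ms :: 'a where "Ms = (\<Sum>i\<in>I. M i * c i)"

lemma Fl_Ms: "Fl True m Ms"
  unfolding Ms_def by (intro Fl_sum Fl_mult'[OF Fl_M[of _ 0] Fl_c1[of _ m]]) auto

lemma Dd_Dx: "Dd = Dx - Ms"
  by (simp add: Dd_def Dx_def Ms_def N_def left_diff_distrib sum_subtractf)

lemma xc_xc: assumes "i \<in> I" "j \<in> I" "i \<noteq> j" shows "scomm True (x i * c i) (x j * c j)"
proof -
  have "scomm False (x i * c i) (x j)"
    by (rule scomm_sym, rule scomm_mult[of False _ _ False])
      (use assms xc[of j i] in \<open>auto intro: scommI xx\<close>)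
  moreover have "scomm True (x i * c i) (c j)"
    by (rule scomm_sym, rule scomm_mult[of False _ _ True])
      (use assms xc[of i j] cc in \<open>auto intro: scomm_sym\<close>)
  ultimately show ?thesis by (auto intro: scomm_mult)
qed

lemma xc_sq: assumes "i \<in> I" shows "x i * c i * (x i * c i) = xsq i"
proof -
  have "c i * x i = - (x i * c i)" using xc[of i i] assms by (simp add: scomm_def sgn_mult_def)
  then have "x i * (c i * x i) * c i = - (x i * x i * (c i * c i))" by (simp add: mult.assoc)
  then show ?thesis using assms by (simp add: xsq_def mult.assoc cc_same x_one)
qed

lemma anticommuting_sum_square:
  assumes "finite A" "\<And>i j. i \<in> A \<Longrightarrow> j \<in> A \<Longrightarrow> i \<noteq> j \<Longrightarrow> scomm True (f i) (f j)"
  shows "(\<Sum>i\<in>A. f i) * (\<Sum>i\<in>A. f i) = (\<Sum>i\<in>A. f i * f i)"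
  using assms
proof (induction A rule: finite_induct)
  case (insert a A)
  have "scomm True (f a) (\<Sum>i\<in>A. f i)" using insert by (intro scomm_sum) auto
  with insert show ?case by (simp add: distrib_left distrib_right scommD)
qed auto

lemma Dx_sq: "Dx * Dx = psum 1"
proof -
  have "Dx * Dx = (\<Sum>i\<in>I. x i * c i * (x i * c i))"
    unfolding Dx_def by (rule anticommuting_sum_square) (auto intro: xc_xc)
  also have "\<dots> = psum 1"
    unfolding psum_def by (intro sum.cong) (auto simp: xc_sq One_nat_def Fl_one'[OF Fl_xsq])
  finally show ?thesis .
qed

text \<open>\<open>Dd\<close> anticommutes with the odd Sergeev element \<open>Ms\<close>, so the
  cross terms drop out of the square of \<open>Dx\<close> = \<open>Dd\<close> +
  \<open>Ms\<close>.\<close>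

lemma Dd_sq: "Dd * Dd = psum 1 - Ms * Ms"
proof -
  have "Dd * Ms = - (Ms * Dd)" using D_Sg[OF Fl_Ms] by (rule scommD)
  moreover have "Dx = Dd + Ms" by (simp add: Dd_Dx)
  ultimately have "Dx * Dx = Dd * Dd + Ms * Ms" by (simp add: distrib_left distrib_right)
  then show ?thesis by (simp add: Dx_sq)
qed

text \<open>For \<open>False\<close> these are the elements commuting with the Sergeev algebra.
  \<open>True\<close> is the twisted version suited to odd primitives: \<open>Dd\<close>
  anticommutes with the c_i, so its products with elements that anticommute as well commute with the
  c_i.\<close>

definition sginv :: "bool \<Rightarrow> 'a \<Rightarrow> bool" where
  "sginv p h \<longleftrightarrow> (\<forall>i\<in>I. scomm p (c i) h) \<and> (\<forall>u. u permutes I \<longrightarrow> scomm False (w u) h)"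

lemma sginv_Sg: "Fl q 0 g \<Longrightarrow> sginv p h \<Longrightarrow> Fl r m h \<Longrightarrow> scomm (p \<and> q) h g"
proof (induction q "0::nat" g rule: Fl.induct)
  case (Fl_S a)
  then show ?case using scomm_S[of r m h] by simp
next
  case (Fl_c i q g)
  then have "scomm p h (c i)" "scomm (p \<and> q) h g" by (auto simp: sginv_def intro: scomm_sym)
  then show ?case by (rule scomm_mult) auto
next
  case (Fl_w u q g)
  then have "scomm False h (w u)" "scomm (p \<and> q) h g" by (auto simp: sginv_def intro: scomm_sym)
  then show ?case by (rule scomm_mult) auto
qed (auto intro: scomm_0 scomm_add)

text \<open>On twisted invariants d squares to zero: \<open>Dd * Dd\<close> is central up to the
  square of \<open>Ms\<close>, and an element anticommuting with \<open>Ms\<close> commutes with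
  that square.\<close>

lemma sginv_Dsq: "sginv True e \<Longrightarrow> Fl p m e \<Longrightarrow> scomm False (Dd * Dd) e"
proof -
  assume e: "sginv True e" "Fl p m e"
  have "scomm (True \<and> True) e Ms" by (rule sginv_Sg[OF Fl_Ms e])
  then have "scomm True e Ms" by (simp only: simp_thms)
  then have "scomm False e (Ms * Ms)" by (rule scomm_sq)
  then show ?thesis unfolding Dd_sq using psum_central[OF e(2)]
    by (intro scomm_sym[of _ e] scomm_diff) (auto intro: scomm_sym)
qed

subsection \<open>Averaging over the Sergeev algebra\<close>

text \<open>Mean of h and its conjugate by c_i, twisted by p; the minus sign arises because the
  inverse of c_i is - c_i.\<close>

definition cav :: "bool \<Rightarrow> nat \<Rightarrow> 'a \<Rightarrow> 'a" where
  "cav p i h = S (1 / 2) * (h - sgn_mult p (c i * h * c i))"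

primrec cavs :: "bool \<Rightarrow> nat \<Rightarrow> 'a \<Rightarrow> 'a" where
  "cavs p 0 h = h"
| "cavs p (Suc m) h = cav p (Suc m) (cavs p m h)"

definition wav :: "'a \<Rightarrow> 'a" where
  "wav h = S (1 / fact n) * (\<Sum>u | u permutes I. w u * h * w (pinv u))"

definition Av :: "bool \<Rightarrow> 'a \<Rightarrow> 'a" where "Av p h = wav (cavs p n h)"

lemma sgn_mult_simps: "sgn_mult p (a + b) = sgn_mult p a + sgn_mult p b" "sgn_mult p (- a) = - sgn_mult p a"
  "sgn_mult p (a * b) = sgn_mult p a * b" "a * sgn_mult p b = sgn_mult p a * b"
  "sgn_mult (\<not> p) a = - sgn_mult p a"
  by (auto simp: sgn_mult_def)

lemma Fl_sgn_mult: "Fl q m h \<Longrightarrow> Fl q m (sgn_mult p h)"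
  by (auto simp: sgn_mult_def intro: Fl_minus)

lemma Fl_cch: "i \<in> I \<Longrightarrow> Fl q m h \<Longrightarrow> Fl q m (c i * h * c i)"
  by (rule Fl_mult'[where p = "\<not> q" and q = True and m = m and l = 0],
      rule Fl_mult'[where p = True and q = q and m = 0 and l = m]) (auto intro: Fl_c1)

lemma Fl_cav: "i \<in> I \<Longrightarrow> Fl q m h \<Longrightarrow> Fl q m (cav p i h)"
  unfolding cav_def by (intro Fl_smult Fl_diff Fl_sgn_mult Fl_cch)

lemma Fl_cavs: "l \<le> n \<Longrightarrow> Fl q m h \<Longrightarrow> Fl q m (cavs p l h)"
  by (induction l) (auto intro!: Fl_cav simp: atLeastAtMost_iff)

lemma Fl_wav: "Fl q m h \<Longrightarrow> Fl q m (wav h)"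
  unfolding wav_def
  by (intro Fl_smult Fl_sum Fl_mult'[where p = q and q = False and l = 0 and m = m]
      Fl_mult'[where p = False and q = q and l = m and m = 0 and g = "w u" for u] Fl_w1)
    (auto intro: permutes_inv)

lemma Fl_Av: "Fl q m h \<Longrightarrow> Fl q m (Av p h)"
  unfolding Av_def by (intro Fl_wav Fl_cavs) auto

lemma cav_add: "cav p i (g + h) = cav p i g + cav p i h"
  by (simp add: cav_def algebra_simps sgn_mult_simps)

lemma cavs_add: "cavs p l (g + h) = cavs p l g + cavs p l h"
  by (induction l) (auto simp: cav_add)

lemma wav_add: "wav (g + h) = wav g + wav h"
  by (simp add: wav_def distrib_left distrib_right sum.distrib)

lemma Av_add: "Av p (g + h) = Av p g + Av p h"
  by (simp add: Av_def wav_add cavs_add)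

lemma Av_0: "Av p 0 = 0"
  using Av_add[of p 0 0] by simp

lemma Av_minus: "Av p (- h) = - Av p h"
  using Av_add[of p "- h" h] Av_0 by (simp add: eq_neg_iff_add_eq_0)

lemma Av_diff: "Av p (g - h) = Av p g - Av p h"
  using Av_add[of p g "- h"] by (simp add: Av_minus)

lemma Av_sum: "Av p (\<Sum>i\<in>A. f i) = (\<Sum>i\<in>A. Av p (f i))"
  by (induction A rule: infinite_finite_induct) (auto simp: Av_add Av_0)

lemma cav_scomm: assumes "i \<in> I" "Fl q m h" shows "scomm p (c i) (cav p i h)"
proof -
  let ?g = "h - sgn_mult p (c i * h * c i)"
  have 1: "c i * (c i * h * c i) = - (h * c i)"
    using c_c_cancel[OF assms] by (simp flip: mult.assoc)
  have 2: "c i * h * c i * c i = - (c i * h)"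
    using assms by (simp add: mult.assoc cc_same Fl_one'[OF assms(2)])
  have "scomm p (c i) ?g"
    using 1 2 by (cases p) (simp_all add: scomm_def sgn_mult_def algebra_simps)
  then show ?thesis unfolding cav_def
    using assms(1) by (intro scomm_mult[of False _ _ p] scomm_S[OF Fl_c1]) auto
qed

lemma cav_keeps_scomm:
  assumes "i \<in> I" "j \<in> I" "i \<noteq> j" "scomm p (c j) h" shows "scomm p (c j) (cav q i h)"
proof -
  have "scomm p (c j) (c i * h * c i)"
    using assms cc[of j i] by (intro scomm_mult[of "\<not> p" _ _ True] scomm_mult[of True _ _ p]) auto
  then show ?thesis unfolding cav_def
    using assms by (intro scomm_mult[of False _ _ p] scomm_diff scomm_S[OF Fl_c1])
      (auto simp: sgn_mult_def intro: scomm_minus)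
qed

lemma cavs_scomm: "l \<le> n \<Longrightarrow> Fl q m h \<Longrightarrow> j \<in> {1..l} \<Longrightarrow> scomm p (c j) (cavs p l h)"
proof (induction l)
  case (Suc l)
  have mem: "Suc l \<in> I" "j \<in> I" using Suc by (auto simp: atLeastAtMost_iff)
  show ?case
  proof (cases "j = Suc l")
    case True
    then show ?thesis using mem Suc.prems by (auto intro!: cav_scomm Fl_cavs)
  next
    case False
    then show ?thesis using mem Suc by (auto intro!: cav_keeps_scomm simp: atLeastAtMost_iff)
  qed
qed (simp add: atLeastAtMost_iff)

text \<open>The outer average over S_n preserves what the Clifford averages achieved, because
  conjugation by \<open>w u\<close> only permutes the c_j.\<close>

lemma sginv_Av: assumes h: "Fl q m h" shows "sginv p (Av p h)"
proof -
  let ?g = "cavs p n h"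
  have g: "scomm p (c j) ?g" if "j \<in> I" for j using cavs_scomm[of n, OF _ h] that by simp
  have c: "scomm p (c j) (w u * ?g * w (pinv u))" if j: "j \<in> I" and u: "u permutes I" for j u
  proof -
    have v: "pinv u permutes I" using u by (rule permutes_inv)
    have uv: "u (pinv u j) = j" "pinv u (u i) = i" for i
      using permutes_inverses[OF u] by auto
    have "c j * (w u * ?g * w (pinv u)) = w u * (c (pinv u j) * ?g) * w (pinv u)"
      using wc[OF u, of "pinv u j"] v j uv by (simp flip: mult.assoc)
    also have "c (pinv u j) * ?g = sgn_mult p (?g * c (pinv u j))"
      using g[of "pinv u j"] v j by (simp add: scomm_def)
    also have "w u * \<dots> * w (pinv u) = sgn_mult p (w u * ?g * (c (pinv u j) * w (pinv u)))"
      by (simp add: sgn_mult_def mult.assoc)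
    also have "c (pinv u j) * w (pinv u) = w (pinv u) * c j"
      using wc[OF v j] by simp
    finally show ?thesis by (simp add: scomm_def mult.assoc)
  qed
  have w: "scomm False (w v) (wav ?g)" if v: "v permutes I" for v
  proof -
    have f: "Fl q m ?g" using h by (intro Fl_cavs) auto
    have "w v * (\<Sum>u | u permutes I. w u * ?g * w (pinv u)) =
        (\<Sum>u | u permutes I. w (v \<circ> u) * ?g * w (pinv (v \<circ> u)) * w v)"
      unfolding sum_distrib_left
    proof (intro sum.cong refl)
      fix u assume "u \<in> {u. u permutes I}"
      then have u: "u permutes I" by simp
      have "pinv (v \<circ> u) = pinv u \<circ> pinv v"
        using o_inv_distrib permutes_bij[OF v] permutes_bij[OF u] by blast
      then have "w (pinv (v \<circ> u)) * w v = w (pinv u \<circ> pinv v \<circ> v)"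
        using u v by (simp add: w_mult permutes_inv permutes_compose)
      also have "pinv u \<circ> pinv v \<circ> v = pinv u"
        using permutes_inv_o[OF v] by (simp add: o_assoc[symmetric])
      finally have "w (pinv (v \<circ> u)) * w v = w (pinv u)" .
      then show "w v * (w u * ?g * w (pinv u)) = w (v \<circ> u) * ?g * w (pinv (v \<circ> u)) * w v"
        by (simp only: w_mult[OF v u, symmetric] mult.assoc)
    qed
    also have "\<dots> = (\<Sum>u | u permutes I. w u * ?g * w (pinv u) * w v)"
      by (rule sum.reindex_bij_witness[of _ "\<lambda>u. pinv v \<circ> u" "\<lambda>u. v \<circ> u"])
        (use v permutes_inv_o[OF v] in \<open>auto simp: o_assoc intro: permutes_compose permutes_inv\<close>)
    finally have "scomm False (w v) (\<Sum>u | u permutes I. w u * ?g * w (pinv u))"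
      by (intro scommI) (simp add: sum_distrib_right)
    then show ?thesis unfolding wav_def
      using v by (intro scomm_mult[of False _ _ False] scomm_S[OF Fl_w1]) auto
  qed
  show ?thesis unfolding sginv_def Av_def
    using w c unfolding wav_def
    by (auto intro!: scomm_mult[of False _ "S (1 / fact n)" p] scomm_S[OF Fl_c1] scomm_sum)
qed

lemma half: "Fl p m h \<Longrightarrow> S (1 / 2) * (h + h) = h"
  using S_add[of "1/2" "1/2"] Fl_one[of p m h] by (simp add: distrib_left flip: distrib_right)

lemma cav_fix: "i \<in> I \<Longrightarrow> Fl q m h \<Longrightarrow> scomm p (c i) h \<Longrightarrow> cav p i h = h"
proof -
  assume a: "i \<in> I" "Fl q m h" "scomm p (c i) h"
  have "h * c i * c i = - h" using a by (simp add: mult.assoc cc_same Fl_one'[OF a(2)])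
  then have "sgn_mult p (c i * h * c i) = - h" using a(3) by (auto simp: scomm_def sgn_mult_def)
  then show ?thesis by (simp add: cav_def half[OF a(2)])
qed

lemma cavs_fix: "l \<le> n \<Longrightarrow> Fl q m h \<Longrightarrow> \<forall>i\<in>I. scomm p (c i) h \<Longrightarrow> cavs p l h = h"
  by (induction l) (auto intro!: cav_fix simp: atLeastAtMost_iff)

lemma wav_scale:
  assumes "Fl q m g" "\<And>u. u permutes I \<Longrightarrow> w u * h * w (pinv u) = g"
  shows "wav h = g"
proof -
  have "wav h = S (1 / fact n) * (\<Sum>u | u permutes I. g)" using assms by (simp add: wav_def)
  also have "(\<Sum>u | u permutes I. g) = S (of_nat (card {u. u permutes I})) * g"
  proof -
    have "finite A \<Longrightarrow> (\<Sum>u\<in>A. g) = S (of_nat (card A)) * g" for A :: "(nat \<Rightarrow> nat) set"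
      by (induction A rule: finite_induct) (auto simp: S_add distrib_right Fl_one[OF assms(1)])
    then show ?thesis by (simp add: finite_permutations)
  qed
  also have "card {u. u permutes I} = fact n"
    by (subst card_permutations[of _ n]) auto
  finally show ?thesis by (simp flip: mult.assoc S_mult add: Fl_one[OF assms(1)])
qed

lemma Av_fix: assumes "Fl q m h" "sginv p h" shows "Av p h = h"
proof -
  have "cavs p n h = h" using assms by (intro cavs_fix) (auto simp: sginv_def)
  moreover have "wav h = h"
  proof (rule wav_scale[OF assms(1)])
    fix u assume u: "u permutes I"
    then have "w u * h = h * w u" using assms(2) by (auto simp: sginv_def scommD)
    then show "w u * h * w (pinv u) = h" using w_cancel_right(1)[OF u assms(1)] by simp
  qed
  ultimately show ?thesis by (simp add: Av_def)
qed

lemma cav_mult: "scomm False g (c i) \<Longrightarrow> scomm False g (S (1 / 2)) \<Longrightarrow> cav p i (g * h) = g * cav p i h"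
proof -
  assume a: "scomm False g (c i)" "scomm False g (S (1 / 2))"
  have "c i * (g * h) * c i = g * (c i * h * c i)"
    using scommD(2)[OF a(1)] by (simp flip: mult.assoc)
  then have "cav p i (g * h) = S (1 / 2) * g * (h - sgn_mult p (c i * h * c i))"
    by (simp add: cav_def sgn_mult_def mult.assoc right_diff_distrib distrib_left)
  then show ?thesis using scommD(2)[OF a(2)] by (simp add: cav_def flip: mult.assoc)
qed

lemma Av_mult: assumes g: "Fl q m g" "sginv False g" shows "Av p (g * h) = g * Av p h"
proof -
  have 1: "l \<le> n \<Longrightarrow> cavs p l (g * h) = g * cavs p l h" for l
  proof (induction l)
    case (Suc l)
    have "Suc l \<in> I" using Suc by (auto simp: atLeastAtMost_iff)
    then show ?case using Suc g by (auto intro!: cav_mult scomm_S[OF g(1)] intro: scomm_sym simp: sginv_def)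
  qed simp
  have "w u * (g * h) * w (pinv u) = g * (w u * h * w (pinv u))" if "u permutes I" for u h
    using g(2) that by (auto simp: sginv_def scomm_def sgn_mult_def simp flip: mult.assoc)
  then have "wav (g * h) = S (1 / fact n) * (g * (\<Sum>u | u permutes I. w u * h * w (pinv u)))" for h
    unfolding wav_def sum_distrib_left[of g] by (intro arg_cong[of _ _ "(*) _"] sum.cong) auto
  then have "wav (g * h) = g * wav h" for h
    using Fl_central[OF g(1)] by (simp add: wav_def flip: mult.assoc)
  then show ?thesis using 1 by (simp add: Av_def)
qed

lemma Av_smult: "Av p (S a * h) = S a * Av p h"
  by (rule Av_mult[OF Fl_S[of 0]])
    (auto simp: sginv_def intro!: scomm_S[OF Fl_c1[of _ 0]] scomm_S[OF Fl_w1[of _ 0]])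

text \<open>The Dirac differential intertwines the averages because \<open>D\<close> anticommutes with the \<open>c\<^sub>i\<close>.\<close>

lemma cav_D: assumes i: "i \<in> I" shows "cav False i (Dd * e + e * Dd) = Dd * cav True i e + cav True i e * Dd"
proof -
  have D: "Dd * c i = - (c i * Dd)" using D_c[OF i] by (rule scommD)
  have "c i * (Dd * e) * c i = - (Dd * (c i * e * c i))"
    using D by (simp flip: mult.assoc)
  moreover have "c i * (e * Dd) * c i = - (c i * e * c i * Dd)"
    using D by (simp add: mult.assoc)
  ultimately have "c i * (Dd * e + e * Dd) * c i = - (Dd * (c i * e * c i) + c i * e * c i * Dd)"
    by (simp add: distrib_left distrib_right)
  then have "Dd * e + e * Dd - c i * (Dd * e + e * Dd) * c i =
      Dd * (e + c i * e * c i) + (e + c i * e * c i) * Dd"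
    by (simp only:) (simp add: distrib_left distrib_right)
  then have "cav False i (Dd * e + e * Dd) =
    S (1 / 2) * (Dd * (e + c i * e * c i) + (e + c i * e * c i) * Dd)"
    by (simp add: cav_def sgn_mult_def)
  also have "\<dots> = Dd * (S (1 / 2) * (e + c i * e * c i)) + S (1 / 2) * (e + c i * e * c i) * Dd"
    unfolding distrib_left[of "S (1/2)" "Dd * _"] mult.assoc[symmetric] Fl_central[OF Fl_D, of "1/2"] ..
  finally show ?thesis by (simp add: cav_def sgn_mult_def)
qed

lemma wav_D: "wav (Dd * e + e * Dd) = Dd * wav e + wav e * Dd"
proof -
  have "w u * (Dd * e + e * Dd) * w (pinv u) = Dd * (w u * e * w (pinv u)) + w u * e * w (pinv u) * Dd"
    if "u permutes I" for u
    using D_w[OF that] D_w[OF permutes_inv[OF that]]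
    by (simp add: distrib_left distrib_right mult.assoc) (simp flip: mult.assoc)
  then have "(\<Sum>u | u permutes I. w u * (Dd * e + e * Dd) * w (pinv u)) =
      Dd * (\<Sum>u | u permutes I. w u * e * w (pinv u)) + (\<Sum>u | u permutes I. w u * e * w (pinv u)) * Dd"
    unfolding sum_distrib_left sum_distrib_right sum.distrib[symmetric] by (intro sum.cong) auto
  then show ?thesis unfolding wav_def using Fl_central[OF Fl_D, of "1 / fact n"]
    by (simp add: distrib_left flip: mult.assoc)
qed

lemma Av_D: "Av False (Dd * e + e * Dd) = Dd * Av True e + Av True e * Dd"
proof -
  have "l \<le> n \<Longrightarrow> cavs False l (Dd * e + e * Dd) = Dd * cavs True l e + cavs True l e * Dd" for l
    by (induction l) (auto simp: cav_D atLeastAtMost_iff)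
  then show ?thesis by (simp add: Av_def wav_D)
qed

section \<open>Cyclicity and conjugation invariance of the average\<close>

lemma cav_c: assumes "i \<in> I" "j \<in> I" "i \<noteq> j"
  shows "cav p j (c i * h) = c i * cav (\<not> p) j h" "cav p j (h * c i) = cav (\<not> p) j h * c i"
proof -
  have D: "c j * c i = - (c i * c j)" using cc[of j i] assms by (simp add: scommD)
  have "c j * (c i * h) * c j = - (c i * (c j * h * c j))" "c j * (h * c i) * c j = - (c j * h * c j * c i)"
    using D by (simp flip: mult.assoc) (simp add: D mult.assoc)
  then show "cav p j (c i * h) = c i * cav (\<not> p) j h" "cav p j (h * c i) = cav (\<not> p) j h * c i"
    using S_c[OF assms(1), of "1/2"]
    by (auto simp: cav_def sgn_mult_def algebra_simps simp flip: mult.assoc)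
qed

lemma cavs_c: "l \<le> n \<Longrightarrow> i \<in> I \<Longrightarrow> l < i \<Longrightarrow>
   cavs p l (c i * h) = c i * cavs (\<not> p) l h \<and> cavs p l (h * c i) = cavs (\<not> p) l h * c i"
proof (induction l)
  case (Suc l)
  have "Suc l \<in> I" using Suc by (auto simp: atLeastAtMost_iff)
  then show ?case using Suc cav_c[of i "Suc l" p] by auto
qed simp

text \<open>The stages before i let c_i pass with the index switched to \<open>True\<close>. At
  stage i the averages of c_i g and of g c_i consist of the same two terms in opposite
  order.\<close>

lemma cavs_trace_c: "l \<le> n \<Longrightarrow> i \<in> I \<Longrightarrow> i \<le> l \<Longrightarrow> Fl q m h \<Longrightarrow>
   cavs False l (c i * h) = cavs False l (h * c i)"
proof (induction l)
  case (Suc l)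
  show ?case
  proof (cases "i = Suc l")
    case True
    let ?g = "cavs True l h"
    have g: "Fl q m ?g" using Suc by (auto intro: Fl_cavs)
    have "c i * (c i * ?g) * c i = - (?g * c i)" "c i * (?g * c i) * c i = - (c i * ?g)"
      using c_c_cancel[OF Suc(3) g] Suc(3) by (simp_all add: mult.assoc cc_same Fl_one'[OF g])
    then show ?thesis using Suc True cavs_c[of l i False h]
      by (simp add: cav_def sgn_mult_def add.commute)
  next
    case False
    then show ?thesis using Suc by auto
  qed
qed (simp add: atLeastAtMost_iff)

lemma Av_trace_c: "i \<in> I \<Longrightarrow> Fl q m h \<Longrightarrow> Av False (c i * h) = Av False (h * c i)"
  using cavs_trace_c[of n i q m h] by (auto simp: Av_def atLeastAtMost_iff)

lemma cav_w: assumes i: "i \<in> I" and u: "u permutes I"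
  shows "cav p i (w u * h * w (pinv u)) = w u * cav p (pinv u i) h * w (pinv u)"
proof -
  have v: "pinv u permutes I" using u by (rule permutes_inv)
  have 1: "c i * w u = w u * c (pinv u i)" using wc[OF u, of "pinv u i"] v i permutes_inverses[OF u] by simp
  have 2: "w (pinv u) * c i = c (pinv u i) * w (pinv u)" using wc[OF v i] .
  have "c i * (w u * h * w (pinv u)) * c i = w u * (c (pinv u i) * h * c (pinv u i)) * w (pinv u)"
    using 1 2 by (simp flip: mult.assoc) (simp add: mult.assoc)
  then have "cav p i (w u * h * w (pinv u)) =
      S (1 / 2) * (w u * (h - sgn_mult p (c (pinv u i) * h * c (pinv u i))) * w (pinv u))"
    by (auto simp: cav_def sgn_mult_def left_diff_distrib right_diff_distrib distrib_left distrib_right)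
  then show ?thesis using S_w[OF u, of "1 / 2"] by (simp add: cav_def flip: mult.assoc)
qed

lemma cav_cav: assumes "i \<in> I" "j \<in> I" shows "cav p i (cav p j h) = cav p j (cav p i h)"
proof (cases "i = j")
  case False
  have D: "c i * c j = - (c j * c i)" using cc[of i j] assms False by (simp add: scommD)
  have 1: "c i * (c j * h * c j) * c i = c j * (c i * h * c i) * c j"
  proof -
    have "c i * (c j * h * c j) * c i = (c i * c j) * h * (c j * c i)" by (simp add: mult.assoc)
    also have "\<dots> = (c j * c i) * h * (c i * c j)" by (simp add: D)
    finally show ?thesis by (simp add: mult.assoc)
  qed
  have 2: "cav p i (S (1 / 2) * g) = S (1 / 2) * cav p i g" if "i \<in> I" for g i
    using that by (intro cav_mult scommI(2) S_c) simp_all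
  have 3: "cav p i (g - h) = cav p i g - cav p i h" "cav p i (sgn_mult q g) = sgn_mult q (cav p i g)" for g h q i
    by (auto simp: cav_def algebra_simps sgn_mult_def)
  show ?thesis using assms 1
    unfolding cav_def[of p j h] cav_def[of p i h] 2[OF assms(1)] 2[OF assms(2)] 3
    by (auto simp: cav_def sgn_mult_def algebra_simps)
qed simp

text \<open>The stages 1, ..., m are permuted among themselves by the swap of l and l + 1 unless m =
  l.\<close>

lemma cavs_swap: assumes l: "1 \<le> l" "l + 1 \<le> n" and m: "m \<le> n" "m \<noteq> l"
  shows "cavs p m (w (transpose l (l + 1)) * h * w (transpose l (l + 1))) =
    w (transpose l (l + 1)) * cavs p m h * w (transpose l (l + 1))"
proof -
  let ?s = "transpose l (l + 1)"
  note s = adjacent_mem[OF l]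
  have inv: "pinv ?s = ?s" by (rule inv_unique_comp) (auto simp: fun_eq_iff)
  have cs: "cav p i (w ?s * g * w ?s) = w ?s * cav p (?s i) g * w ?s" if "i \<in> I" for i g
    using cav_w[of i ?s p g] s that by (simp add: inv)
  have low: "m < l \<Longrightarrow> cavs p m (w ?s * h * w ?s) = w ?s * cavs p m h * w ?s" for m
  proof (induction m)
    case (Suc m)
    then have "Suc m \<in> I" "?s (Suc m) = Suc m" using l by (auto simp: atLeastAtMost_iff transpose_def)
    with Suc show ?case by (simp add: cs)
  qed simp
  have "l < m \<Longrightarrow> m \<le> n \<Longrightarrow> cavs p m (w ?s * h * w ?s) = w ?s * cavs p m h * w ?s" for m
  proof (induction m)
    case (Suc m)
    have mem: "Suc m \<in> I" using Suc by (auto simp: atLeastAtMost_iff)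
    show ?case
    proof (cases "m = l")
      case True
      \<comment> \<open>The swap reverses the order of the stages l and l + 1;
        \<open>cav_cav\<close> restores it.\<close>
      obtain l' where l': "l = Suc l'" using l by (cases l) auto
      have "cavs p (Suc l) (w ?s * h * w ?s) = cav p (Suc l) (cav p l (w ?s * cavs p l' h * w ?s))"
        using low[of l'] l' by simp
      also have "\<dots> = w ?s * cav p l (cav p (Suc l) (cavs p l' h)) * w ?s"
        using s by (simp only: cs transpose_apply_first transpose_apply_second Suc_eq_plus1)
      also have "\<dots> = w ?s * cavs p (Suc l) h * w ?s"
        using s cav_cav[of l "Suc l" p "cavs p l' h"] by (simp add: l' flip: Suc_eq_plus1)
      finally show ?thesis using True by simp
    next
      case False
      then have "?s (Suc m) = Suc m" using Suc by (auto simp: transpose_def)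
      with Suc False mem show ?thesis by (simp add: cs)
    qed
  qed simp
  with low m show ?thesis by (cases "m < l") auto
qed

lemma pinv_comp: "u permutes I \<Longrightarrow> v permutes I \<Longrightarrow> pinv (v \<circ> u) = pinv u \<circ> pinv v"
  using o_inv_distrib permutes_bij by blast

lemma cavs_w: "u permutes I \<Longrightarrow> Fl q m h \<Longrightarrow>
  cavs p n (w u * h * w (pinv u)) = w u * cavs p n h * w (pinv u)"
proof (induction rule: permutes_adjacent_induct)
  case id
  have "Fl q m (cavs p n h)" using id by (intro Fl_cavs) auto
  then show ?case using id by (simp add: w_id Fl_one Fl_one' flip: id_def)
next
  case (adjacent l u)
  let ?s = "transpose l (l + 1)"
  note s = adjacent_mem[OF adjacent(1,2)]
  have inv: "pinv ?s = ?s" by (rule inv_unique_comp) (auto simp: fun_eq_iff)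
  have eq: "w (?s \<circ> u) * g * w (pinv (?s \<circ> u)) = w ?s * (w u * g * w (pinv u)) * w ?s" for g
    using adjacent s permutes_inv[OF adjacent(3)] by (simp add: pinv_comp inv mult.assoc flip: w_mult)
  show ?case
    using adjacent cavs_swap[of l n p "w u * h * w (pinv u)"] by (simp only: eq)
qed

lemma wav_conj: assumes v: "v permutes I" shows "wav (w v * h * w (pinv v)) = wav h"
proof -
  have "(\<Sum>u | u permutes I. w u * (w v * h * w (pinv v)) * w (pinv u)) =
    (\<Sum>u | u permutes I. w (u \<circ> v) * h * w (pinv (u \<circ> v)))"
    using v permutes_inv[OF v] by (intro sum.cong refl)
      (simp add: pinv_comp permutes_inv mult.assoc flip: w_mult)
  also have "\<dots> = (\<Sum>u | u permutes I. w u * h * w (pinv u))"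
    by (rule sum.reindex_bij_witness[of _ "\<lambda>u. u \<circ> pinv v" "\<lambda>u. u \<circ> v"])
      (use v permutes_inv_o[OF v] in \<open>auto simp: o_assoc[symmetric] intro: permutes_compose permutes_inv\<close>)
  finally show ?thesis by (simp add: wav_def)
qed

lemma Av_conj: "u permutes I \<Longrightarrow> Fl q m h \<Longrightarrow> Av p (w u * h * w (pinv u)) = Av p h"
  by (simp add: Av_def cavs_w wav_conj)

end

section \<open>Representations\<close>

text \<open>The axioms are imposed on a subset \<open>V\<close> because, for left multiplication,
  the unit of the algebra acts as the identity just on the elements that it fixes.\<close>

locale hc_rep =
  fixes n :: nat and k :: complex and V :: "'v::ab_group_add set"
    and sc :: "complex \<Rightarrow> 'v \<Rightarrow> 'v" and opr :: "hc_gen \<Rightarrow> 'v \<Rightarrow> 'v"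
  assumes V_0: "0 \<in> V" and V_add: "u \<in> V \<Longrightarrow> v \<in> V \<Longrightarrow> u + v \<in> V"
    and V_sc: "v \<in> V \<Longrightarrow> sc a v \<in> V" and V_opr: "g \<in> gens n \<Longrightarrow> v \<in> V \<Longrightarrow> opr g v \<in> V"
    and sc_add: "sc a (u + v) = sc a u + sc a v" and sc_add': "sc (a + b) v = sc a v + sc b v"
    and sc_sc: "sc a (sc b v) = sc (a * b) v" and sc_1: "v \<in> V \<Longrightarrow> sc 1 v = v"
    and opr_add: "g \<in> gens n \<Longrightarrow> u \<in> V \<Longrightarrow> v \<in> V \<Longrightarrow> opr g (u + v) = opr g u + opr g v"
    and opr_sc: "g \<in> gens n \<Longrightarrow> v \<in> V \<Longrightarrow> opr g (sc a v) = sc a (opr g v)"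
    and r_W_id: "v \<in> V \<Longrightarrow> opr (GW id) v = v"
    and r_W_mult: "v \<in> V \<Longrightarrow> s permutes {1..n} \<Longrightarrow> t permutes {1..n} \<Longrightarrow>
      opr (GW s) (opr (GW t) v) = opr (GW (s \<circ> t)) v"
    and r_XX: "v \<in> V \<Longrightarrow> i \<in> {1..n} \<Longrightarrow> j \<in> {1..n} \<Longrightarrow> opr (GX i) (opr (GX j) v) = opr (GX j) (opr (GX i) v)"
    and r_XC: "v \<in> V \<Longrightarrow> i \<in> {1..n} \<Longrightarrow> j \<in> {1..n} \<Longrightarrow> i \<noteq> j \<Longrightarrow>
      opr (GX i) (opr (GC j) v) = opr (GC j) (opr (GX i) v)"
    and r_XC_same: "v \<in> V \<Longrightarrow> i \<in> {1..n} \<Longrightarrow> opr (GX i) (opr (GC i) v) = - opr (GC i) (opr (GX i) v)"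
    and r_CC: "v \<in> V \<Longrightarrow> i \<in> {1..n} \<Longrightarrow> j \<in> {1..n} \<Longrightarrow> i \<noteq> j \<Longrightarrow>
      opr (GC i) (opr (GC j) v) = - opr (GC j) (opr (GC i) v)"
    and r_CC_same: "v \<in> V \<Longrightarrow> i \<in> {1..n} \<Longrightarrow> opr (GC i) (opr (GC i) v) = - v"
    and r_WC: "v \<in> V \<Longrightarrow> s permutes {1..n} \<Longrightarrow> i \<in> {1..n} \<Longrightarrow>
      opr (GW s) (opr (GC i) v) = opr (GC (s i)) (opr (GW s) v)"
    and r_SX: "v \<in> V \<Longrightarrow> 1 \<le> i \<Longrightarrow> i + 1 \<le> n \<Longrightarrow> opr (GW (transpose i (i + 1))) (opr (GX i) v) =
      opr (GX (i + 1)) (opr (GW (transpose i (i + 1))) v) + sc k (- v + opr (GC i) (opr (GC (i + 1)) v))"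
    and r_SX_far: "v \<in> V \<Longrightarrow> 1 \<le> i \<Longrightarrow> i + 1 \<le> n \<Longrightarrow> j \<in> {1..n} \<Longrightarrow> j \<noteq> i \<Longrightarrow> j \<noteq> i + 1 \<Longrightarrow>
      opr (GW (transpose i (i + 1))) (opr (GX j) v) = opr (GX j) (opr (GW (transpose i (i + 1))) v)"

lemma free_alg_induct [consumes 1, case_names zero add]:
  assumes "f \<in> carrier (free_alg n)" "P 0"
    and "\<And>u a f. set (letters u) \<subseteq> gens n \<Longrightarrow> f \<in> carrier (free_alg n) \<Longrightarrow> P f \<Longrightarrow>
      P (Poly_Mapping.single u a + f)"
  shows "P f"
  using assms(1)
proof (induction f rule: update_induct)
  case const
  then show ?case using assms(2) by simp
next
  case (update f a b)
  have "Poly_Mapping.update a b f = Poly_Mapping.single a b + f"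
    using update(1) by (intro poly_mapping_eqI)
      (auto simp: lookup_update lookup_add lookup_single when_def in_keys_iff)
  moreover have "Poly_Mapping.keys (Poly_Mapping.update a b f) = insert a (Poly_Mapping.keys f)"
    using update(1,2) by (auto simp: in_keys_iff lookup_update split: if_splits)
  ultimately show ?case using update assms(3)[of a f b] by (simp add: free_alg_simps)
qed

lemma free_single: "set (letters u) \<subseteq> gens n \<Longrightarrow> Poly_Mapping.single u a \<in> carrier (free_alg n)"
  by (simp add: free_alg_simps)

context hc_rep
begin

lemma sc_0 [simp]: "sc 0 v = 0" and sc_zero [simp]: "sc a 0 = 0"
  using sc_add'[of 0 0 v] sc_add[of a 0 0] by auto

definition ev :: "hc_free \<Rightarrow> 'v \<Rightarrow> 'v" where
  "ev f v = (\<Sum>u\<in>Poly_Mapping.keys f. sc (Poly_Mapping.lookup f u) (foldr opr (letters u) v))"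

lemma ev_superset: "finite A \<Longrightarrow> Poly_Mapping.keys f \<subseteq> A \<Longrightarrow>
  ev f v = (\<Sum>u\<in>A. sc (Poly_Mapping.lookup f u) (foldr opr (letters u) v))"
  unfolding ev_def by (rule sum.mono_neutral_left) (auto simp: in_keys_iff)

lemma ev_add: "ev (f + g) v = ev f v + ev g v"
proof -
  let ?A = "Poly_Mapping.keys f \<union> Poly_Mapping.keys g"
  show ?thesis
    using keys_add[of f g] ev_superset[of ?A f v] ev_superset[of ?A g v] ev_superset[of ?A "f + g" v]
    by (simp add: lookup_add sc_add' sum.distrib)
qed

lemma ev_zero [simp]: "ev 0 v = 0"
  by (simp add: ev_def)

lemma ev_minus: "ev (- f) v = - ev f v"
  using ev_add[of f "- f" v] by (simp add: eq_neg_iff_add_eq_0 add.commute)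

lemma ev_diff: "ev (f - g) v = ev f v - ev g v"
  using ev_add[of f "- g" v] by (simp add: ev_minus)

lemma ev_single: "ev (Poly_Mapping.single u a) v = sc a (foldr opr (letters u) v)"
  by (auto simp: ev_def)

lemma word_V: "set l \<subseteq> gens n \<Longrightarrow> v \<in> V \<Longrightarrow> foldr opr l v \<in> V"
  by (induction l) (auto intro: V_opr)

lemma word_sc: "set l \<subseteq> gens n \<Longrightarrow> v \<in> V \<Longrightarrow> foldr opr l (sc a v) = sc a (foldr opr l v)"
  by (induction l) (auto simp: opr_sc word_V)

lemma word_add: "set l \<subseteq> gens n \<Longrightarrow> u \<in> V \<Longrightarrow> v \<in> V \<Longrightarrow> foldr opr l (u + v) = foldr opr l u + foldr opr l v"
  by (induction l) (auto simp: opr_add word_V)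

lemma ev_V: "f \<in> carrier (free_alg n) \<Longrightarrow> v \<in> V \<Longrightarrow> ev f v \<in> V"
  by (induction rule: free_alg_induct) (auto simp: ev_add ev_single intro: V_0 V_add V_sc word_V)

lemma word_0: "set l \<subseteq> gens n \<Longrightarrow> foldr opr l 0 = 0"
  using word_sc[of l 0 0] V_0 by simp

lemma ev_single_mult:
  assumes "g \<in> carrier (free_alg n)" "set (letters u) \<subseteq> gens n" "v \<in> V"
  shows "ev (Poly_Mapping.single u a * g) v = sc a (foldr opr (letters u) (ev g v))"
  using assms
proof (induction rule: free_alg_induct)
  case (add u' b g)
  then show ?case
    by (simp add: distrib_left mult_single ev_add ev_single plus_hc_word_def word_add word_sc
        word_V V_sc ev_V sc_add sc_sc)
qed (auto simp: word_0)

lemma ev_mult: "f \<in> carrier (free_alg n) \<Longrightarrow> g \<in> carrier (free_alg n) \<Longrightarrow> v \<in> V \<Longrightarrow> ev (f * g) v = ev f (ev g v)"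
  by (induction rule: free_alg_induct) (auto simp: distrib_right ev_add ev_single_mult ev_single)

lemma ev_gen: "g \<in> gens n \<Longrightarrow> v \<in> V \<Longrightarrow> ev (gen g) v = opr g v"
  by (simp add: gen_def ev_single sc_1 V_opr)

lemma ev_scal: "ev (scal a) v = sc a v"
  by (simp add: scal_def ev_single zero_hc_word_def)

lemma ev_one: "v \<in> V \<Longrightarrow> ev 1 v = v"
  using ev_scal[of 1 v] by (simp add: scal_def sc_1)

lemma ev_0: "f \<in> carrier (free_alg n) \<Longrightarrow> ev f 0 = 0"
  by (induction rule: free_alg_induct) (auto simp: ev_add ev_single word_0)

text \<open>The annihilator of \<open>V\<close> is a two-sided ideal, so testing the defining
  relations suffices.\<close>

lemma ev_ideal: assumes "f \<in> hc_ideal n k" "v \<in> V" shows "ev f v = 0"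
proof -
  let ?J = "{f \<in> carrier (free_alg n). \<forall>v\<in>V. ev f v = 0}"
  have add: "subgroup ?J (add_monoid (free_alg n))"
  proof -
    interpret R: ring "free_alg n" by (rule ring_free_alg)
    show ?thesis
    proof (rule R.add.subgroupI, goal_cases)
      case 2
      have "0 \<in> ?J" by (simp add: free_alg_simps)
      then show ?case by blast
    next
      case (3 a)
      then show ?case using free_uminus[of a n] by (simp add: free_minus ev_minus)
    next
      case (4 a b)
      then show ?case using free_add[of a n b] by (simp add: ev_add free_alg_simps(5))
    qed blast
  qed
  have "ideal ?J (free_alg n)"
  proof (rule idealI[OF ring_free_alg add], goal_cases)
    case (1 a y)
    then show ?case using free_mult[of y n a] by (simp add: free_alg_simps(2) ev_mult ev_0)
  next
    case (2 a y)
    then show ?case using free_mult[of a n y] ev_mult[of a y] ev_V[of y] by (simp add: free_alg_simps(2))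
  qed
  moreover have "hc_rels n k \<subseteq> ?J"
  proof
    fix r assume r: "r \<in> hc_rels n k"
    have m: "gen g \<in> carrier (free_alg n)" if "g \<in> gens n" for g using that by (rule free_gen)
    have mm: "gen g * gen h \<in> carrier (free_alg n)" if "g \<in> gens n" "h \<in> gens n" for g h
      using that by (intro free_mult m)
    have gs: "GX i \<in> gens n" "GC i \<in> gens n" if "i \<in> {1..n}" for i using that by (auto simp: gens_def)
    have gw: "GW u \<in> gens n" if "u permutes {1..n}" for u using that by (auto simp: gens_def)
    have e2: "ev (gen g * gen h) v = opr g (opr h v)" if "g \<in> gens n" "h \<in> gens n" "v \<in> V" for g h v
      using that by (simp add: ev_mult m ev_gen V_opr)
    have "\<forall>v\<in>V. ev r v = 0"
      using r
    proof cases
      case W_one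
      then show ?thesis using r_W_id gw[of id] permutes_id by (simp add: ev_diff ev_gen ev_one)
    next
      case (W_mult u v)
      then show ?thesis using r_W_mult by (simp add: ev_diff ev_gen e2 gw permutes_compose)
    next
      case (XX i j)
      then show ?thesis using r_XX by (simp add: ev_diff e2 gs)
    next
      case (XC i j)
      then show ?thesis using r_XC by (simp add: ev_diff e2 gs)
    next
      case (XC_same i)
      then show ?thesis using r_XC_same by (simp add: ev_diff ev_add e2 gs)
    next
      case (CC i j)
      then show ?thesis unfolding CC(1) using r_CC[OF _ CC(2-4)] by (simp add: ev_add e2 gs)
    next
      case (C_square i)
      then show ?thesis using r_CC_same by (simp add: ev_diff ev_add e2 gs ev_one)
    next
      case (WC u i)
      have "u i \<in> {1..n}" using permutes_in_image[OF WC(2)] WC(3) by simp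
      then show ?thesis unfolding WC(1) using r_WC[OF _ WC(2,3)] gs[OF WC(3)] gs gw[OF WC(2)]
        by (simp add: ev_diff e2)
    next
      case (SX i)
      have i: "i \<in> {1..n}" "i + 1 \<in> {1..n}" using SX by (auto simp: atLeastAtMost_iff)
      have s: "transpose i (i + 1) permutes {1..n}" using i by (intro permutes_swap_id)
      have "ev (scal k * (- 1 + cg i * cg (i + 1))) v = sc k (- v + opr (GC i) (opr (GC (i + 1)) v))"
        if "v \<in> V" for v
        using that i by (simp add: ev_mult free_scal free_diff free_one mm gs ev_diff ev_scal ev_one e2)
      then show ?thesis unfolding SX(1) using r_SX[OF _ SX(2,3)] gs[OF i(1)] gs[OF i(2)] gw[OF s]
        by (simp add: ev_diff e2)
    next
      case (SX_far i j)
      have i: "i \<in> {1..n}" "i + 1 \<in> {1..n}" using SX_far by (auto simp: atLeastAtMost_iff)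
      have s: "transpose i (i + 1) permutes {1..n}" using i by (intro permutes_swap_id)
      show ?thesis unfolding SX_far(1) using r_SX_far[OF _ SX_far(2-6)] gs[OF SX_far(4)] gw[OF s]
        by (simp add: ev_diff e2)
    qed
    then show "r \<in> ?J" using r hc_rels_carrier by blast
  qed
  ultimately have "hc_ideal n k \<subseteq> ?J"
    unfolding hc_ideal_def by (rule ring.genideal_minimal[OF ring_free_alg])
  then show ?thesis using assms by blast
qed

text \<open>Elements of the quotient are bare cosets. Evaluating a chosen representative is harmless
  since ideal elements act as zero; this is how functions on the quotient arise.\<close>

lemma factor:
  assumes v: "v \<in> V"
  obtains \<Psi> where "\<And>f. f \<in> carrier (free_alg n) \<Longrightarrow> \<Psi> (cls n k f) = ev f v"
proof -
  define \<Psi> where "\<Psi> h = ev (SOME f. f \<in> carrier (free_alg n) \<and> cls n k f = h) v" for h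
  have "\<Psi> (cls n k f) = ev f v" if f: "f \<in> carrier (free_alg n)" for f
  proof -
    let ?g = "SOME g. g \<in> carrier (free_alg n) \<and> cls n k g = cls n k f"
    have g: "?g \<in> carrier (free_alg n) \<and> cls n k ?g = cls n k f"
      by (rule someI[of _ f]) (use f in simp)
    then have "?g - f \<in> hc_ideal n k" using cls_eq f by blast
    from ev_ideal[OF this v] show ?thesis by (simp add: \<Psi>_def ev_diff)
  qed
  then show thesis using that by blast
qed

end

section \<open>The basis theorem\<close>

context hc_alg
begin

text \<open>
  \<open>H\<close> acts on the module induced from the algebra generated by the \<open>x\<^sub>i\<close> and \<open>c\<^sub>i\<close>:
  \<open>F u \<alpha>\<close> is the coefficient of \<open>w\<^sub>u x\<^sup>\<alpha>\<close>, an element of the Clifford algebra acting on itself.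
  The correction terms of \<open>x\<^sub>i\<close> come from \<open>x\<^sub>i w\<^sub>u = w\<^sub>u x\<^sub>p + M\<^sub>i w\<^sub>u - w\<^sub>u M\<^sub>p\<close>, \<open>p = u\<^sup>-\<^sup>1 i\<close>.
\<close>

definition xi :: "nat \<Rightarrow> ((nat \<Rightarrow> nat) \<Rightarrow> 'a) \<Rightarrow> (nat \<Rightarrow> nat) \<Rightarrow> 'a" where
  "xi p f = (\<lambda>\<alpha>. if \<alpha> p = 0 then 0 else f (\<alpha>(p := \<alpha> p - 1)))"

text \<open>Left multiplication by c_p on x^\<alpha> b; moving c_p to the right of x^\<alpha> costs
  a sign for each factor x_p.\<close>

definition gam :: "nat \<Rightarrow> ((nat \<Rightarrow> nat) \<Rightarrow> 'a) \<Rightarrow> (nat \<Rightarrow> nat) \<Rightarrow> 'a" where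
  "gam p f = (\<lambda>\<alpha>. sgn_mult (odd (\<alpha> p)) (c p * f \<alpha>))"

definition scf :: "complex \<Rightarrow> ((nat \<Rightarrow> nat) \<Rightarrow> 'a) \<Rightarrow> (nat \<Rightarrow> nat) \<Rightarrow> 'a" where
  "scf a f = (\<lambda>\<alpha>. S a * f \<alpha>)"

text \<open>The Clifford factor 1 - c_q c_p of a summand of a Jucys-Murphy element.\<close>

definition Q :: "nat \<Rightarrow> nat \<Rightarrow> ((nat \<Rightarrow> nat) \<Rightarrow> 'a) \<Rightarrow> (nat \<Rightarrow> nat) \<Rightarrow> 'a" where
  "Q q p f = f - gam q (gam p f)"

definition unital :: "((nat \<Rightarrow> nat) \<Rightarrow> 'a) \<Rightarrow> bool" where
  "unital f \<longleftrightarrow> (\<forall>\<alpha>. E * f \<alpha> = f \<alpha>)"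

section \<open>Elementary operators on coefficient functions\<close>

lemma xi_add: "xi p (f + g) = xi p f + xi p g" and xi_0 [simp]: "xi p 0 = 0"
  and xi_minus: "xi p (- f) = - xi p f" and xi_scf: "xi p (scf a f) = scf a (xi p f)"
  by (auto simp: xi_def scf_def fun_eq_iff)

lemma gam_add: "gam p (f + g) = gam p f + gam p g" and gam_0 [simp]: "gam p 0 = 0"
  and gam_minus: "gam p (- f) = - gam p f" and gam_diff: "gam p (f - g) = gam p f - gam p g"
  by (auto simp: gam_def fun_eq_iff sgn_mult_def distrib_left right_diff_distrib)

lemma scf_add: "scf a (f + g) = scf a f + scf a g" and scf_0 [simp]: "scf a 0 = 0" "scf 0 f = 0"
  and scf_minus: "scf a (- f) = - scf a f" and scf_diff: "scf a (f - g) = scf a f - scf a g"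
  by (auto simp: scf_def fun_eq_iff distrib_left right_diff_distrib)

lemma scf_add': "scf (a + b) f = scf a f + scf b f"
  and scf_minus': "scf (- a) f = - scf a f" and scf_scf: "scf a (scf b f) = scf (a * b) f"
  by (auto simp: scf_def fun_eq_iff distrib_right S_add S_minus S_mult mult.assoc)

lemma gam_scf: "p \<in> I \<Longrightarrow> gam p (scf a f) = scf a (gam p f)"
  by (auto simp: gam_def scf_def fun_eq_iff sgn_mult_def S_c simp flip: mult.assoc)

lemma Q_add: "Q q p (f + g) = Q q p f + Q q p g" and Q_0 [simp]: "Q q p 0 = 0"
  by (auto simp: Q_def gam_add)

lemma Q_scf: "p \<in> I \<Longrightarrow> q \<in> I \<Longrightarrow> Q q p (scf a f) = scf a (Q q p f)"
  by (simp add: Q_def gam_scf scf_diff)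

lemma unital_xi: "unital f \<Longrightarrow> unital (xi p f)"
  by (auto simp: unital_def xi_def)

lemma unital_gam: "p \<in> I \<Longrightarrow> unital (gam p f)"
  by (auto simp: unital_def gam_def sgn_mult_def one_c simp flip: mult.assoc)

lemma unital_add: "unital f \<Longrightarrow> unital g \<Longrightarrow> unital (f + g)"
  and unital_diff: "unital f \<Longrightarrow> unital g \<Longrightarrow> unital (f - g)"
  and unital_0: "unital 0" and unital_scf: "unital f \<Longrightarrow> unital (scf a f)"
  by (auto simp: unital_def scf_def distrib_left right_diff_distrib simp flip: mult.assoc S_mult)

lemma unital_Q: "p \<in> I \<Longrightarrow> q \<in> I \<Longrightarrow> unital f \<Longrightarrow> unital (Q q p f)"
  by (simp add: Q_def unital_diff unital_gam)

lemma unital_sum: "(\<And>j. j \<in> A \<Longrightarrow> unital (f j)) \<Longrightarrow> unital (\<Sum>j\<in>A. f j)"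
  by (induction A rule: infinite_finite_induct) (auto intro: unital_0 unital_add)

lemma gam_gam: "p \<in> I \<Longrightarrow> q \<in> I \<Longrightarrow> p \<noteq> q \<Longrightarrow> gam p (gam q f) = - gam q (gam p f)"
  using cc[of p q] by (auto simp: gam_def fun_eq_iff sgn_mult_def scomm_def simp flip: mult.assoc)

lemma gam_same: "p \<in> I \<Longrightarrow> unital f \<Longrightarrow> gam p (gam p f) = - f"
  by (auto simp: gam_def fun_eq_iff sgn_mult_def cc_same unital_def simp flip: mult.assoc)

lemma xi_xi: "xi p (xi q f) = xi q (xi p f)"
  by (auto simp: xi_def fun_eq_iff fun_upd_twist)

lemma xi_gam: "xi p (gam q f) = sgn_mult (p = q) (gam q (xi p f))"
  by (auto simp: xi_def gam_def fun_eq_iff sgn_mult_def)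

lemma Q_gam:
  assumes "p \<in> I" "q \<in> I" "p \<noteq> q" "unital f"
  shows "Q q p (gam p f) = gam q (Q q p f)" "Q q p (gam q f) = - gam p (Q q p f)"
    "r \<in> I \<Longrightarrow> r \<noteq> p \<Longrightarrow> r \<noteq> q \<Longrightarrow> Q q p (gam r f) = gam r (Q q p f)"
proof -
  have qq: "gam q (gam q g) = - g" "gam p (gam p g) = - g" if "unital g" for g
    using assms that by (simp_all add: gam_same)
  have pq: "gam p (gam q g) = - gam q (gam p g)" for g using gam_gam[OF assms(1-3)] .
  show "Q q p (gam p f) = gam q (Q q p f)" "Q q p (gam q f) = - gam p (Q q p f)"
    using assms by (simp_all add: Q_def gam_diff gam_minus qq pq unital_gam)
  show "Q q p (gam r f) = gam r (Q q p f)" if r: "r \<in> I" "r \<noteq> p" "r \<noteq> q"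
    using gam_gam[OF r(1) assms(1) r(2)] gam_gam[OF r(1) assms(2) r(3)]
    by (simp add: Q_def gam_diff gam_minus)
qed

type_synonym 'b ind = "(nat \<Rightarrow> nat) \<Rightarrow> (nat \<Rightarrow> nat) \<Rightarrow> 'b"

definition indV :: "'a ind set" where
  "indV = {F. (\<forall>u. unital (F u)) \<and> (\<forall>u. \<not> u permutes I \<longrightarrow> F u = 0)}"

definition opW :: "(nat \<Rightarrow> nat) \<Rightarrow> 'a ind \<Rightarrow> 'a ind" where
  "opW s F = (\<lambda>u. F (pinv s \<circ> u))"

definition opC :: "nat \<Rightarrow> 'a ind \<Rightarrow> 'a ind" where
  "opC i F = (\<lambda>u. if u permutes I then gam (pinv u i) (F u) else 0)"

text \<open>Coefficient of \<open>T j i\<close> in M_i w_v - w_v M_p for the source v = (i j) u. The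
  inverse of v takes at i and j the values of the inverse of u at j and i, so the second comparison
  looks reversed when written in terms of the target u.\<close>

definition eta :: "nat \<Rightarrow> nat \<Rightarrow> (nat \<Rightarrow> nat) \<Rightarrow> complex" where
  "eta i j u = (if j < i then 1 else 0) - (if pinv u i < pinv u j then 1 else 0)"

definition opX :: "nat \<Rightarrow> 'a ind \<Rightarrow> 'a ind" where
  "opX i F = (\<lambda>u. if u permutes I then xi (pinv u i) (F u) +
     (\<Sum>j\<in>I - {i}. scf (k * eta i j u) (Q (pinv u j) (pinv u i) (F (transpose i j \<circ> u)))) else 0)"

definition scV :: "complex \<Rightarrow> 'a ind \<Rightarrow> 'a ind" where
  "scV a F = (\<lambda>u. scf a (F u))"

lemma indV_D: "F \<in> indV \<Longrightarrow> unital (F u)" "F \<in> indV \<Longrightarrow> \<not> u permutes I \<Longrightarrow> F u = 0"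
  by (auto simp: indV_def)

lemma pinv_mem: "u permutes I \<Longrightarrow> i \<in> I \<Longrightarrow> pinv u i \<in> I"
  by (simp add: permutes_inv)

lemma pinv_eq: "u permutes I \<Longrightarrow> pinv u i = pinv u j \<longleftrightarrow> i = j"
  using permutes_inverses(1) by metis

lemma comp_permutes: "s permutes I \<Longrightarrow> s \<circ> u permutes I \<longleftrightarrow> u permutes I"
proof
  assume s: "s permutes I" "s \<circ> u permutes I"
  have "pinv s \<circ> (s \<circ> u) = u" using permutes_inv_o(2)[OF s(1)] by (simp add: o_assoc)
  then show "u permutes I" using permutes_compose[OF s(2) permutes_inv[OF s(1)]] by simp
qed (auto intro: permutes_compose)

lemma opX_mem: "i \<in> I \<Longrightarrow> F \<in> indV \<Longrightarrow> opX i F \<in> indV"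
  unfolding indV_def
  by (auto simp: opX_def intro!: unital_add unital_xi unital_sum unital_scf unital_Q unital_0 pinv_mem)

lemma opC_mem: "i \<in> I \<Longrightarrow> F \<in> indV \<Longrightarrow> opC i F \<in> indV"
  unfolding indV_def by (auto simp: opC_def intro!: unital_gam unital_0 pinv_mem)

lemma opW_mem: "s permutes I \<Longrightarrow> F \<in> indV \<Longrightarrow> opW s F \<in> indV"
  unfolding indV_def by (auto simp: opW_def comp_permutes permutes_inv)

lemma scV_mem: "F \<in> indV \<Longrightarrow> scV a F \<in> indV"
  unfolding indV_def by (auto simp: scV_def intro: unital_scf)

lemma add_mem: "F \<in> indV \<Longrightarrow> G \<in> indV \<Longrightarrow> F + G \<in> indV" and zero_mem: "0 \<in> indV"
  and minus_mem: "F \<in> indV \<Longrightarrow> G \<in> indV \<Longrightarrow> F - G \<in> indV"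
  unfolding indV_def by (auto intro: unital_add unital_0 unital_diff)

lemma opX_add: "opX i (F + G) = opX i F + opX i G"
  by (auto simp: opX_def fun_eq_iff[of _ "_ + _"] xi_add Q_add scf_add sum.distrib)

lemma opC_add: "opC i (F + G) = opC i F + opC i G"
  by (auto simp: opC_def fun_eq_iff[of _ "_ + _"] gam_add)

lemma opW_add: "opW s (F + G) = opW s F + opW s G"
  by (auto simp: opW_def fun_eq_iff)

lemma scV_add: "scV a (F + G) = scV a F + scV a G" "scV (a + b) F = scV a F + scV b F"
  "scV a (scV b F) = scV (a * b) F" "scV a (- F) = - scV a F"
  by (auto simp: scV_def fun_eq_iff[of _ "_ + _"] scf_add scf_add' scf_scf)
    (auto simp: fun_eq_iff scf_minus)

lemma scf_sum: "scf a (\<Sum>j\<in>A. f j) = (\<Sum>j\<in>A. scf a (f j))"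
  and gam_sum: "gam p (\<Sum>j\<in>A. f j) = (\<Sum>j\<in>A. gam p (f j))"
  by (induction A rule: infinite_finite_induct) (auto simp: scf_add gam_add)

lemma opX_scV: assumes "i \<in> I" shows "opX i (scV a F) = scV a (opX i F)"
proof
  fix u
  show "opX i (scV a F) u = scV a (opX i F) u"
    using assms by (auto simp: opX_def scV_def xi_scf scf_add scf_sum Q_scf pinv_mem scf_scf ac_simps intro!: sum.cong)
qed

lemma opC_scV: "i \<in> I \<Longrightarrow> opC i (scV a F) = scV a (opC i F)"
  by (auto simp: opC_def scV_def gam_scf pinv_mem fun_eq_iff[of _ "scV _ _"] intro!: ext)

lemma opC_opC: "i \<in> I \<Longrightarrow> j \<in> I \<Longrightarrow> i \<noteq> j \<Longrightarrow> opC i (opC j F) = - opC j (opC i F)"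
  by (rule ext) (auto simp: opC_def pinv_mem pinv_eq intro!: gam_gam)

lemma opC_same: "i \<in> I \<Longrightarrow> F \<in> indV \<Longrightarrow> opC i (opC i F) = - F"
  by (rule ext) (auto simp: opC_def gam_same pinv_mem indV_D)

lemma pinv_comp_apply: "u permutes I \<Longrightarrow> v permutes I \<Longrightarrow> pinv (v \<circ> u) i = pinv u (pinv v i)"
  by (simp add: pinv_comp)

lemma pinv_pinv: "s permutes I \<Longrightarrow> pinv (pinv s) = s"
  by (metis permutes_inv_inv)

lemma opW_opC: assumes "s permutes I" "i \<in> I" shows "opW s (opC i F) = opC (s i) (opW s F)"
proof
  fix u
  have "pinv (pinv s \<circ> u) i = pinv u (s i)" if "u permutes I"
    using that assms by (simp add: pinv_comp_apply permutes_inv pinv_pinv)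
  then show "opW s (opC i F) u = opC (s i) (opW s F) u"
    using assms by (auto simp: opW_def opC_def comp_permutes permutes_inv)
qed

lemma opX_opC: assumes "i \<in> I" "l \<in> I" "F \<in> indV"
  shows "opX i (opC l F) = sgn_mult (i = l) (opC l (opX i F))"
proof
  fix u
  show "opX i (opC l F) u = sgn_mult (i = l) (opC l (opX i F)) u"
  proof (cases "u permutes I")
    case u: True
    have s: "sgn_mult b (G :: 'a ind) u = sgn_mult b (G u)" for b G by (simp add: sgn_mult_def)
    have "Q (pinv u j) (pinv u i) (opC l F (transpose i j \<circ> u)) =
      sgn_mult (i = l) (gam (pinv u l) (Q (pinv u j) (pinv u i) (F (transpose i j \<circ> u))))"
      if j: "j \<in> I - {i}" for j
    proof -
      let ?t = "transpose i j"
      have t: "?t permutes I" using assms j by simp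
      have "pinv ?t = ?t" by (rule inv_unique_comp) (auto simp: fun_eq_iff)
      then have "opC l F (?t \<circ> u) = gam (pinv u (?t l)) (F (?t \<circ> u))"
        using u t by (simp add: opC_def comp_permutes pinv_comp_apply)
      moreover have "unital (F (?t \<circ> u))" using assms by (simp add: indV_D)
      moreover have "pinv u i \<in> I" "pinv u j \<in> I" "pinv u l \<in> I" using u j assms by (auto intro: pinv_mem)
      ultimately show ?thesis using u j Q_gam[of "pinv u i" "pinv u j" "F (?t \<circ> u)"]
        by (auto simp: transpose_def sgn_mult_def pinv_eq)
    qed
    note Q = this
    have "opX i (opC l F) u = xi (pinv u i) (gam (pinv u l) (F u)) +
      (\<Sum>j\<in>I - {i}. scf (k * eta i j u) (Q (pinv u j) (pinv u i) (opC l F (transpose i j \<circ> u))))"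
      using u by (simp add: opX_def) (simp add: opC_def)
    also have "\<dots> = sgn_mult (i = l) (gam (pinv u l) (xi (pinv u i) (F u))) +
      (\<Sum>j\<in>I - {i}. scf (k * eta i j u) (sgn_mult (i = l) (gam (pinv u l) (Q (pinv u j) (pinv u i) (F (transpose i j \<circ> u))))))"
      using u by (intro arg_cong2[of _ _ _ _ "(+)"] sum.cong refl) (simp_all add: xi_gam pinv_eq Q)
    also have "\<dots> = sgn_mult (i = l) (opC l (opX i F) u)"
      using u assms by (simp add: opC_def opX_def gam_add gam_sum gam_scf pinv_mem sgn_mult_def scf_minus sum_negf)
    finally show ?thesis by (simp add: s)
  next
    case False
    then show ?thesis by (simp add: opX_def opC_def sgn_mult_def)
  qed
qed

text \<open>An adjacent transposition reverses the order of one pair only, so \<open>eta\<close>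
  changes in a single summand, and that summand is the inhomogeneous term of \<open>sx\<close> or
  \<open>sx'\<close>.\<close>

lemma opW_opX:
  assumes l: "1 \<le> l" "l + 1 \<le> n" and i: "i \<in> I" and F: "F \<in> indV"
  shows "opW (transpose l (l + 1)) (opX i F) =
    opX (transpose l (l + 1) i) (opW (transpose l (l + 1)) F) +
    (if i = l then scV k (- F + opC l (opC (l + 1) F))
     else if i = l + 1 then scV k (F + opC l (opC (l + 1) F)) else 0)"
    (is "_ = _ + ?R")
proof
  let ?s = "transpose l (l + 1)"
  note m = adjacent_mem[OF l]
  have s: "?s permutes I" using m by simp
  fix u
  show "opW ?s (opX i F) u = (opX (?s i) (opW ?s F) + ?R) u"
  proof (cases "u permutes I")
    case False
    then have "\<not> ?s \<circ> u permutes I" using comp_permutes[OF s] by simp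
    then show ?thesis using False F
      by (auto simp: opW_def opX_def scV_def opC_def indV_D scf_def fun_eq_iff)
  next
    case u: True
    let ?p = "pinv u"
    have su: "?s \<circ> u permutes I" using comp_permutes[OF s] u by simp
    have ps: "pinv (?s \<circ> u) j = ?p (?s j)" for j
      using u s by (simp add: pinv_comp_apply)
    let ?q = "\<lambda>j. Q (?p (?s j)) (?p (?s i)) (F (transpose i j \<circ> (?s \<circ> u)))"
    \<comment> \<open>The change of \<open>eta\<close> for j different from i: 1 or -1 if i and j
      are l and l + 1 in some order, and 0 otherwise.\<close>
    define dl :: "nat \<Rightarrow> complex" where "dl j = (if j < i then 1 else 0) - (if ?s j < ?s i then 1 else 0)" for j
    have eta: "eta i j (?s \<circ> u) = eta (?s i) (?s j) u + dl j" for j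
      by (simp add: eta_def ps dl_def)
    have conj: "?s \<circ> (transpose (?s i) (?s j) \<circ> u) = transpose i j \<circ> (?s \<circ> u)" for j
      by (rule ext) (auto simp: transpose_def)
    have "opW ?s (opX i F) u = xi (?p (?s i)) (F (?s \<circ> u)) +
        (\<Sum>j\<in>I - {i}. scf (k * eta i j (?s \<circ> u)) (?q j))"
      using su by (simp add: opW_def opX_def ps)
    also have "\<dots> = xi (?p (?s i)) (F (?s \<circ> u)) +
        (\<Sum>j\<in>I - {i}. scf (k * eta (?s i) (?s j) u) (?q j)) + (\<Sum>j\<in>I - {i}. scf (k * dl j) (?q j))"
      by (simp add: eta distrib_left scf_add' sum.distrib add.assoc)
    also have "(\<Sum>j\<in>I - {i}. scf (k * eta (?s i) (?s j) u) (?q j)) =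
        (\<Sum>j\<in>I - {?s i}. scf (k * eta (?s i) j u)
           (Q (?p j) (?p (?s i)) (F (?s \<circ> (transpose (?s i) j \<circ> u)))))"
    proof (rule sum.reindex_bij_witness[of _ ?s ?s])
      fix j assume j: "j \<in> I - {i}"
      show "?s (?s j) = j" by simp
      show "?s j \<in> I - {?s i}" using j s by (auto simp: transpose_eq_iff)
      show "scf (k * eta (?s i) (?s j) u) (Q (?p (?s j)) (?p (?s i)) (F (?s \<circ> (transpose (?s i) (?s j) \<circ> u)))) =
         scf (k * eta (?s i) (?s j) u) (?q j)"
        by (simp only: conj)
    next
      fix j assume "j \<in> I - {?s i}"
      then show "?s j \<in> I - {i}" using s by (auto simp: transpose_eq_iff)
    qed simp
    also have "xi (?p (?s i)) (F (?s \<circ> u)) + \<dots> = opX (?s i) (opW ?s F) u"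
      using u by (simp add: opX_def opW_def)
    also have "(\<Sum>j\<in>I - {i}. scf (k * dl j) (?q j)) = ?R u"
    proof -
      have gg: "gam (?p l) (gam (?p (l + 1)) f) = - gam (?p (l + 1)) (gam (?p l) f)" for f
        using u m pinv_eq[OF u, of l "l + 1"] by (intro gam_gam) (auto intro: pinv_mem)
      have R: "opC l (opC (l + 1) F) u = gam (?p l) (gam (?p (l + 1)) (F u))"
        using u by (simp add: opC_def)
      have id: "transpose l (l + 1) \<circ> (?s \<circ> u) = u" "transpose (l + 1) l \<circ> (?s \<circ> u) = u"
        by (auto simp: fun_eq_iff transpose_commute)
      consider "i = l" | "i = l + 1" | "i \<noteq> l" "i \<noteq> l + 1" by blast
      then show ?thesis
      proof cases
        case 1
        have "(\<Sum>j\<in>I - {i}. scf (k * dl j) (?q j)) = (\<Sum>j\<in>{l + 1}. scf (k * dl j) (?q j))"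
          using 1 m by (intro sum.mono_neutral_right) (auto simp: dl_def transpose_def)
        also have "\<dots> = ?R u"
          using 1 by (simp add: dl_def Q_def id scV_def R scf_minus' flip: scf_minus)
        finally show ?thesis .
      next
        case 2
        have "(\<Sum>j\<in>I - {i}. scf (k * dl j) (?q j)) = (\<Sum>j\<in>{l}. scf (k * dl j) (?q j))"
          using 2 m by (intro sum.mono_neutral_right) (auto simp: dl_def transpose_def)
        also have "\<dots> = ?R u"
          using 2 by (simp add: dl_def Q_def id scV_def R gg)
        finally show ?thesis .
      next
        case 3
        have "dl j = 0" for j using 3 by (auto simp: dl_def transpose_def)
        then show ?thesis using 3 by simp
      qed
    qed
    finally show ?thesis by (simp add: fun_eq_iff)
  qed
qed

section \<open>Commutativity of the operators of the x_i\<close>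

definition kop :: "nat \<Rightarrow> nat \<Rightarrow> 'a ind \<Rightarrow> 'a ind" where
  "kop i j F = opX i (opX j F) - opX j (opX i F)"

definition delta :: "((nat \<Rightarrow> nat) \<Rightarrow> 'a) \<Rightarrow> 'a ind" where
  "delta f = (\<lambda>u. if u = id then f else 0)"

lemma delta_mem: "unital f \<Longrightarrow> delta f \<in> indV"
  by (auto simp: delta_def indV_def unital_0 permutes_id)

text \<open>A correction could appear only at u = (i j), and there the two comparisons in
  \<open>eta\<close> agree.\<close>

lemma opX_delta: assumes "i \<in> I" shows "opX i (delta f) = delta (xi i f)"
proof
  fix u
  show "opX i (delta f) u = delta (xi i f) u"
  proof (cases "u permutes I")
    case u: True
    have "scf (k * eta i j u) (Q (pinv u j) (pinv u i) (delta f (transpose i j \<circ> u))) = 0" if j: "j \<in> I - {i}" for j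
    proof (cases "transpose i j \<circ> u = id")
      case True
      then have "transpose i j \<circ> (transpose i j \<circ> u) = transpose i j" by simp
      then have "u = transpose i j" by (simp add: o_assoc)
      then have "eta i j u = 0" using j by (auto simp: eta_def)
      then show ?thesis by simp
    qed (simp add: delta_def)
    then have "opX i (delta f) u = xi (pinv u i) (delta f u)" using u by (simp add: opX_def)
    then show ?thesis by (auto simp: delta_def)
  next
    case False
    then show ?thesis using permutes_id[of I] by (auto simp: opX_def delta_def)
  qed
qed

lemma opC_delta: "opC i (delta f) = delta (gam i f)"
  by (rule ext) (use permutes_id[of I] in \<open>auto simp: opC_def delta_def\<close>)

lemma opW_delta: "u permutes I \<Longrightarrow> opW u (delta f) = (\<lambda>v. if v = u then f else 0)"
proof
  fix v assume u: "u permutes I"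
  have "pinv u \<circ> v = id \<longleftrightarrow> v = u"
    using permutes_inv_o[OF u] by (metis comp_id id_comp o_assoc)
  then show "opW u (delta f) v = (if v = u then f else 0)" by (simp add: opW_def delta_def)
qed

lemma opX_minus: "opX i (- F) = - opX i F" and opX_diff: "opX i (F - G) = opX i F - opX i G"
  and opC_minus: "opC i (- F) = - opC i F" and opW_diff: "opW s (F - G) = opW s F - opW s G"
proof -
  show m: "opX i (- F) = - opX i F" for F
    using opX_add[of i F "- F"] opX_add[of i 0 0] by (simp add: eq_neg_iff_add_eq_0 add.commute)
  show "opX i (F - G) = opX i F - opX i G"
    using opX_add[of i F "- G"] by (simp add: m)
  show "opC i (- F) = - opC i F"
    using opC_add[of i F "- F"] opC_add[of i 0 0] by (simp add: eq_neg_iff_add_eq_0 add.commute)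
  show "opW s (F - G) = opW s F - opW s G" by (simp add: opW_def fun_eq_iff)
qed

lemma kop_add: "kop i j (F + G) = kop i j F + kop i j G"
  by (simp add: kop_def opX_add)

lemma scV_simps: "scV a (F - G) = scV a F - scV a G" "scV a (- F) = - scV a F" "scV a (F + G) = scV a F + scV a G"
  by (rule ext, simp add: scV_def scf_diff scf_minus scf_add)+

text \<open>The commutators of the operators \<open>x\<^sub>i\<close> are permuted by \<open>S\<^sub>n\<close>, and vanish on the generators \<open>delta f\<close>.\<close>

lemma opW_kop: assumes l: "1 \<le> l" "l + 1 \<le> n" and i: "i \<in> I" "j \<in> I" and F: "F \<in> indV"
  shows "opW (transpose l (l + 1)) (kop i j F) =
    kop (transpose l (l + 1) i) (transpose l (l + 1) j) (opW (transpose l (l + 1)) F)"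
proof -
  let ?s = "transpose l (l + 1)"
  note m = adjacent_mem[OF l]
  let ?C = "\<lambda>F. opC l (opC (l + 1) F)"
  have C_mem: "?C F \<in> indV" "opX j F \<in> indV" if "F \<in> indV" "j \<in> I" for F j using m that by (auto intro: opC_mem opX_mem)
  define R where "R i F = (if i = l then scV k (- F + ?C F) else if i = l + 1 then scV k (F + ?C F) else 0)" for i F
  have sX: "opW ?s (opX i F) = opX (?s i) (opW ?s F) + R i F" if "i \<in> I" "F \<in> indV" for i F
    using opW_opX[OF l that] by (simp only: R_def)
  have CX: "?C (opX j F) = (if j = l \<or> j = l + 1 then - opX j (?C F) else opX j (?C F))"
    if j: "j \<in> I" and F: "F \<in> indV" for j F
    using m j F opX_opC[of j "l + 1" F] opX_opC[of j l "opC (l + 1) F"]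
    by (auto simp: sgn_mult_def opC_mem opC_minus)
  have RX: "opX j (R i F) = R i (opX j F)" if "j \<in> I" "F \<in> indV" "j \<noteq> l" "j \<noteq> l + 1" for i j F
    using CX[OF that(1,2)] that opX_add[of j 0 0]
    by (auto simp: R_def opX_scV opX_add opX_diff opX_minus)
  \<comment> \<open>The Clifford product \<open>?C\<close> anticommutes with x_l and x_(l+1), and
    the remaining parts of \<open>R l\<close> and \<open>R (l + 1)\<close> have opposite
    signs.\<close>
  have X: "opX (l + 1) (R (l + 1) F) + R l (opX (l + 1) F) = 0" "opX l (R l F) + R (l + 1) (opX l F) = 0"
    if "F \<in> indV" for F
    using CX[OF _ that] m by (auto simp: R_def opX_scV opX_add opX_minus opX_diff scV_simps)
  have step: "opW ?s (opX a (opX b F)) = opX (?s a) (opX (?s b) (opW ?s F)) + opX (?s a) (R b F) + R a (opX b F)"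
    if "a \<in> I" "b \<in> I" for a b
    using that F C_mem by (simp add: sX opX_add)
  \<comment> \<open>The corrections are symmetric in a and b, so none survives in the
    commutator.\<close>
  have main: "opX (?s a) (R b F) + R a (opX b F) = opX (?s b) (R a F) + R b (opX a F)"
    if ab: "a \<in> I" "b \<in> I" for a b
  proof -
    have R0: "R c F = 0" if "c \<noteq> l" "c \<noteq> l + 1" for c F using that by (simp add: R_def)
    have X0: "opX a 0 = 0" for a using opX_add[of a 0 0] by simp
    have s: "?s c = c" if "c \<noteq> l" "c \<noteq> l + 1" for c using that by (simp add: transpose_def)
    consider "a = b" | "a = l" "b = l + 1" | "a = l + 1" "b = l" | "a \<noteq> l" "a \<noteq> l + 1" | "b \<noteq> l" "b \<noteq> l + 1"
      by blast
    then show ?thesis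
    proof cases
      case 2
      then show ?thesis using X[OF F] by simp
    next
      case 3
      then show ?thesis using X[OF F] by simp
    next
      case 4
      then show ?thesis using RX[OF ab(1) F 4] by (simp add: R0 X0 s)
    next
      case 5
      then show ?thesis using RX[OF ab(2) F 5] by (simp add: R0 X0 s)
    qed simp
  qed
  show ?thesis
    unfolding kop_def opW_diff step[OF i] step[OF i(2,1)] add.assoc main[OF i] by simp
qed

lemma opW_opW: "s permutes I \<Longrightarrow> t permutes I \<Longrightarrow> opW s (opW t F) = opW (s \<circ> t) F"
  by (rule ext) (simp add: opW_def pinv_comp o_assoc)

lemma opW_id: "opW id F = F"
  by (simp add: opW_def)

lemma kop_delta: "u permutes I \<Longrightarrow> i \<in> I \<Longrightarrow> j \<in> I \<Longrightarrow> unital f \<Longrightarrow> kop i j (opW u (delta f)) = 0"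
proof (induction arbitrary: i j rule: permutes_adjacent_induct)
  case id
  then show ?case by (simp add: opW_id[unfolded id_def] opW_id kop_def opX_delta xi_xi[of i])
next
  case (adjacent l u)
  let ?s = "transpose l (l + 1)"
  have s: "?s permutes I" using adjacent_mem adjacent by blast
  have mem: "opW u (delta f) \<in> indV" using adjacent by (auto intro: opW_mem delta_mem)
  have "kop (?s (?s i)) (?s (?s j)) (opW ?s (opW u (delta f))) = opW ?s (kop (?s i) (?s j) (opW u (delta f)))"
    using adjacent s mem by (intro opW_kop[symmetric]) auto
  also have "\<dots> = 0" using adjacent s by (simp add: opW_def fun_eq_iff)
  finally show ?case using s adjacent by (simp add: opW_opW comp_def)
qed

lemma fun_sum_apply: "(\<Sum>i\<in>A. f i) u = (\<Sum>i\<in>A. f i u)"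
  by (induction A rule: infinite_finite_induct) auto

text \<open>A direct check would involve products of two correction sums. Instead \<open>F\<close>
  is written as a sum of S_n-translates of elements \<open>delta f\<close>, where the commutators
  are known to vanish.\<close>

lemma opX_opX: assumes "i \<in> I" "j \<in> I" "F \<in> indV" shows "opX i (opX j F) = opX j (opX i F)"
proof -
  have eq: "F = (\<Sum>u | u permutes I. opW u (delta (F u)))"
  proof
    fix v
    have "(\<Sum>u | u permutes I. opW u (delta (F u)) v) = (\<Sum>u | u permutes I. if v = u then F u else 0)"
      by (intro sum.cong refl) (simp add: opW_delta)
    also have "\<dots> = F v" using indV_D(2)[OF assms(3)] by (simp add: finite_permutations)
    finally show "F v = (\<Sum>u | u permutes I. opW u (delta (F u))) v" by (simp add: fun_sum_apply)
  qed
  have "kop i j (\<Sum>u\<in>A. opW u (delta (F u))) = 0" if "A \<subseteq> {u. u permutes I}" for A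
    using that
  proof (induction A rule: infinite_finite_induct)
    case (insert u A)
    have "kop i j (opW u (delta (F u))) = 0"
      using insert.prems assms indV_D(1) by (intro kop_delta) auto
    moreover have "kop i j (\<Sum>u\<in>A. opW u (delta (F u))) = 0"
      using insert by blast
    ultimately show ?case
      unfolding sum.insert[OF insert(1,2), of "\<lambda>u. opW u (delta (F u))"] kop_add by simp
  qed (use kop_add[of i j 0 0] in auto)
  from this[OF order_refl] have "kop i j F = 0" by (simp only: eq[symmetric])
  then show ?thesis by (simp add: kop_def)
qed

section \<open>The induced module and the Jucys-Murphy representation\<close>

definition oprV :: "hc_gen \<Rightarrow> 'a ind \<Rightarrow> 'a ind" where
  "oprV g = (case g of GX i \<Rightarrow> opX i | GC i \<Rightarrow> opC i | GW u \<Rightarrow> opW u)"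

lemma rep_V: "hc_rep n k indV scV oprV"
proof unfold_locales
  fix F G :: "'a ind" and g assume "g \<in> gens n" "F \<in> indV"
  then show "oprV g F \<in> indV"
    by (auto simp: gens_def oprV_def intro: opX_mem opC_mem opW_mem)
next
  fix F G :: "'a ind" and g a assume "g \<in> gens n" "F \<in> indV"
  then show "oprV g (scV a F) = scV a (oprV g F)"
    by (auto simp: gens_def oprV_def opX_scV opC_scV) (simp add: opW_def scV_def)
next
  fix F G :: "'a ind" and g a assume "g \<in> gens n" "F \<in> indV" "G \<in> indV"
  then show "oprV g (F + G) = oprV g F + oprV g G"
    by (auto simp: gens_def oprV_def opX_add opC_add opW_add)
next
  fix F :: "'a ind" assume "F \<in> indV"
  then show "scV 1 F = F" by (auto simp: scV_def scf_def fun_eq_iff indV_def unital_def)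
next
  fix F :: "'a ind" and i j assume "F \<in> indV" "i \<in> I" "j \<in> I"
  then show "oprV (GX i) (oprV (GX j) F) = oprV (GX j) (oprV (GX i) F)"
    by (simp add: oprV_def opX_opX[of i j])
next
  fix F :: "'a ind" and i assume F: "F \<in> indV" and i: "1 \<le> i" "i + 1 \<le> n"
  show "oprV (GW (transpose i (i + 1))) (oprV (GX i) F) =
      oprV (GX (i + 1)) (oprV (GW (transpose i (i + 1))) F) +
      scV k (- F + oprV (GC i) (oprV (GC (i + 1)) F))"
    using opW_opX[OF i _ F, of i] adjacent_mem[OF i] by (simp add: oprV_def)
next
  fix F :: "'a ind" and i j assume F: "F \<in> indV" and i: "1 \<le> i" "i + 1 \<le> n" and j: "j \<in> I" "j \<noteq> i" "j \<noteq> i + 1"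
  show "oprV (GW (transpose i (i + 1))) (oprV (GX j) F) =
      oprV (GX j) (oprV (GW (transpose i (i + 1))) F)"
    using opW_opX[OF i j(1) F] j by (simp add: oprV_def transpose_def)
next
  fix F :: "'a ind" and i j assume F: "F \<in> indV" and ij: "i \<in> I" "j \<in> I" "i \<noteq> j"
  show "oprV (GC i) (oprV (GC j) F) = - oprV (GC j) (oprV (GC i) F)"
    using opC_opC[OF ij] by (simp add: oprV_def)
qed (auto simp: zero_mem add_mem scV_mem scV_add oprV_def opW_id opW_opW opX_opC sgn_mult_def opC_same opW_opC)

definition oprM :: "hc_gen \<Rightarrow> 'a \<Rightarrow> 'a" where
  "oprM g = (*) (case g of GX i \<Rightarrow> M i | GC i \<Rightarrow> c i | GW u \<Rightarrow> w u)"

lemma rep_M: "hc_rep n k {v. E * v = v} (\<lambda>a v. S a * v) oprM"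
proof unfold_locales
  fix v and g assume g: "g \<in> gens n" "v \<in> {v. E * v = v}"
  then show "oprM g v \<in> {v. E * v = v}"
    using Fl_one[OF Fl_M] by (auto simp: gens_def oprM_def one_c one_w simp flip: mult.assoc)
next
  fix v and g a assume g: "g \<in> gens n" "v \<in> {v. E * v = v}"
  then show "oprM g (S a * v) = S a * oprM g v"
    using Fl_central[OF Fl_M] by (auto simp: gens_def oprM_def S_c S_w simp flip: mult.assoc)
next
  fix v i assume v: "v \<in> {v. E * v = v}" and i: "1 \<le> i" "i + 1 \<le> n"
  show "oprM (GW (transpose i (i + 1))) (oprM (GX i) v) =
     oprM (GX (i + 1)) (oprM (GW (transpose i (i + 1))) v) + S k * (- v + oprM (GC i) (oprM (GC (i + 1)) v))"
    using s_M[OF i] v by (simp add: oprM_def flip: mult.assoc) (simp add: distrib_right left_diff_distrib mult.assoc)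
next
  fix v i j assume v: "v \<in> {v. E * v = v}" and i: "i \<in> I" "j \<in> I" "i \<noteq> j"
  show "oprM (GC i) (oprM (GC j) v) = - oprM (GC j) (oprM (GC i) v)"
    using cc[OF i] by (simp add: oprM_def scommD flip: mult.assoc)
qed (use M_c in \<open>auto simp: oprM_def distrib_left distrib_right S_add S_mult w_id w_mult cc_same wc s_M_far scomm_def sgn_mult_def M_M simp flip: mult.assoc S_mult\<close>)

definition point :: "(nat \<Rightarrow> nat) \<Rightarrow> 'a \<Rightarrow> (nat \<Rightarrow> nat) \<Rightarrow> 'a" where
  "point \<alpha> b = (\<lambda>\<beta>. if \<beta> = \<alpha> then b else 0)"

end

text \<open>
  \<open>\<phi>\<close> is the projection to the Sergeev algebra sending \<open>x\<^sub>i\<close> to a Jucys-Murphy element,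
  \<open>\<psi>\<close> the evaluation of the induced module at its generator.
\<close>

locale hc_univ = hc_alg n k S x c w
  for n :: nat and k :: complex and S :: "complex \<Rightarrow> 'a::ring" and x c w +
  fixes \<phi> :: "'a \<Rightarrow> 'a" and \<psi> :: "'a \<Rightarrow> 'a ind"
  assumes phi_S: "\<phi> (S a) = S a"
    and phi_add: "Fl p m g \<Longrightarrow> Fl q l h \<Longrightarrow> \<phi> (g + h) = \<phi> g + \<phi> h"
    and phi_smult: "Fl p m h \<Longrightarrow> \<phi> (S a * h) = S a * \<phi> h"
    and phi_x: "i \<in> {1..n} \<Longrightarrow> Fl p m h \<Longrightarrow> \<phi> (x i * h) = M i * \<phi> h"
    and phi_c: "i \<in> {1..n} \<Longrightarrow> Fl p m h \<Longrightarrow> \<phi> (c i * h) = c i * \<phi> h"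
    and phi_w: "u permutes {1..n} \<Longrightarrow> Fl p m h \<Longrightarrow> \<phi> (w u * h) = w u * \<phi> h"
    and psi_S: "\<psi> (S a) = delta (point (\<lambda>_. 0) (S a))"
    and psi_add: "Fl p m g \<Longrightarrow> Fl q l h \<Longrightarrow> \<psi> (g + h) = \<psi> g + \<psi> h"
    and psi_x: "i \<in> {1..n} \<Longrightarrow> Fl p m h \<Longrightarrow> \<psi> (x i * h) = opX i (\<psi> h)"
    and psi_c: "i \<in> {1..n} \<Longrightarrow> Fl p m h \<Longrightarrow> \<psi> (c i * h) = opC i (\<psi> h)"
    and psi_w: "u permutes {1..n} \<Longrightarrow> Fl p m h \<Longrightarrow> \<psi> (w u * h) = opW u (\<psi> h)"
begin

section \<open>The projection onto the Sergeev algebra\<close>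

lemma phi_0: "\<phi> 0 = 0"
  using phi_S[of 0] by simp

lemma phi_mult: "Fl p m g \<Longrightarrow> Fl q l h \<Longrightarrow> \<phi> (g * h) = \<phi> g * \<phi> h"
proof (induction rule: Fl.induct)
  case (Fl_S m a)
  then show ?case by (simp add: phi_S phi_smult)
next
  case (Fl_add p m g g')
  then show ?case using Fl_mult[of p m g q l h] Fl_mult[of p m g' q l h]
    by (simp add: distrib_right phi_add)
next
  case (Fl_x i p m g)
  then show ?case using phi_x[OF _ Fl_mult[of p m g q l h]] by (simp add: mult.assoc phi_x)
next
  case (Fl_c i p m g)
  then show ?case using phi_c[OF _ Fl_mult[of p m g q l h]] by (simp add: mult.assoc phi_c)
next
  case (Fl_w u p m g)
  then show ?case using phi_w[OF _ Fl_mult[of p m g q l h]] by (simp add: mult.assoc phi_w)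
qed (simp add: phi_0)

lemma phi_Sg: "Fl p 0 h \<Longrightarrow> \<phi> h = h"
  by (induction p "0::nat" h rule: Fl.induct) (auto simp: phi_S phi_0 phi_add phi_c phi_w)

lemma phi_Fl: "Fl p m h \<Longrightarrow> Fl p 0 (\<phi> h)"
proof (induction rule: Fl.induct)
  case (Fl_x i p m h)
  then show ?case using Fl_mult[OF Fl_M[of i 0], of p 0 "\<phi> h"] by (simp add: phi_x)
qed (auto simp: phi_S phi_0 phi_add phi_c phi_w intro: Fl.intros)

lemma phi_x1: "i \<in> I \<Longrightarrow> \<phi> (x i) = M i"
  using phi_x[OF _ Fl_S[of 0 1], of i] by (simp add: x_one phi_S Fl_one'[OF Fl_M])

lemma phi_sum: "(\<And>i. i \<in> A \<Longrightarrow> Fl p m (f i)) \<Longrightarrow> \<phi> (\<Sum>i\<in>A. f i) = (\<Sum>i\<in>A. \<phi> (f i))"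
proof (induction A rule: infinite_finite_induct)
  case (insert a A)
  then show ?case using phi_add[of p m "f a" p m "\<Sum>i\<in>A. f i"] Fl_sum[of A p m f] by simp
qed (auto simp: phi_0)

lemma phi_minus: "Fl p m h \<Longrightarrow> \<phi> (- h) = - \<phi> h"
  using phi_add[of p m h p m "- h"] Fl_minus[of p m h] phi_0 by (simp add: eq_neg_iff_add_eq_0 add.commute)

lemma phi_N: assumes i: "i \<in> I" shows "\<phi> (N i) = 0"
proof -
  have "\<phi> (x i + - M i) = \<phi> (x i) + \<phi> (- M i)"
    by (rule phi_add[OF Fl_x1[OF i] Fl_minus[OF Fl_M[OF i, of 0]]])
  then show ?thesis using phi_x1[OF i] phi_Sg[OF Fl_M[OF i]] phi_minus[OF Fl_M[OF i]] by (simp add: N_def)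
qed

lemma phi_D: "\<phi> Dd = 0"
proof -
  have "\<phi> Dd = (\<Sum>i\<in>I. \<phi> (N i * c i))"
    unfolding Dd_def by (rule phi_sum[of _ True 1]) (auto intro!: Fl_mult'[OF Fl_N Fl_c1[of _ 0]])
  also have "\<dots> = 0"
    by (intro sum.neutral ballI) (simp add: phi_mult[OF Fl_N Fl_c1[of _ 0]] phi_N)
  finally show ?thesis .
qed

lemma phi_psum: "\<phi> (psum a) = (\<Sum>i\<in>I. pw (M i * M i) a)"
proof -
  have "\<phi> (pw (xsq i) a) = pw (M i * M i) a" if "i \<in> I" for i
    using that
    by (induction a) (auto simp: phi_S phi_mult[OF Fl_xsq Fl_pw[OF Fl_xsq]], simp add: xsq_def phi_mult[OF Fl_x1 Fl_x1] phi_x1)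
  then show ?thesis unfolding psum_def
    using phi_sum[of I False "a * 2" "\<lambda>i. pw (xsq i) a"] Fl_pw[OF Fl_xsq] by simp
qed

subsection \<open>Monomials\<close>

definition mi :: "nat \<Rightarrow> (nat \<Rightarrow> nat) set" where
  "mi m = {\<alpha>. (\<forall>i. i \<notin> I \<longrightarrow> \<alpha> i = 0) \<and> sum \<alpha> I = m}"

lemma finite_mi: "finite (mi m)"
proof (rule finite_subset)
  show "mi m \<subseteq> {f. \<forall>i. (i \<in> I \<longrightarrow> f i \<in> {..m}) \<and> (i \<notin> I \<longrightarrow> f i = 0)}"
    by (auto simp: mi_def intro: member_le_sum)
  show "finite {f :: nat \<Rightarrow> nat. \<forall>i. (i \<in> I \<longrightarrow> f i \<in> {..m}) \<and> (i \<notin> I \<longrightarrow> f i = 0)}"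
    by (rule finite_set_of_finite_funs) auto
qed

lemma sum_upd: assumes "i \<in> I" shows "sum (\<alpha>(i := v)) I + \<alpha> i = sum \<alpha> I + v"
proof -
  have "sum (\<alpha>(i := v)) I = v + sum \<alpha> (I - {i})"
    using assms by (subst sum.remove[of _ i]) (auto intro!: sum.cong)
  moreover have "sum \<alpha> I = \<alpha> i + sum \<alpha> (I - {i})" using assms by (subst sum.remove[of _ i]) auto
  ultimately show ?thesis by (simp add: ac_simps)
qed

definition raise :: "nat \<Rightarrow> (nat \<Rightarrow> nat) \<Rightarrow> nat \<Rightarrow> nat" where "raise i \<alpha> = \<alpha>(i := Suc (\<alpha> i))"
definition lower :: "nat \<Rightarrow> (nat \<Rightarrow> nat) \<Rightarrow> nat \<Rightarrow> nat" where "lower i \<alpha> = \<alpha>(i := \<alpha> i - 1)"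

lemma raise_mi: "i \<in> I \<Longrightarrow> \<alpha> \<in> mi m \<Longrightarrow> raise i \<alpha> \<in> mi (Suc m)"
  using sum_upd[of i \<alpha> "Suc (\<alpha> i)"] by (auto simp: mi_def raise_def)

lemma lower_mi: "i \<in> I \<Longrightarrow> \<alpha> \<in> mi (Suc m) \<Longrightarrow> \<alpha> i \<noteq> 0 \<Longrightarrow> lower i \<alpha> \<in> mi m"
  using sum_upd[of i \<alpha> "\<alpha> i - 1"] by (auto simp: mi_def lower_def)

lemma raise_lower: "\<alpha> i \<noteq> 0 \<Longrightarrow> raise i (lower i \<alpha>) = \<alpha>" "lower i (raise i \<alpha>) = \<alpha>"
  by (auto simp: raise_def lower_def fun_eq_iff)

primrec xw :: "nat list \<Rightarrow> 'a" where
  "xw [] = E"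
| "xw (i # l) = x i * xw l"

text \<open>A monomial is stored as a sorted word. Since the x_i commute, identities between
  monomials become equalities of letter counts.\<close>

primrec idx :: "nat \<Rightarrow> (nat \<Rightarrow> nat) \<Rightarrow> nat list" where
  "idx 0 \<alpha> = []"
| "idx (Suc m) \<alpha> = idx m \<alpha> @ replicate (\<alpha> (Suc m)) (Suc m)"

definition xp :: "(nat \<Rightarrow> nat) \<Rightarrow> 'a" where "xp \<alpha> = xw (idx n \<alpha>)"

lemma count_replicate: "count_list (replicate a y) z = (if y = z then a else 0)"
  by (induction a) auto

lemma count_idx: "count_list (idx m \<alpha>) i = (if i \<in> {1..m} then \<alpha> i else 0)"
  by (induction m) (auto simp: count_replicate atLeastAtMost_iff le_Suc_eq)

lemma set_idx: "set (idx m \<alpha>) \<subseteq> {1..m}"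
  by (induction m) (auto simp: atLeastAtMost_iff)

lemma length_idx: "length (idx m \<alpha>) = sum \<alpha> {1..m}"
  by (induction m) auto

lemma Fl_xw: "set l \<subseteq> I \<Longrightarrow> Fl False (length l) (xw l)"
  by (induction l) (auto intro: Fl.intros)

lemma xw_insert: "set (a @ i # b) \<subseteq> I \<Longrightarrow> xw (a @ i # b) = x i * xw (a @ b)"
proof (induction a)
  case (Cons j a)
  then show ?case using xx[of i j] by (simp flip: mult.assoc)
qed simp

lemma xw_count: "set l \<subseteq> I \<Longrightarrow> (\<And>i. count_list l i = count_list l' i) \<Longrightarrow> xw l = xw l'"
proof (induction l arbitrary: l')
  case Nil
  then have "\<And>i. i \<notin> set l'" by (simp add: eq_commute[of 0] count_list_0_iff)
  then have "l' = []" by (cases l') (auto dest: meta_spec[of _ "hd l'"])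
  then show ?case by simp
next
  case (Cons i l)
  have "count_list l' i \<noteq> 0" using Cons.prems(2)[of i] by auto
  then have "i \<in> set l'" by (metis count_list_0_iff)
  then obtain a b where l': "l' = a @ i # b" by (meson split_list)
  have cnt: "count_list l j = count_list (a @ b) j" for j
    using Cons.prems(2)[of j] by (auto simp: l' split: if_splits)
  have "j \<in> set l' \<longleftrightarrow> j \<in> set (i # l)" for j
    using Cons.prems(2)[of j] count_list_0_iff[of l' j] count_list_0_iff[of "i # l" j] by presburger
  then have "set l' = set (i # l)" by blast
  then have "set (a @ i # b) \<subseteq> I" using Cons.prems(1) by (simp only: l')
  then show ?case using Cons.IH[of "a @ b"] cnt Cons.prems(1) by (simp add: l' xw_insert)
qed

lemma xw_xp: "set l \<subseteq> I \<Longrightarrow> xw l = xp (count_list l)"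
  unfolding xp_def by (rule xw_count) (auto simp: count_idx count_list_0_iff)

lemma x_xp: assumes "i \<in> I" "\<alpha> \<in> mi m" shows "x i * xp \<alpha> = xp (raise i \<alpha>)"
proof -
  have "x i * xp \<alpha> = xw (i # idx n \<alpha>)" by (simp add: xp_def)
  also have "\<dots> = xw (idx n (raise i \<alpha>))"
    using assms set_idx[of n \<alpha>] by (intro xw_count) (auto simp: count_idx raise_def)
  finally show ?thesis by (simp add: xp_def)
qed

lemma Fl_xp: "\<alpha> \<in> mi m \<Longrightarrow> Fl False m (xp \<alpha>)"
  using Fl_xw[OF set_idx, of \<alpha>] by (simp add: xp_def length_idx mi_def)

lemma x_xp_comm: "i \<in> I \<Longrightarrow> scomm False (x i) (xp \<alpha>)"
proof -
  assume i: "i \<in> I"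
  have "set l \<subseteq> I \<Longrightarrow> scomm False (x i) (xw l)" for l
    using i by (induction l) (auto intro!: scomm_S[OF Fl_x1] scomm_mult[of False _ _ False] scommI(2)[OF xx])
  then show ?thesis using set_idx by (simp add: xp_def)
qed

lemma c_xw: "j \<in> I \<Longrightarrow> set l \<subseteq> I \<Longrightarrow> scomm (odd (count_list l j)) (c j) (xw l)"
proof (induction l)
  case Nil
  then show ?case using scomm_S[OF Fl_c1[of j 0]] by simp
next
  case (Cons i l)
  then have "scomm (i = j) (c j) (x i)" using scomm_sym[OF xc] by auto
  with Cons show ?case by (auto intro: scomm_mult)
qed

lemma c_xp: "j \<in> I \<Longrightarrow> scomm (odd (\<alpha> j)) (c j) (xp \<alpha>)"
  using c_xw[of j "idx n \<alpha>"] set_idx[of n \<alpha>] by (simp add: xp_def count_idx)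

subsection \<open>Normal forms: spanning\<close>

abbreviation Perms :: "(nat \<Rightarrow> nat) set" where "Perms \<equiv> {u. u permutes I}"

lemma finite_Perms: "finite Perms"
  by (rule finite_permutations) simp

text \<open>Degree strictly below m; for m = 0 this has to mean the zero element, as no natural
  number lies below.\<close>

definition Lt :: "bool \<Rightarrow> nat \<Rightarrow> 'a \<Rightarrow> bool" where
  "Lt p m h \<longleftrightarrow> (case m of 0 \<Rightarrow> h = 0 | Suc l \<Rightarrow> Fl p l h)"

lemma Lt_Suc: "Lt p (Suc m) h \<longleftrightarrow> Fl p m h" by (simp add: Lt_def)
lemma Lt_0: "Lt p m 0" by (auto simp: Lt_def Fl_0 split: nat.split)
lemma Lt_add: "Lt p m g \<Longrightarrow> Lt p m h \<Longrightarrow> Lt p m (g + h)" by (auto simp: Lt_def Fl_add split: nat.splits)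
lemma Lt_diff: "Lt p m g \<Longrightarrow> Lt p m h \<Longrightarrow> Lt p m (g - h)" by (auto simp: Lt_def Fl_diff split: nat.splits)
lemma Lt_sum: "(\<And>i. i \<in> A \<Longrightarrow> Lt p m (f i)) \<Longrightarrow> Lt p m (\<Sum>i\<in>A. f i)"
  by (induction A rule: infinite_finite_induct) (auto intro: Lt_0 Lt_add)
lemma Lt_Fl: "Lt p m h \<Longrightarrow> Fl p m h" by (auto simp: Lt_def intro: Fl_0 Fl_mono split: nat.splits)

lemma Lt_mult: "Fl p m g \<Longrightarrow> Lt q l h \<Longrightarrow> r = (p \<noteq> q) \<Longrightarrow> t = m + l \<Longrightarrow> Lt r t (g * h)"
  by (cases l) (auto simp: Lt_def Lt_0[unfolded Lt_def] intro: Fl_mult')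

lemma Lt_mult_right: "Fl p m g \<Longrightarrow> Lt q l h \<Longrightarrow> r = (p \<noteq> q) \<Longrightarrow> t = m + l \<Longrightarrow> Lt r t (h * g)"
  by (cases l) (auto simp: Lt_def Lt_0[unfolded Lt_def] intro: Fl_mult')

lemma Cl_sgn_mult: "Cl p h \<Longrightarrow> Cl p (sgn_mult q h)"
  by (auto simp: sgn_mult_def intro: Cl_minus)

definition NF :: "nat \<Rightarrow> ((nat \<Rightarrow> nat) \<Rightarrow> (nat \<Rightarrow> nat) \<Rightarrow> 'a) \<Rightarrow> 'a" where
  "NF m b = (\<Sum>u\<in>Perms. \<Sum>\<alpha>\<in>mi m. w u * (xp \<alpha> * b u \<alpha>))"

definition rep :: "bool \<Rightarrow> nat \<Rightarrow> 'a \<Rightarrow> bool" where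
  "rep p m h \<longleftrightarrow> (\<exists>b r. (\<forall>u \<alpha>. Cl p (b u \<alpha>)) \<and> Lt p m r \<and> h = NF m b + r)"

lemma Fl_term: "u permutes I \<Longrightarrow> \<alpha> \<in> mi m \<Longrightarrow> Cl p b \<Longrightarrow> Fl p m (w u * (xp \<alpha> * b))"
  by (intro Fl_w Fl_mult'[OF Fl_xp Cl_Fl[of p b 0]]) auto

lemma Fl_NF: "(\<And>u \<alpha>. Cl p (b u \<alpha>)) \<Longrightarrow> Fl p m (NF m b)"
  unfolding NF_def by (intro Fl_sum Fl_term) auto

lemma NF_add: "NF m (\<lambda>u \<alpha>. b u \<alpha> + b' u \<alpha>) = NF m b + NF m b'"
  by (simp add: NF_def distrib_left sum.distrib)

lemma NF_0: "NF m (\<lambda>u \<alpha>. 0) = 0"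
  by (simp add: NF_def)

lemma rep_add: "rep p m g \<Longrightarrow> rep p m h \<Longrightarrow> rep p m (g + h)"
proof -
  assume "rep p m g" "rep p m h"
  then obtain b r b' r' where "\<forall>u \<alpha>. Cl p (b u \<alpha>)" "Lt p m r" "g = NF m b + r"
    "\<forall>u \<alpha>. Cl p (b' u \<alpha>)" "Lt p m r'" "h = NF m b' + r'" unfolding rep_def by blast
  then show ?thesis unfolding rep_def
    by (intro exI[of _ "\<lambda>u \<alpha>. b u \<alpha> + b' u \<alpha>"] exI[of _ "r + r'"])
      (auto simp: NF_add algebra_simps intro: Cl_add Lt_add)
qed

lemma rep_Lt: "Lt p m r \<Longrightarrow> rep p m r"
  unfolding rep_def by (intro exI[of _ "\<lambda>u \<alpha>. 0"] exI[of _ r]) (auto simp: NF_0 Cl_0)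

lemma rep_sum: "(\<And>i. i \<in> A \<Longrightarrow> rep p m (f i)) \<Longrightarrow> rep p m (\<Sum>i\<in>A. f i)"
  by (induction A rule: infinite_finite_induct) (auto intro: rep_add rep_Lt Lt_0)

lemma rep_term:
  assumes "u permutes I" "\<alpha> \<in> mi m" "Cl p b" shows "rep p m (w u * (xp \<alpha> * b))"
proof -
  let ?b = "\<lambda>v \<beta>. if v = u then if \<beta> = \<alpha> then b else 0 else 0"
  have "NF m ?b = (\<Sum>v\<in>Perms. if v = u then \<Sum>\<beta>\<in>mi m. (if \<beta> = \<alpha> then w v * (xp \<beta> * b) else 0) else 0)"
    unfolding NF_def by (intro sum.cong refl) (auto intro!: sum.cong)
  also have "\<dots> = w u * (xp \<alpha> * b)"
    using assms finite_Perms finite_mi by simp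
  finally show ?thesis unfolding rep_def using assms
    by (intro exI[of _ ?b] exI[of _ 0]) (auto intro: Cl_0 Lt_0)
qed

lemma rep_map:
  assumes "rep p m h" "\<And>u \<alpha> b. u permutes I \<Longrightarrow> \<alpha> \<in> mi m \<Longrightarrow> Cl p b \<Longrightarrow> rep q l (y * (w u * (xp \<alpha> * b)))"
    and "\<And>r. Lt p m r \<Longrightarrow> Lt q l (y * r)"
  shows "rep q l (y * h)"
proof -
  obtain b r where b: "\<forall>u \<alpha>. Cl p (b u \<alpha>)" "Lt p m r" "h = NF m b + r" using assms(1) unfolding rep_def by blast
  have "rep q l (y * NF m b)" unfolding NF_def sum_distrib_left using b by (intro rep_sum assms(2)) auto
  then show ?thesis using b assms(3)[of r] by (auto simp: distrib_left intro: rep_add rep_Lt)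
qed

lemma x_w: assumes "i \<in> I" "u permutes I"
  shows "x i * w u = w u * x (pinv u i) + (M i * w u - w u * M (pinv u i))"
proof -
  have "w u * N (pinv u i) = N i * w u"
    using w_N[OF assms(2), of "pinv u i"] assms by (simp add: pinv_mem permutes_inverses)
  then show ?thesis by (simp add: N_def algebra_simps)
qed

lemma Fl_x_w: assumes "i \<in> I" "u permutes I" shows "Fl False 0 (M i * w u - w u * M (pinv u i))"
  using assms by (intro Fl_diff Fl_mult'[of False 0 _ False 0] Fl_M Fl_w1) (auto intro: pinv_mem)

text \<open>Bringing a new left factor into normal order is exact for c_i and \<open>w v\<close>,
  while x_i leaves a remainder of lower degree by \<open>x_w\<close>.\<close>

lemma rep_Fl: "Fl p m h \<Longrightarrow> rep p m h"
proof (induction rule: Fl.induct)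
  case (Fl_S m a)
  show ?case
  proof (cases m)
    case 0
    have z: "(\<lambda>_. 0) \<in> mi 0" by (simp add: mi_def)
    have "count_list [] = (\<lambda>_ :: nat. 0)" by (rule ext) simp
    then have "xp (\<lambda>_. 0) = E" using xw_xp[of "[]"] by simp
    then have "w id * (xp (\<lambda>_. 0) * S a) = S a" by (simp add: w_id flip: S_mult)
    then show ?thesis using rep_term[OF permutes_id z Cl_S[of a]] 0 by simp
  next
    case (Suc l)
    then show ?thesis by (intro rep_Lt) (simp add: Lt_Suc Fl.Fl_S)
  qed
next
  case (Fl_0 p m)
  then show ?case by (intro rep_Lt Lt_0)
next
  case (Fl_x i p m h)
  show ?case
  proof (rule rep_map[OF Fl_x(3)])
    fix u \<alpha> b assume a: "u permutes I" "\<alpha> \<in> mi m" "Cl p b"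
    let ?r = "M i * w u - w u * M (pinv u i)"
    have p: "pinv u i \<in> I" using a Fl_x by (simp add: pinv_mem)
    have "x i * (w u * (xp \<alpha> * b)) = (x i * w u) * (xp \<alpha> * b)" by (simp add: mult.assoc)
    also have "\<dots> = w u * (x (pinv u i) * xp \<alpha> * b) + ?r * (xp \<alpha> * b)"
      unfolding x_w[OF Fl_x(1) a(1)] by (simp add: distrib_right mult.assoc)
    also have "x (pinv u i) * xp \<alpha> = xp (raise (pinv u i) \<alpha>)" using x_xp[OF p a(2)] .
    finally have eq: "x i * (w u * (xp \<alpha> * b)) = w u * (xp (raise (pinv u i) \<alpha>) * b) + ?r * (xp \<alpha> * b)" .
    have "Fl p m (?r * (xp \<alpha> * b))"
      by (rule Fl_mult'[OF Fl_x_w[OF Fl_x(1) a(1)] Fl_mult'[OF Fl_xp[OF a(2)] Cl_Fl[OF a(3), of 0]]]) auto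
    then show "rep p (Suc m) (x i * (w u * (xp \<alpha> * b)))"
      unfolding eq using a p by (intro rep_add rep_term raise_mi rep_Lt) (auto simp: Lt_Suc)
  qed (use Fl_x in \<open>auto intro!: Lt_mult[OF Fl_x1]\<close>)
next
  case (Fl_c i p m h)
  show ?case
  proof (rule rep_map[OF Fl_c(3)])
    fix u \<alpha> b assume a: "u permutes I" "\<alpha> \<in> mi m" "Cl p b"
    let ?j = "pinv u i"
    have p: "?j \<in> I" using a Fl_c by (simp add: pinv_mem)
    have "c i * w u = w u * c ?j" using wc[OF a(1) p] a by (simp add: permutes_inverses)
    then have "c i * (w u * (xp \<alpha> * b)) = w u * (c ?j * xp \<alpha> * b)" by (simp flip: mult.assoc)
    also have "\<dots> = w u * (xp \<alpha> * (sgn_mult (odd (\<alpha> ?j)) (c ?j * b)))"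
      using c_xp[OF p, of \<alpha>] by (auto simp: scomm_def sgn_mult_def mult.assoc)
    finally show "rep (\<not> p) m (c i * (w u * (xp \<alpha> * b)))"
      using rep_term[OF a(1,2) Cl_sgn_mult[OF Cl_c[OF p a(3)]]] by simp
  qed (use Fl_c in \<open>auto intro!: Lt_mult[OF Fl_c1[of _ 0]]\<close>)
next
  case (Fl_w v p m h)
  show ?case
  proof (rule rep_map[OF Fl_w(3)])
    fix u \<alpha> b assume a: "u permutes I" "\<alpha> \<in> mi m" "Cl p b"
    then show "rep p m (w v * (w u * (xp \<alpha> * b)))"
      using Fl_w rep_term[of "v \<circ> u" \<alpha> m p b] permutes_compose[OF a(1) Fl_w(1)]
      by (simp flip: mult.assoc add: w_mult)
  qed (use Fl_w in \<open>auto intro!: Lt_mult[OF Fl_w1[of _ 0]]\<close>)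
qed (auto intro: rep_add)

subsection \<open>Normal forms: independence\<close>

lemma psi_0: "\<psi> 0 = 0"
  using psi_add[OF Fl_0[of False 0] Fl_0[of False 0]] by simp

lemma psi_sum: "(\<And>i. i \<in> A \<Longrightarrow> Fl p m (f i)) \<Longrightarrow> \<psi> (\<Sum>i\<in>A. f i) = (\<Sum>i\<in>A. \<psi> (f i))"
proof (induction A rule: infinite_finite_induct)
  case (insert a A)
  then show ?case using psi_add[of p m "f a" p m "\<Sum>i\<in>A. f i"] Fl_sum[of A p m f] by simp
qed (auto simp: psi_0)

lemma psi_minus: "Fl p m h \<Longrightarrow> \<psi> (- h) = - \<psi> h"
  using psi_add[of p m h p m "- h"] Fl_minus[of p m h] psi_0 by (simp add: eq_neg_iff_add_eq_0 add.commute)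

lemma psi_Cl: "Cl p b \<Longrightarrow> \<psi> b = delta (point (\<lambda>_. 0) b)"
proof (induction rule: Cl.induct)
  case (Cl_S a)
  then show ?case by (rule psi_S)
next
  case (Cl_0 p)
  then show ?case by (simp add: psi_0 point_def delta_def fun_eq_iff)
next
  case (Cl_add p g h)
  then show ?case using psi_add[OF Cl_Fl[of p g 0] Cl_Fl[of p h 0]]
    by (auto simp: point_def delta_def fun_eq_iff)
next
  case (Cl_c i p h)
  then show ?case using psi_c[OF _ Cl_Fl[of p h 0], of i]
    by (simp add: opC_delta) (auto simp: point_def delta_def gam_def sgn_mult_def fun_eq_iff)
qed

lemma psi_xw: "set l \<subseteq> I \<Longrightarrow> Cl p b \<Longrightarrow> \<psi> (xw l * b) = delta (point (count_list l) b)"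
proof (induction l)
  case Nil
  then show ?case using psi_Cl[of p b] by (simp add: Fl_one[OF Cl_Fl])
next
  case (Cons i l)
  have "xi i (point (count_list l) b) = point (count_list (i # l)) b"
  proof
    fix \<alpha> :: "nat \<Rightarrow> nat"
    have "\<alpha> = count_list (i # l) \<longleftrightarrow> \<alpha> i \<noteq> 0 \<and> \<alpha>(i := \<alpha> i - 1) = count_list l"
      by (auto simp: fun_eq_iff)
    then show "xi i (point (count_list l) b) \<alpha> = point (count_list (i # l)) b \<alpha>"
      by (auto simp: xi_def point_def)
  qed
  moreover have "Fl p (length l) (xw l * b)"
    using Cons Fl_mult'[OF Fl_xw Cl_Fl[of p b 0]] by auto
  ultimately show ?case using Cons by (simp add: mult.assoc psi_x opX_delta del: count_list.simps)
qed

lemma psi_term: assumes "u permutes I" "\<alpha> \<in> mi m" "Cl p b"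
  shows "\<psi> (w u * (xp \<alpha> * b)) v \<beta> = (if v = u then if \<beta> = \<alpha> then b else 0 else 0)"
proof -
  have "count_list (idx n \<alpha>) = \<alpha>" using assms(2) by (auto simp: count_idx mi_def fun_eq_iff)
  then have "\<psi> (xp \<alpha> * b) = delta (point \<alpha> b)"
    unfolding xp_def using psi_xw[OF set_idx assms(3), of \<alpha>] by simp
  moreover have F: "Fl p m (xp \<alpha> * b)"
    by (rule Fl_mult'[OF Fl_xp[OF assms(2)] Cl_Fl[OF assms(3), of 0]]) auto
  ultimately show ?thesis
    using psi_w[OF assms(1) F] assms(1) by (simp add: opW_delta point_def)
qed

text \<open>Only the \<open>xi\<close> part of \<open>opX\<close> raises the degree, and by one; its
  corrections keep it. Hence terms of lower degree are invisible in the top coefficients.\<close>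

lemma psi_high: "Fl p m h \<Longrightarrow> m < sum \<beta> I \<Longrightarrow> \<psi> h v \<beta> = 0"
proof (induction arbitrary: \<beta> v rule: Fl.induct)
  case (Fl_S m a)
  then show ?case by (auto simp: psi_S delta_def point_def)
next
  case (Fl_0 p m)
  then show ?case by (simp add: psi_0)
next
  case (Fl_add p m g h)
  then show ?case by (simp add: psi_add)
next
  case (Fl_x i p m h)
  have Q: "Q q r (\<psi> h u) \<beta> = 0" for q r u
    using Fl_x by (simp add: Q_def gam_def sgn_mult_def)
  have "xi (pinv v i) (\<psi> h v) \<beta> = 0" if v: "v permutes I"
  proof (cases "\<beta> (pinv v i) = 0")
    case False
    then show ?thesis
      using sum_upd[of "pinv v i" \<beta> "\<beta> (pinv v i) - 1"] Fl_x pinv_mem[OF v, of i] by (simp add: xi_def)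
  qed (simp add: xi_def)
  then show ?case using Fl_x by (auto simp: psi_x opX_def fun_sum_apply scf_def Q)
next
  case (Fl_c i p m h)
  then show ?case by (simp add: psi_c opC_def gam_def sgn_mult_def)
next
  case (Fl_w u p m h)
  then show ?case by (simp add: psi_w opW_def)
qed

lemma psi_Lt: "Lt p m h \<Longrightarrow> \<beta> \<in> mi m \<Longrightarrow> \<psi> h v \<beta> = 0"
  using psi_high[of p _ h \<beta> v] by (auto simp: Lt_def psi_0 mi_def split: nat.splits)

lemma psi_sum_terms:
  assumes "finite A" "\<And>a. a \<in> A \<Longrightarrow> f a \<in> mi m" "\<And>u a. a \<in> A \<Longrightarrow> Cl p (b u a)" "v \<in> Perms"
  shows "\<psi> (\<Sum>u\<in>Perms. \<Sum>a\<in>A. w u * (xp (f a) * b u a)) v \<beta> = (\<Sum>a\<in>A. if \<beta> = f a then b v a else 0)"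
proof -
  have "\<psi> (\<Sum>u\<in>Perms. \<Sum>a\<in>A. w u * (xp (f a) * b u a)) v \<beta> =
      (\<Sum>u\<in>Perms. \<psi> (\<Sum>a\<in>A. w u * (xp (f a) * b u a)) v \<beta>)"
    by (subst psi_sum[of _ p m]) (use assms in \<open>auto simp: fun_sum_apply intro!: Fl_sum Fl_term\<close>)
  also have "\<dots> = (\<Sum>u\<in>Perms. \<Sum>a\<in>A. \<psi> (w u * (xp (f a) * b u a)) v \<beta>)"
    by (intro sum.cong refl, subst psi_sum[of _ p m]) (use assms in \<open>auto simp: fun_sum_apply intro!: Fl_term\<close>)
  also have "\<dots> = (\<Sum>u\<in>Perms. if v = u then \<Sum>a\<in>A. if \<beta> = f a then b v a else 0 else 0)"
    using psi_term[OF _ assms(2,3)] by (intro sum.cong refl) (auto intro!: sum.cong)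
  also have "\<dots> = (\<Sum>a\<in>A. if \<beta> = f a then b v a else 0)"
    using assms finite_Perms by simp
  finally show ?thesis .
qed

lemma psi_NF: assumes "\<And>u \<alpha>. Cl p (b u \<alpha>)" "v \<in> Perms" "\<beta> \<in> mi m"
  shows "\<psi> (NF m b) v \<beta> = b v \<beta>"
  unfolding NF_def using psi_sum_terms[of "mi m" "\<lambda>\<alpha>. \<alpha>" m p b v \<beta>] assms finite_mi by simp

lemma NF_cong: "(\<And>u \<alpha>. u \<in> Perms \<Longrightarrow> \<alpha> \<in> mi m \<Longrightarrow> b u \<alpha> = b' u \<alpha>) \<Longrightarrow> NF m b = NF m b'"
  unfolding NF_def by (intro sum.cong refl) simp

text \<open>The leading coefficients are values of \<psi>, so they depend on h alone. This is the
  independence half of the basis theorem.\<close>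

lemma normal_form: assumes "Fl p m h"
  shows "\<exists>b r. (\<forall>u \<alpha>. Cl p (b u \<alpha>)) \<and> Lt p m r \<and> h = NF m b + r \<and>
    (\<forall>u\<in>Perms. \<forall>\<alpha>\<in>mi m. b u \<alpha> = \<psi> h u \<alpha>)"
proof -
  obtain b r where b: "\<And>u \<alpha>. Cl p (b u \<alpha>)" "Lt p m r" "h = NF m b + r"
    using rep_Fl[OF assms] unfolding rep_def by blast
  have "\<psi> h u \<alpha> = b u \<alpha>" if "u \<in> Perms" "\<alpha> \<in> mi m" for u \<alpha>
  proof -
    have "\<psi> h = \<psi> (NF m b) + \<psi> r"
      unfolding b(3) by (rule psi_add[OF Fl_NF Lt_Fl]) (use b in auto)
    then show ?thesis using psi_NF[of p b u \<alpha> m] psi_Lt[OF b(2) that(2)] b(1) that by simp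
  qed
  then show ?thesis using b by (intro exI[of _ b] exI[of _ r]) simp
qed

lemma Fl_drop: assumes h: "Fl p m h" and z: "\<And>u \<alpha>. u \<in> Perms \<Longrightarrow> \<alpha> \<in> mi m \<Longrightarrow> \<psi> h u \<alpha> = 0"
  shows "Lt p m h"
proof -
  obtain b r where b: "Lt p m r" "h = NF m b + r"
    "\<forall>u\<in>Perms. \<forall>\<alpha>\<in>mi m. b u \<alpha> = \<psi> h u \<alpha>" using normal_form[OF h] by blast
  have "NF m b = NF m (\<lambda>_ _. 0)" by (rule NF_cong) (simp add: b(3) z)
  then show ?thesis using b by (simp add: NF_0)
qed

subsection \<open>Central elements are even\<close>

definition ones :: "nat \<Rightarrow> nat" where "ones = (\<lambda>i. if i \<in> I then 1 else 0)"
definition add_ones :: "(nat \<Rightarrow> nat) \<Rightarrow> nat \<Rightarrow> nat" where "add_ones \<alpha> = (\<lambda>i. \<alpha> i + ones i)"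

lemma add_ones_mi: "\<alpha> \<in> mi m \<Longrightarrow> add_ones \<alpha> \<in> mi (n + m)"
  by (auto simp: mi_def add_ones_def ones_def sum.distrib)

lemma ones_mi: "ones \<in> mi n"
  by (auto simp: mi_def ones_def)

lemma add_ones_inj: "add_ones \<alpha> = add_ones \<beta> \<longleftrightarrow> \<alpha> = \<beta>"
  by (auto simp: add_ones_def fun_eq_iff)

lemma xw_append: "set a \<subseteq> I \<Longrightarrow> set b \<subseteq> I \<Longrightarrow> xw (a @ b) = xw a * xw b"
  by (induction a) (auto simp: Fl_one[OF Fl_xw] mult.assoc)

lemma xp_ones: assumes "\<alpha> \<in> mi m" shows "xp ones * xp \<alpha> = xp (add_ones \<alpha>)"
proof -
  have "xp ones * xp \<alpha> = xw (idx n ones @ idx n \<alpha>)" unfolding xp_def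
    by (rule xw_append[symmetric]) (use set_idx in blast)+
  also have "\<dots> = xw (idx n (add_ones \<alpha>))"
    using set_idx[of n] by (intro xw_count) (auto simp: count_idx add_ones_def)
  finally show ?thesis by (simp add: xp_def)
qed

lemma xw_w: "set l \<subseteq> I \<Longrightarrow> u permutes I \<Longrightarrow>
  Lt False (length l) (xw l * w u - w u * xw (map (pinv u) l))"
proof (induction l)
  case Nil
  then show ?case by (simp add: Lt_0 one_w w_one)
next
  case (Cons i l)
  let ?l = "map (pinv u) l" and ?s = "M i * w u - w u * M (pinv u i)"
  let ?r = "xw l * w u - w u * xw ?l"
  have i: "i \<in> I" and l: "set l \<subseteq> I" using Cons by auto
  have l': "set ?l \<subseteq> I" using l pinv_mem[OF Cons.prems(2)] by auto
  have eq0: "w u * xw ?l + ?r = xw l * w u" by simp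
  have "xw (i # l) * w u = x i * (w u * xw ?l + ?r)" by (simp only: eq0 xw.simps mult.assoc)
  also have "\<dots> = (x i * w u) * xw ?l + x i * ?r" by (simp only: distrib_left mult.assoc)
  also have "\<dots> = w u * xw (map (pinv u) (i # l)) + ?s * xw ?l + x i * ?r"
    unfolding x_w[OF i Cons.prems(2)] by (simp add: distrib_right mult.assoc)
  finally have eq: "xw (i # l) * w u - w u * xw (map (pinv u) (i # l)) = ?s * xw ?l + x i * ?r" by simp
  have "Lt False (Suc (length l)) (?s * xw ?l)"
    unfolding Lt_Suc by (rule Fl_mult'[OF Fl_x_w[OF i Cons.prems(2)] Fl_xw[OF l']]) auto
  moreover have "Lt False (Suc (length l)) (x i * ?r)"
    by (rule Lt_mult[OF Fl_x1[OF i] Cons.IH[OF l Cons.prems(2)]]) auto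
  ultimately show ?case unfolding eq by (auto intro: Lt_add)
qed

lemma count_map_inj: "inj f \<Longrightarrow> count_list (map f l) (f y) = count_list l y"
  by (induction l) (auto simp: inj_eq)

lemma xp_ones_w: assumes u: "u permutes I" shows "Lt False n (xp ones * w u - w u * xp ones)"
proof -
  have set: "set (idx n ones) \<subseteq> I" by (rule set_idx)
  have "count_list (map (pinv u) (idx n ones)) i = count_list (idx n ones) i" for i
  proof -
    have "count_list (map (pinv u) (idx n ones)) (pinv u (u i)) = count_list (idx n ones) (u i)"
      by (rule count_map_inj[OF permutes_inj[OF permutes_inv[OF u]]])
    then show ?thesis using u by (simp add: permutes_inverses count_idx ones_def)
  qed
  then have "xw (map (pinv u) (idx n ones)) = xp ones"
    unfolding xp_def using set pinv_mem[OF u] by (intro xw_count) auto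
  then show ?thesis using xw_w[OF set u] ones_mi by (simp add: length_idx mi_def flip: xp_def)
qed

lemma Cl_ones: "Cl p b \<Longrightarrow> scomm p b (xp ones)"
proof (induction rule: Cl.induct)
  case (Cl_S a)
  then show ?case by (intro scomm_sym[OF scomm_S[OF Fl_xp[OF ones_mi]]])
next
  case (Cl_c i p h)
  then have "scomm True (c i) (xp ones)" using c_xp[of i ones] by (simp add: ones_def)
  then show ?case using Cl_c by (intro scomm_mult_left) auto
qed (auto intro: scomm_0_left scomm_add_left)

lemma xp_comm: "scomm False (xp ones) (xp \<alpha>)"
proof -
  have "set l \<subseteq> I \<Longrightarrow> scomm False (xp \<alpha>) (xw l)" for l
  proof (induction l)
    case Nil
    have "set l \<subseteq> I \<Longrightarrow> scomm False (xw l) E" for l by (rule scomm_S[OF Fl_xw])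
    then show ?case using set_idx by (simp add: xp_def)
  next
    case (Cons i l)
    then show ?case using scomm_sym[OF x_xp_comm[of i \<alpha>]] by (auto intro: scomm_mult)
  qed
  from this[OF set_idx] have "scomm False (xp \<alpha>) (xp ones)" by (simp only: xp_def[of ones])
  then show ?thesis by (rule scomm_sym)
qed

text \<open>Odd elements of the Clifford algebra anticommute with \<open>x\<^sub>1 \<cdots> x\<^sub>n\<close>.\<close>

lemma odd_commuting_zero: "Fl True m z \<Longrightarrow> xp ones * z = z * xp ones \<Longrightarrow> z = 0"
proof (induction m)
  have low: "Lt True m z" if z: "Fl True m z" and comm: "xp ones * z = z * xp ones" for m
  proof -
    obtain b r where "\<forall>u \<alpha>. Cl True (b u \<alpha>)" and b2: "Lt True m r" "z = NF m b + r"
      "\<forall>u\<in>Perms. \<forall>\<alpha>\<in>mi m. b u \<alpha> = \<psi> z u \<alpha>" using normal_form[OF z] by blast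
    then have b: "\<And>u \<alpha>. Cl True (b u \<alpha>)" by blast
    note b = b b2
    let ?X = "xp ones"
    define t where "t u \<alpha> = (?X * w u - w u * ?X) * (xp \<alpha> * b u \<alpha>)" for u \<alpha>
    \<comment> \<open>The sign of the odd coefficient doubles the leading term instead of cancelling
      it, and x_1 ... x_n shifts every exponent by one.\<close>
    have X: "?X * (w u * (xp \<alpha> * b u \<alpha>)) - w u * (xp \<alpha> * b u \<alpha>) * ?X =
      w u * (xp (add_ones \<alpha>) * (S 2 * b u \<alpha>)) + t u \<alpha>" if "u \<in> Perms" "\<alpha> \<in> mi m" for u \<alpha>
    proof -
      have "b u \<alpha> * ?X = - (?X * b u \<alpha>)" "?X * xp \<alpha> = xp \<alpha> * ?X"
        using Cl_ones[OF b(1)] xp_comm[of \<alpha>] by (auto simp: scommD)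
      then have "w u * (xp \<alpha> * b u \<alpha>) * ?X = - (w u * (?X * xp \<alpha> * b u \<alpha>))"
        by (simp add: mult.assoc)
      moreover have "S 2 * b u \<alpha> = b u \<alpha> + b u \<alpha>"
        using S_add[of 1 1] Fl_one[OF Cl_Fl[OF b(1)]] by (simp add: distrib_right)
      moreover have "?X * (w u * (xp \<alpha> * b u \<alpha>)) = w u * (?X * xp \<alpha> * b u \<alpha>) + t u \<alpha>"
        by (simp add: t_def left_diff_distrib mult.assoc)
      ultimately show ?thesis using xp_ones[OF that(2)] by (simp add: distrib_left)
    qed
    have t: "Lt True (n + m) (t u \<alpha>)" if "u \<in> Perms" "\<alpha> \<in> mi m" for u \<alpha>
    proof -
      have "Fl True m (xp \<alpha> * b u \<alpha>)" by (rule Fl_mult'[OF Fl_xp[OF that(2)] Cl_Fl[OF b(1), of 0]]) auto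
      from Lt_mult_right[OF this xp_ones_w[of u], of True "n + m"] show ?thesis
        using that by (simp add: t_def)
    qed
    let ?R = "(\<Sum>u\<in>Perms. \<Sum>\<alpha>\<in>mi m. t u \<alpha>) + (?X * r - r * ?X)"
    let ?T = "\<Sum>u\<in>Perms. \<Sum>\<alpha>\<in>mi m. w u * (xp (add_ones \<alpha>) * (S 2 * b u \<alpha>))"
    have R: "Lt True (n + m) ?R"
      using b(2) by (intro Lt_add Lt_sum t Lt_diff Lt_mult[OF Fl_xp[OF ones_mi]]
          Lt_mult_right[OF Fl_xp[OF ones_mi]]) auto
    have "?X * NF m b - NF m b * ?X + (?X * r - r * ?X) = ?X * z - z * ?X"
      by (simp add: b(3) distrib_left distrib_right)
    then have "0 = ?X * NF m b - NF m b * ?X + (?X * r - r * ?X)" using comm by simp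
    also have "?X * NF m b - NF m b * ?X =
      (\<Sum>u\<in>Perms. \<Sum>\<alpha>\<in>mi m. ?X * (w u * (xp \<alpha> * b u \<alpha>)) - w u * (xp \<alpha> * b u \<alpha>) * ?X)"
      unfolding NF_def sum_distrib_left sum_distrib_right by (simp add: sum_subtractf)
    also have "\<dots> = ?T + (\<Sum>u\<in>Perms. \<Sum>\<alpha>\<in>mi m. t u \<alpha>)"
      by (simp add: X sum.distrib)
    finally have "0 = ?T + ?R" by (simp add: add.assoc)
    moreover have "Fl True (n + m) ?T"
      by (intro Fl_sum Fl_term add_ones_mi Cl_smult b) auto
    ultimately have "\<psi> ?T + \<psi> ?R = 0" using psi_add[OF _ Lt_Fl[OF R], of True "n + m" ?T] psi_0 by simp
    then have "\<psi> ?T v \<gamma> + \<psi> ?R v \<gamma> = 0" for v \<gamma> by (simp add: fun_eq_iff)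
    note sum0 = this
    have "\<psi> ?T v (add_ones \<beta>) = 0" if "\<beta> \<in> mi m" for v \<beta>
      using sum0[of v "add_ones \<beta>"] psi_Lt[OF R add_ones_mi[OF that], of v] by simp
    moreover have "\<psi> ?T v (add_ones \<beta>) = S 2 * b v \<beta>" if "v \<in> Perms" "\<beta> \<in> mi m" for v \<beta>
      using psi_sum_terms[of "mi m" add_ones "n + m" True "\<lambda>u \<alpha>. S 2 * b u \<alpha>" v "add_ones \<beta>"]
        that finite_mi add_ones_mi Cl_smult[OF b(1)] by (simp add: add_ones_inj)
    ultimately have "S 2 * b v \<beta> = 0" if "v \<in> Perms" "\<beta> \<in> mi m" for v \<beta> using that by simp
    moreover have "S (1 / 2) * (S 2 * b v \<beta>) = b v \<beta>" for v \<beta>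
      using Fl_one[OF Cl_Fl[OF b(1)]] by (simp flip: mult.assoc S_mult)
    ultimately have "b v \<beta> = 0" if "v \<in> Perms" "\<beta> \<in> mi m" for v \<beta>
      using that by (metis mult_zero_right mem_Collect_eq)
    then show ?thesis using b(4) by (intro Fl_drop[OF z]) simp
  qed
  {
    case 0
    then show ?case using low[of 0] by (simp add: Lt_def)
  next
    case (Suc m)
    then show ?case using low[of "Suc m"] by (simp add: Lt_def)
  }
qed

subsection \<open>Exactness of the symbol of the Dirac differential\<close>

text \<open>For every j exactly one of x_i and c_i anticommutes with c_j.\<close>

lemma Cl_xc: "i \<in> I \<Longrightarrow> Cl p b \<Longrightarrow> scomm p b (x i * c i)"
proof (rotate_tac, induction rule: Cl.induct)
  case (Cl_S a)
  then have "Fl True 1 (x i * c i)" by (intro Fl_mult'[OF Fl_x1 Fl_c1[of _ 0]]) auto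
  then show ?case by (rule scomm_sym[OF scomm_S])
next
  case (Cl_c j p h)
  have "scomm (i = j) (c j) (x i)" using scomm_sym[OF xc[of i j]] Cl_c by auto
  moreover have "scomm (i \<noteq> j) (c j) (c i)"
    using cc[of j i] Cl_c by (cases "i = j") (auto intro: scommI)
  ultimately have "scomm True (c j) (x i * c i)" by (rule scomm_mult) auto
  then show ?case using Cl_c by (intro scomm_mult_left) auto
qed (auto intro: scomm_0_left scomm_add_left)

text \<open>x_i c_i passes b with the sign of the supercommutator, so only the sign of c_i against
  x^\<alpha> counts: the two terms cancel if the exponent of x_i is even and add up to -2 if it is
  odd.\<close>

lemma Dx_term: assumes \<alpha>: "\<alpha> \<in> mi m" and b: "Cl p b"
  shows "Dx * (xp \<alpha> * b) - sgn_mult p (xp \<alpha> * b * Dx) =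
    (\<Sum>i\<in>I. xp (raise i \<alpha>) * (S (if odd (\<alpha> i) then -2 else 0) * (c i * b)))"
proof -
  have "x i * c i * (xp \<alpha> * b) - sgn_mult p (xp \<alpha> * b * (x i * c i)) =
    xp (raise i \<alpha>) * (S (if odd (\<alpha> i) then -2 else 0) * (c i * b))" if i: "i \<in> I" for i
  proof -
    let ?Z = "xp (raise i \<alpha>) * (c i * b)"
    have Z: "x i * xp \<alpha> * (c i * b) = ?Z" using x_xp[OF i \<alpha>] by simp
    have "x i * c i * (xp \<alpha> * b) = x i * (c i * xp \<alpha>) * b" by (simp add: mult.assoc)
    also have "c i * xp \<alpha> = sgn_mult (odd (\<alpha> i)) (xp \<alpha> * c i)" using c_xp[OF i, of \<alpha>] by (simp add: scomm_def)
    also have "x i * \<dots> * b = sgn_mult (odd (\<alpha> i)) ?Z"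
      unfolding Z[symmetric] by (auto simp: sgn_mult_def mult.assoc)
    finally have 1: "x i * c i * (xp \<alpha> * b) = sgn_mult (odd (\<alpha> i)) ?Z" .
    have "xp \<alpha> * b * (x i * c i) = xp \<alpha> * sgn_mult p (x i * c i * b)"
      using Cl_xc[OF i b] by (simp add: scomm_def mult.assoc)
    also have "\<dots> = sgn_mult p (xp \<alpha> * x i * (c i * b))" by (auto simp: sgn_mult_def mult.assoc)
    also have "xp \<alpha> * x i = x i * xp \<alpha>" by (rule scommD(2)[OF scomm_sym[OF x_xp_comm[OF i]]])
    finally have 2: "xp \<alpha> * b * (x i * c i) = sgn_mult p ?Z" by (simp only: Z)
    have "S (-2) * (c i * b) = - (c i * b) - c i * b"
      using S_add[of "-1" "-1"] Fl_one[OF Cl_Fl[OF Cl_c[OF i b]]] by (simp add: distrib_right left_diff_distrib S_minus)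
    then show ?thesis unfolding 1 2 by (auto simp: sgn_mult_def right_diff_distrib)
  qed
  then have "(\<Sum>i\<in>I. x i * c i * (xp \<alpha> * b) - sgn_mult p (xp \<alpha> * b * (x i * c i))) =
    (\<Sum>i\<in>I. xp (raise i \<alpha>) * (S (if odd (\<alpha> i) then -2 else 0) * (c i * b)))"
    by (intro sum.cong) auto
  then show ?thesis
    by (cases p) (simp_all add: Dx_def sum_distrib_left sum_distrib_right sum_subtractf sgn_mult_def
        sum_negf sum.distrib)
qed

abbreviation ev_pos :: "nat \<Rightarrow> bool" where "ev_pos a \<equiv> a \<noteq> 0 \<and> even a"

text \<open>The symbol of d. Raising an odd exponent leaves a positive even one, hence
  \<open>ev_pos\<close>. The contributions of \<open>Ms\<close> and of the lower part of h stay in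
  degree m and are invisible in degree m + 1.\<close>

lemma psi_d: assumes h: "Fl p m h" and v: "v \<in> Perms" and \<gamma>: "\<gamma> \<in> mi (Suc m)"
  shows "\<psi> (Dd * h - sgn_mult p (h * Dd)) v \<gamma> =
    (\<Sum>i\<in>I. if ev_pos (\<gamma> i) then S (-2) * (c i * \<psi> h v (lower i \<gamma>)) else 0)"
proof -
  obtain b r where "\<forall>u \<alpha>. Cl p (b u \<alpha>)" and b2: "Lt p m r" "h = NF m b + r"
    "\<forall>u\<in>Perms. \<forall>\<alpha>\<in>mi m. b u \<alpha> = \<psi> h u \<alpha>" using normal_form[OF h] by blast
  then have b: "\<And>u \<alpha>. Cl p (b u \<alpha>)" by blast
  note b = b b2
  define d where "d y = Dd * y - sgn_mult p (y * Dd)" for y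
  have d_add: "d (y + z) = d y + d z" for y z
    by (simp add: d_def distrib_left distrib_right sgn_mult_simps)
  have d_sum: "d (\<Sum>i\<in>A. f i) = (\<Sum>i\<in>A. d (f i))" for f :: "'b \<Rightarrow> 'a" and A
    using d_add[of 0 0] by (induction A rule: infinite_finite_induct) (auto simp: d_add)
  define B where "B u a = S (if odd (fst a (snd a)) then -2 else 0) * (c (snd a) * b u (fst a))" for u and a :: "(nat \<Rightarrow> nat) \<times> nat"
  define t where "t u \<alpha> = w u * (Ms * (xp \<alpha> * b u \<alpha>) - sgn_mult p (xp \<alpha> * b u \<alpha> * Ms))" for u \<alpha>
  have dterm: "d (w u * (xp \<alpha> * b u \<alpha>)) = (\<Sum>i\<in>I. w u * (xp (raise i \<alpha>) * B u (\<alpha>, i))) - t u \<alpha>"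
    if "u \<in> Perms" "\<alpha> \<in> mi m" for u \<alpha>
  proof -
    let ?y = "xp \<alpha> * b u \<alpha>"
    have "Dd * w u = w u * Dd" using D_w that by simp
    then have "d (w u * ?y) = w u * d ?y"
      by (simp add: d_def right_diff_distrib sgn_mult_def flip: mult.assoc)
    also have "d ?y = (Dx * ?y - sgn_mult p (?y * Dx)) - (Ms * ?y - sgn_mult p (?y * Ms))"
      by (simp add: d_def Dd_Dx left_diff_distrib right_diff_distrib sgn_mult_def)
    finally show ?thesis unfolding t_def B_def Dx_term[OF that(2) b(1)]
      by (simp add: right_diff_distrib sum_distrib_left)
  qed
  have t: "Fl (\<not> p) m (t u \<alpha>)" if "u \<in> Perms" "\<alpha> \<in> mi m" for u \<alpha>
  proof -
    have y: "Fl p m (xp \<alpha> * b u \<alpha>)" by (rule Fl_mult'[OF Fl_xp[OF that(2)] Cl_Fl[OF b(1), of 0]]) auto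
    show ?thesis unfolding t_def using that
      by (intro Fl_w Fl_diff Fl_sgn_mult Fl_mult'[OF Fl_Ms[of 0] y] Fl_mult'[OF y Fl_Ms[of 0]]) auto
  qed
  let ?T = "\<Sum>u\<in>Perms. \<Sum>a\<in>mi m \<times> I. w u * (xp (raise (snd a) (fst a)) * B u a)"
  let ?R = "d r - (\<Sum>u\<in>Perms. \<Sum>\<alpha>\<in>mi m. t u \<alpha>)"
  have dr: "Fl (\<not> p) m (d r)"
  proof (cases m)
    case 0
    then have "d r = 0" using b(2) by (simp add: Lt_def d_def sgn_mult_def)
    then show ?thesis by (simp add: Fl_0)
  next
    case (Suc l)
    then have "Fl p l r" using b(2) by (simp add: Lt_def)
    then show ?thesis unfolding d_def using Suc
      by (intro Fl_diff Fl_sgn_mult Fl_mult'[OF Fl_D] Fl_mult'[OF _ Fl_D]) auto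
  qed
  then have R: "Fl (\<not> p) m ?R" using t by (intro Fl_diff Fl_sum) auto
  have "d h = (\<Sum>u\<in>Perms. \<Sum>\<alpha>\<in>mi m. d (w u * (xp \<alpha> * b u \<alpha>))) + d r"
    by (simp add: b(3) d_add NF_def d_sum)
  also have "\<dots> = (\<Sum>u\<in>Perms. \<Sum>\<alpha>\<in>mi m. \<Sum>i\<in>I. w u * (xp (raise i \<alpha>) * B u (\<alpha>, i))) + ?R"
    by (simp add: dterm sum_subtractf)
  also have "(\<Sum>u\<in>Perms. \<Sum>\<alpha>\<in>mi m. \<Sum>i\<in>I. w u * (xp (raise i \<alpha>) * B u (\<alpha>, i))) = ?T"
    by (simp add: sum.cartesian_product case_prod_beta)
  finally have dh: "d h = ?T + ?R" .
  have fin: "finite (mi m \<times> I)" using finite_mi by simp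
  have B: "Cl (\<not> p) (B u a)" if "a \<in> mi m \<times> I" for u a
    unfolding B_def using that by (intro Cl_smult Cl_c b) auto
  have fm: "raise (snd a) (fst a) \<in> mi (Suc m)" if "a \<in> mi m \<times> I" for a
    using that by (auto intro: raise_mi)
  have T: "Fl (\<not> p) (Suc m) ?T" using B fm by (intro Fl_sum Fl_term) auto
  have "\<psi> (d h) v \<gamma> = \<psi> ?T v \<gamma> + \<psi> ?R v \<gamma>" unfolding dh by (subst psi_add[OF T R]) simp
  also have "\<psi> ?R v \<gamma> = 0" using \<gamma> by (intro psi_high[OF R]) (simp add: mi_def)
  also have "\<psi> ?T v \<gamma> = (\<Sum>a\<in>mi m \<times> I. if \<gamma> = raise (snd a) (fst a) then B v a else 0)"
    by (rule psi_sum_terms[OF fin fm B v])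
  also have "\<dots> = (\<Sum>\<alpha>\<in>mi m. \<Sum>i\<in>I. if \<gamma> = raise i \<alpha> then B v (\<alpha>, i) else 0)"
    by (subst sum.cartesian_product) (auto intro!: sum.cong)
  also have "\<dots> = (\<Sum>i\<in>I. \<Sum>\<alpha>\<in>mi m. if \<gamma> = raise i \<alpha> then B v (\<alpha>, i) else 0)"
    by (rule sum.swap)
  also have "\<dots> = (\<Sum>i\<in>I. if ev_pos (\<gamma> i) then S (-2) * (c i * \<psi> h v (lower i \<gamma>)) else 0)"
  proof (rule sum.cong[OF refl])
    fix i assume i: "i \<in> I"
    show "(\<Sum>\<alpha>\<in>mi m. if \<gamma> = raise i \<alpha> then B v (\<alpha>, i) else 0) =
      (if ev_pos (\<gamma> i) then S (-2) * (c i * \<psi> h v (lower i \<gamma>)) else 0)"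
    proof (cases "\<gamma> i = 0")
      case True
      then have "\<gamma> \<noteq> raise i \<alpha>" for \<alpha> by (auto simp: raise_def fun_eq_iff)
      then show ?thesis using True by simp
    next
      case False
      have "\<gamma> = raise i \<alpha> \<longleftrightarrow> \<alpha> = lower i \<gamma>" for \<alpha>
        using raise_lower(1)[of \<gamma> i, OF False] raise_lower(2)[of i \<alpha>] by auto
      moreover have "lower i \<gamma> \<in> mi m" using lower_mi[OF i \<gamma> False] .
      moreover have "odd (lower i \<gamma> i) \<longleftrightarrow> even (\<gamma> i)" using False by (simp add: lower_def)
      ultimately show ?thesis using False b(4) v finite_mi by (simp add: B_def)
    qed
  qed
  finally show ?thesis by (simp add: d_def)
qed

lemma Cl_psi: "Fl p m h \<Longrightarrow> v \<in> Perms \<Longrightarrow> \<alpha> \<in> mi m \<Longrightarrow> Cl p (\<psi> h v \<alpha>)"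
proof -
  assume h: "Fl p m h" and v: "v \<in> Perms" "\<alpha> \<in> mi m"
  obtain b where "\<forall>u \<alpha>. Cl p (b u \<alpha>)" "\<forall>u\<in>Perms. \<forall>\<alpha>\<in>mi m. b u \<alpha> = \<psi> h u \<alpha>"
    using normal_form[OF h] by blast
  then show "Cl p (\<psi> h v \<alpha>)" using v by metis
qed

definition nz :: "(nat \<Rightarrow> nat) \<Rightarrow> nat" where "nz \<alpha> = card {i \<in> I. \<alpha> i \<noteq> 0}"

text \<open>
  On symbols the differential raises the odd exponents, and lowering the even positive exponents is
  a contracting homotopy up to the number of nonzero exponents.
\<close>

lemma exact_step:
  assumes h: "Fl False (Suc m) h" and Dh: "Dd * h = h * Dd"
  shows "\<exists>e. Fl True m e \<and> Fl False m (h - (Dd * e + e * Dd))"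
proof -
  let ?b = "\<psi> h"
  have bC: "Cl False (?b v \<alpha>)" if "v \<in> Perms" "\<alpha> \<in> mi (Suc m)" for v \<alpha>
    using Cl_psi[OF h that] .
  \<comment> \<open>Closedness of h on the level of symbols.\<close>
  have star: "(\<Sum>i\<in>I. if ev_pos (\<gamma> i) then c i * ?b v (lower i \<gamma>) else 0) = 0"
    if "v \<in> Perms" "\<gamma> \<in> mi (Suc (Suc m))" for v \<gamma>
  proof -
    let ?s = "\<Sum>i\<in>I. if ev_pos (\<gamma> i) then c i * ?b v (lower i \<gamma>) else 0"
    have "S (-2) * ?s = \<psi> (Dd * h - sgn_mult False (h * Dd)) v \<gamma>"
      unfolding psi_d[OF h that] sum_distrib_left by (intro sum.cong) auto
    also have "\<dots> = 0" using Dh by (simp add: sgn_mult_def psi_0)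
    finally have 0: "S (-2) * ?s = 0" .
    have "Fl True 0 ?s"
      using that by (intro Fl_sum) (auto intro!: Cl_c[of _ False, simplified] Cl_Fl bC lower_mi Fl_0)
    then have "?s = S (- 1 / 2) * (S (-2) * ?s)" using Fl_one by (simp flip: mult.assoc S_mult)
    then show ?thesis using 0 by simp
  qed
  \<comment> \<open>The homotopy that lowers positive even exponents. The factor 1 / 2 offsets the
    -2 of \<open>psi_d\<close>, with the sign supplied by c_i c_i = -1; division by
    \<open>nz\<close> normalizes the equal contributions from \<open>?Ev\<close> and
    \<open>?Od\<close> counted below.\<close>
  define g where "g v \<beta> = (if v \<in> Perms \<and> \<beta> \<in> mi m then S (1 / (2 * of_nat (nz \<beta>))) *
    (\<Sum>j\<in>I. if odd (\<beta> j) then c j * ?b v (raise j \<beta>) else 0) else 0)" for v \<beta>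
  have gC: "Cl True (g v \<beta>)" for v \<beta>
    unfolding g_def by (auto intro!: Cl_0 Cl_smult Cl_sum Cl_c[of _ False, simplified] bC raise_mi)
  define e where "e = NF m g"
  have e: "Fl True m e" unfolding e_def by (rule Fl_NF) (rule gC)
  let ?h = "h - (Dd * e + e * Dd)"
  have de: "Fl False (Suc m) (Dd * e + e * Dd)"
    by (intro Fl_add Fl_mult'[OF Fl_D e] Fl_mult'[OF e Fl_D]) auto
  have "\<psi> ?h v \<alpha> = 0" if v: "v \<in> Perms" and \<alpha>: "\<alpha> \<in> mi (Suc m)" for v \<alpha>
  proof -
    let ?N = "of_nat (nz \<alpha>) :: complex"
    let ?Ev = "{i \<in> I. ev_pos (\<alpha> i)}" and ?Od = "{i \<in> I. odd (\<alpha> i)}"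
    have b1: "E * ?b v \<alpha> = ?b v \<alpha>" using Fl_one[OF Cl_Fl[OF bC[OF v \<alpha>]]] .
    have cmul: "c i * (c i * ?b v \<alpha>) = - ?b v \<alpha>" if "i \<in> I" for i
      using c_c_cancel[OF that Cl_Fl[OF bC[OF v \<alpha>], of 0]] .
    have inner: "S (-2) * (c i * g v (lower i \<alpha>)) =
        S (1 / ?N) * (?b v \<alpha> - (\<Sum>j\<in>?Od. c i * (c j * ?b v (raise j (lower i \<alpha>)))))"
      if i: "i \<in> ?Ev" for i
    proof -
      \<comment> \<open>A positive even exponent is at least 2, so lowering it creates no new
        zero.\<close>
      have nz: "nz (lower i \<alpha>) = nz \<alpha>"
        unfolding nz_def lower_def using i by (intro arg_cong[of _ _ card]) (auto elim: oddE)
      have low: "lower i \<alpha> \<in> mi m" using i \<alpha> by (intro lower_mi) auto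
      have I: "{j \<in> I. odd (lower i \<alpha> j)} = insert i ?Od" using i by (auto simp: lower_def)
      have "(\<Sum>j\<in>I. if odd (lower i \<alpha> j) then c j * ?b v (raise j (lower i \<alpha>)) else 0) =
          (\<Sum>j\<in>{j \<in> I. odd (lower i \<alpha> j)}. c j * ?b v (raise j (lower i \<alpha>)))"
        by (simp add: sum.inter_filter[symmetric])
      also have "\<dots> = c i * ?b v \<alpha> + (\<Sum>j\<in>?Od. c j * ?b v (raise j (lower i \<alpha>)))"
        unfolding I using i by (simp add: raise_lower)
      finally have sum: "(\<Sum>j\<in>I. if odd (lower i \<alpha> j) then c j * ?b v (raise j (lower i \<alpha>)) else 0) =
         c i * ?b v \<alpha> + (\<Sum>j\<in>?Od. c j * ?b v (raise j (lower i \<alpha>)))" .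
      have "g v (lower i \<alpha>) = S (1 / (2 * ?N)) * (c i * ?b v \<alpha> + (\<Sum>j\<in>?Od. c j * ?b v (raise j (lower i \<alpha>))))"
        unfolding g_def nz using low v sum by simp
      moreover have "c i * (S (1 / (2 * ?N)) * y) = S (1 / (2 * ?N)) * (c i * y)" for y
        using S_c[of i "1 / (2 * ?N)"] i by (simp flip: mult.assoc)
      ultimately have "S (-2) * (c i * g v (lower i \<alpha>)) = S (-2) * (S (1 / (2 * ?N)) *
          (c i * (c i * ?b v \<alpha>) + (\<Sum>j\<in>?Od. c i * (c j * ?b v (raise j (lower i \<alpha>))))))"
        by (simp add: distrib_left sum_distrib_left)
      also have "\<dots> = S (- (1 / ?N)) *
          (- ?b v \<alpha> + (\<Sum>j\<in>?Od. c i * (c j * ?b v (raise j (lower i \<alpha>)))))"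
        using i cmul by (simp flip: mult.assoc S_mult)
      finally show ?thesis by (simp add: S_minus algebra_simps)
    qed
    \<comment> \<open>Closedness at \<alpha> raised in j: there j joins the positive even positions,
      and its term balances the sum over \<open>?Ev\<close>.\<close>
    have outer: "(\<Sum>i\<in>?Ev. c i * (c j * ?b v (raise j (lower i \<alpha>)))) = - ?b v \<alpha>" if j: "j \<in> ?Od" for j
    proof -
      have up: "raise j \<alpha> \<in> mi (Suc (Suc m))" using j \<alpha> by (intro raise_mi) auto
      have I: "{i \<in> I. ev_pos (raise j \<alpha> i)} = insert j ?Ev" using j by (auto simp: raise_def)
      have sw: "raise j (lower i \<alpha>) = lower i (raise j \<alpha>)" if "i \<in> ?Ev" for i
        using that j by (auto simp: raise_def lower_def fun_eq_iff)
      have "(\<Sum>i\<in>I. if ev_pos (raise j \<alpha> i) then c i * ?b v (lower i (raise j \<alpha>)) else 0) =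
          (\<Sum>i\<in>{i \<in> I. ev_pos (raise j \<alpha> i)}. c i * ?b v (lower i (raise j \<alpha>)))"
        by (simp add: sum.inter_filter[symmetric])
      also have "\<dots> = c j * ?b v \<alpha> + (\<Sum>i\<in>?Ev. c i * ?b v (lower i (raise j \<alpha>)))"
        unfolding I using j by (simp add: raise_lower)
      finally have 1: "(\<Sum>i\<in>?Ev. c i * ?b v (lower i (raise j \<alpha>))) = - (c j * ?b v \<alpha>)"
        using star[OF v up] by (simp add: eq_neg_iff_add_eq_0 add.commute)
      have "c i * (c j * ?b v (raise j (lower i \<alpha>))) = - (c j * (c i * ?b v (lower i (raise j \<alpha>))))"
        if "i \<in> ?Ev" for i
      proof -
        have "c i * c j = - (c j * c i)" using that j cc[of i j] by (cases "i = j") (auto simp: scommD)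
        then show ?thesis using sw[OF that] by (simp flip: mult.assoc)
      qed
      then have "(\<Sum>i\<in>?Ev. c i * (c j * ?b v (raise j (lower i \<alpha>)))) =
          - (c j * (\<Sum>i\<in>?Ev. c i * ?b v (lower i (raise j \<alpha>))))"
        unfolding sum_distrib_left sum_negf[symmetric] by (intro sum.cong refl) auto
      then show ?thesis unfolding 1 using cmul j by simp
    qed
    have scal: "(\<Sum>i\<in>A. ?b v \<alpha>) = S (of_nat (card A)) * ?b v \<alpha>" if "finite A" for A :: "nat set"
      using that by (induction A rule: finite_induct) (auto simp: S_add distrib_right b1)
    have cards: "nz \<alpha> = card ?Ev + card ?Od"
    proof -
      have "{i \<in> I. \<alpha> i \<noteq> 0} = ?Ev \<union> ?Od" by (auto intro: odd_pos)
      moreover have "?Ev \<inter> ?Od = {}" by auto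
      ultimately show ?thesis unfolding nz_def by (simp add: card_Un_disjoint)
    qed
    have "nz \<alpha> \<noteq> 0"
    proof
      assume "nz \<alpha> = 0"
      then have "\<forall>i\<in>I. \<alpha> i = 0" by (auto simp: nz_def)
      then show False using \<alpha> by (simp add: mi_def)
    qed
    have "\<psi> (Dd * e - sgn_mult True (e * Dd)) v \<alpha> =
      (\<Sum>i\<in>I. if ev_pos (\<alpha> i) then S (-2) * (c i * \<psi> e v (lower i \<alpha>)) else 0)"
      by (rule psi_d[OF e v \<alpha>])
    also have "\<dots> = (\<Sum>i\<in>?Ev. S (-2) * (c i * \<psi> e v (lower i \<alpha>)))"
      by (simp add: sum.inter_filter[symmetric])
    also have "\<dots> = (\<Sum>i\<in>?Ev. S (1 / ?N) * (?b v \<alpha> - (\<Sum>j\<in>?Od. c i * (c j * ?b v (raise j (lower i \<alpha>))))))"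
    proof (intro sum.cong refl)
      fix i assume i: "i \<in> ?Ev"
      then have "lower i \<alpha> \<in> mi m" using \<alpha> by (intro lower_mi) auto
      then have "\<psi> e v (lower i \<alpha>) = g v (lower i \<alpha>)" unfolding e_def using psi_NF[of True g v] gC v by simp
      then show "S (-2) * (c i * \<psi> e v (lower i \<alpha>)) =
        S (1 / ?N) * (?b v \<alpha> - (\<Sum>j\<in>?Od. c i * (c j * ?b v (raise j (lower i \<alpha>)))))"
        using inner[OF i] by simp
    qed
    also have "\<dots> = S (1 / ?N) * ((\<Sum>i\<in>?Ev. ?b v \<alpha>) - (\<Sum>i\<in>?Ev. \<Sum>j\<in>?Od. c i * (c j * ?b v (raise j (lower i \<alpha>)))))"
      by (simp add: sum_distrib_left[symmetric] sum_subtractf)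
    also have "(\<Sum>i\<in>?Ev. \<Sum>j\<in>?Od. c i * (c j * ?b v (raise j (lower i \<alpha>)))) =
        (\<Sum>j\<in>?Od. \<Sum>i\<in>?Ev. c i * (c j * ?b v (raise j (lower i \<alpha>))))" by (rule sum.swap)
    also have "\<dots> = - (\<Sum>j\<in>?Od. ?b v \<alpha>)" unfolding sum_negf[symmetric] by (intro sum.cong refl outer)
    also have "(\<Sum>i\<in>?Ev. ?b v \<alpha>) - - (\<Sum>j\<in>?Od. ?b v \<alpha>) = S ?N * ?b v \<alpha>"
      by (simp add: scal cards S_add distrib_right)
    also have "S (1 / ?N) * (S ?N * ?b v \<alpha>) = ?b v \<alpha>"
      using \<open>nz \<alpha> \<noteq> 0\<close> b1 by (simp flip: mult.assoc S_mult)
    finally have "\<psi> (Dd * e + e * Dd) v \<alpha> = ?b v \<alpha>" by (simp add: sgn_mult_def)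
    moreover have "\<psi> ?h = \<psi> h + - \<psi> (Dd * e + e * Dd)"
      by (simp only: diff_conv_add_uminus[of h] psi_add[OF h Fl_minus[OF de]] psi_minus[OF de])
    ultimately show ?thesis by simp
  qed
  then have "Lt False (Suc m) ?h" by (intro Fl_drop Fl_diff h de)
  then show ?thesis using e by (auto simp: Lt_Suc)
qed

text \<open>Each step subtracts an exact term. The primitive is first replaced by its twisted
  average, so that the remainder is again invariant and commutes with \<open>Dd\<close>, as the next
  step requires.\<close>

lemma dirac_cohomology:
  "Fl False m h \<Longrightarrow> sginv False h \<Longrightarrow> Dd * h = h * Dd \<Longrightarrow>
   \<exists>e l y. Fl True l e \<and> Fl False 0 y \<and> sginv False y \<and> h = y + (Dd * e + e * Dd)"
proof (induction m arbitrary: h)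
  case 0
  then show ?case by (intro exI[of _ 0] exI[of _ h]) (auto intro: Fl_0)
next
  case (Suc m)
  obtain e where e: "Fl True m e" "Fl False m (h - (Dd * e + e * Dd))"
    using exact_step[OF Suc.prems(1,3)] by blast
  let ?e = "Av True e"
  let ?h = "h - (Dd * ?e + ?e * Dd)"
  have e': "Fl True m ?e" "sginv True ?e" using e(1) by (auto intro: Fl_Av sginv_Av)
  have de: "Fl False (Suc m) (Dd * e + e * Dd)"
    by (intro Fl_add Fl_mult'[OF Fl_D e(1)] Fl_mult'[OF e(1) Fl_D]) auto
  \<comment> \<open>The remainder is the average of the one from \<open>exact_step\<close>, hence
    invariant and of degree m.\<close>
  have h': "?h = Av False (h - (Dd * e + e * Dd))"
    using Av_fix[OF Suc.prems(1,2)] by (simp add: Av_diff Av_D)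
  have "Fl False m ?h" "sginv False ?h"
    unfolding h' using e(2) by (auto intro: Fl_Av sginv_Av)
  moreover have "Dd * ?h = ?h * Dd"
  proof -
    \<comment> \<open>d squares to zero on \<open>?e\<close> because it is a twisted
      invariant.\<close>
    have "Dd * Dd * ?e = ?e * (Dd * Dd)" using sginv_Dsq[OF e'(2,1)] by (simp add: scommD)
    then show ?thesis using Suc.prems(3) by (simp add: algebra_simps)
  qed
  ultimately obtain e1 l y where y: "Fl True l e1" "Fl False 0 y" "sginv False y" "?h = y + (Dd * e1 + e1 * Dd)"
    using Suc.IH by blast
  have "h = y + (Dd * (e1 + ?e) + (e1 + ?e) * Dd)"
    using y(4) by (simp add: algebra_simps)
  moreover have "Fl True (max l m) (e1 + ?e)"
    using y(1) e'(1) by (intro Fl_add) (auto intro: Fl_mono)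
  ultimately show ?case using y by blast
qed

end

section \<open>Cycles\<close>

text \<open>A product of transpositions with the common point i, the shape in which cycles arise
  from powers of \<open>M i\<close>. For distinct entries each one is sent to its predecessor, and i
  to the last.\<close>

primrec cyc :: "'b \<Rightarrow> 'b list \<Rightarrow> 'b \<Rightarrow> 'b" where
  "cyc i [] = id"
| "cyc i (j # js) = transpose j i \<circ> cyc i js"

lemma cyc_permutes: "i \<in> A \<Longrightarrow> set js \<subseteq> A \<Longrightarrow> cyc i js permutes A"
  by (induction js) (auto intro!: permutes_compose permutes_swap_id permutes_id simp: comp_def[symmetric])

lemma cyc_outside: "y \<noteq> i \<Longrightarrow> y \<notin> set js \<Longrightarrow> cyc i js y = y"
  by (induction js) auto

lemma cyc_first: "distinct (i # js) \<Longrightarrow> cyc i js i = last (i # js)"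
proof (induction js)
  case (Cons j js)
  then have "last (i # js) = i \<longleftrightarrow> js = []" "last (i # js) \<noteq> j"
    by (auto dest: last_in_set split: if_splits)
  with Cons show ?case by (auto simp: transpose_def)
qed simp

lemma cyc_nth: "distinct (i # js) \<Longrightarrow> t < length js \<Longrightarrow> cyc i js ((i # js) ! Suc t) = (i # js) ! t"
proof (induction js arbitrary: t)
  case (Cons j js)
  show ?case
  proof (cases t)
    case 0
    have "cyc i js j = j" using Cons.prems by (intro cyc_outside) auto
    then show ?thesis using 0 by simp
  next
    case (Suc s)
    then have "cyc i js (js ! s) = (i # js) ! s" using Cons by auto
    moreover have "s < length js" using Cons.prems Suc by simp
    ultimately show ?thesis using Cons.prems Suc by (cases s) (auto simp: transpose_def)
  qed
qed simp

definition moved :: "('b \<Rightarrow> 'b) \<Rightarrow> 'b set" where "moved u = {y. u y \<noteq> y}"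

lemma moved_subset: "u permutes A \<Longrightarrow> moved u \<subseteq> A"
  by (auto simp: moved_def permutes_def)

text \<open>Multiplying by (j i), where j is the preimage of i, turns j into a fixed point, so fewer
  points move; j is then prepended to the cycle found by induction.\<close>

lemma cycle_decomposition:
  assumes "finite A" "u permutes A" "i \<in> A"
  shows "\<exists>js v. u = cyc i js \<circ> v \<and> distinct (i # js) \<and> set js \<subseteq> A \<and> v permutes A \<and> (\<forall>y\<in>set (i # js). v y = y)"
  using assms(2)
proof (induction "card (moved u)" arbitrary: u rule: less_induct)
  case less
  note u = less.prems
  show ?case
  proof (cases "u i = i")
    case True
    then show ?thesis using u by (intro exI[of _ "[]"] exI[of _ u]) auto
  next
    case False
    define j where "j = inv_into UNIV u i"
    have uj: "u j = i" unfolding j_def using u by (simp add: permutes_inverses)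
    have ij: "j \<noteq> i" using uj False by auto
    have j: "j \<in> A" using uj assms(3) permutes_in_image[OF u] by metis
    let ?u = "transpose j i \<circ> u"
    have u': "?u permutes A" using u j assms(3) by (intro permutes_compose permutes_swap_id)
    have sub: "moved ?u \<subseteq> moved u - {j}"
    proof
      fix y assume y: "y \<in> moved ?u"
      have "y \<noteq> j" using y uj by (auto simp: moved_def)
      moreover have "u y \<noteq> y"
      proof
        assume uy: "u y = y"
        then have "y \<noteq> i" using False by auto
        then show False using y uy \<open>y \<noteq> j\<close> by (auto simp: moved_def)
      qed
      ultimately show "y \<in> moved u - {j}" by (simp add: moved_def)
    qed
    have "finite (moved u)" using moved_subset[OF u] assms(1) finite_subset by blast
    moreover have "j \<in> moved u" using uj ij by (auto simp: moved_def)
    ultimately have "card (moved ?u) < card (moved u)"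
      using sub by (intro psubset_card_mono) auto
    then obtain js v where v: "?u = cyc i js \<circ> v" "distinct (i # js)" "set js \<subseteq> A" "v permutes A"
      "\<forall>y\<in>set (i # js). v y = y" using less.hyps[OF _ u'] by blast
    \<comment> \<open>Since \<open>?u\<close> fixes j, the cycle through i found by induction cannot
      contain j, and v fixes j as well.\<close>
    have fixj: "cyc i js (v j) = j" using fun_cong[OF v(1), of j] uj by simp
    have "j \<notin> set js"
    proof
      assume "j \<in> set js"
      then obtain t where t: "t < length js" "j = (i # js) ! Suc t" by (auto simp: in_set_conv_nth)
      then have "cyc i js j = (i # js) ! t" using cyc_nth[OF v(2)] by simp
      moreover have "v j = j" using v(5) \<open>j \<in> set js\<close> by simp
      ultimately have "(i # js) ! t = (i # js) ! Suc t" using fixj t by simp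
      then show False using v(2) t nth_eq_iff_index_eq[of "i # js" t "Suc t"] by simp
    qed
    moreover have "v j = j"
    proof (cases "v j \<in> set (i # js)")
      case True
      then have "v (v j) = v j" using v(5) by blast
      then show ?thesis using permutes_inj[OF v(4)] by (simp add: inj_eq)
    next
      case False
      then show ?thesis using fixj cyc_outside[of "v j" i js] by simp
    qed
    moreover have "u = cyc i (j # js) \<circ> v"
    proof -
      have "transpose j i \<circ> ?u = u" by (simp add: fun_eq_iff)
      then show ?thesis using v(1) by (simp add: o_assoc[symmetric])
    qed
    ultimately show ?thesis using v ij j by (intro exI[of _ "j # js"] exI[of _ v]) auto
  qed
qed

text \<open>Supplies the permutation that conjugates one cycle into another of the same
  length.\<close>

lemma permutes_extending_list:
  assumes "distinct xs" "distinct ys" "length xs = length ys" "set xs \<subseteq> A" "set ys \<subseteq> A"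
  shows "\<exists>g. g permutes A \<and> map g xs = ys"
  using assms(3,1,2,4,5)
proof (induction xs ys rule: list_induct2)
  case Nil
  then show ?case using permutes_id[of A] by (intro exI[of _ id]) (simp add: id_def)
next
  case (Cons y xs z ys)
  then obtain g where g: "g permutes A" "map g xs = ys" by auto
  let ?t = "transpose (g y) z"
  have "g y \<notin> set ys" using g Cons permutes_inj[OF g(1)] by (auto simp: inj_eq dest: arg_cong[of _ _ set])
  then have "map (?t \<circ> g) xs = ys"
    using g Cons.prems permutes_inj[OF g(1)] by (auto simp: transpose_def inj_eq)
  moreover have "?t \<circ> g permutes A"
    using g Cons.prems permutes_in_image[OF g(1)] by (intro permutes_compose permutes_swap_id) auto
  ultimately show ?case by (intro exI[of _ "?t \<circ> g"]) (simp add: comp_def)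
qed

section \<open>The even center of the Sergeev algebra\<close>

context hc_univ
begin

section \<open>The image of the center under the projection\<close>

definition Zc :: "'a \<Rightarrow> bool" where
  "Zc z \<longleftrightarrow> (\<exists>m. Fl False m z) \<and> (\<forall>p m h. Fl p m h \<longrightarrow> z * h = h * z)"

definition P :: "'a set" where "P = \<phi> ` {z. Zc z}"

abbreviation A :: "'a \<Rightarrow> 'a" where "A \<equiv> Av False"

lemma Zc_S: "Zc (S a)"
  unfolding Zc_def using Fl_S Fl_central by blast

lemma Zc_add: "Zc y \<Longrightarrow> Zc z \<Longrightarrow> Zc (y + z)"
proof -
  assume y: "Zc y" and z: "Zc z"
  then obtain l m where "Fl False l y" "Fl False m z" unfolding Zc_def by blast
  then have "Fl False (max l m) (y + z)" by (intro Fl_add) (auto intro: Fl_mono)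
  then show ?thesis using y z unfolding Zc_def by (auto simp: distrib_left distrib_right)
qed

lemma Zc_mult: "Zc y \<Longrightarrow> Zc z \<Longrightarrow> Zc (y * z)"
proof -
  assume y: "Zc y" and z: "Zc z"
  then obtain l m where "Fl False l y" "Fl False m z" unfolding Zc_def by blast
  then have "Fl False (l + m) (y * z)" using Fl_mult[of False l y False m z] by simp
  moreover have "y * z * h = h * (y * z)" if "Fl p q h" for p q h
  proof -
    have "y * z * h = y * (h * z)" using z that by (auto simp: Zc_def mult.assoc)
    also have "\<dots> = h * y * z" using y that by (auto simp: Zc_def simp flip: mult.assoc)
    finally show ?thesis by (simp add: mult.assoc)
  qed
  ultimately show ?thesis unfolding Zc_def by blast
qed

lemma P_S: "S a \<in> P"
  unfolding P_def using Zc_S phi_S by (intro image_eqI[of _ _ "S a"]) auto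

lemma P_add: "g \<in> P \<Longrightarrow> h \<in> P \<Longrightarrow> g + h \<in> P"
proof -
  assume "g \<in> P" "h \<in> P"
  then obtain y z where z: "g = \<phi> y" "h = \<phi> z" "Zc y" "Zc z" unfolding P_def by blast
  then obtain l m where "Fl False l y" "Fl False m z" unfolding Zc_def by blast
  then show ?thesis using z Zc_add[of y z] phi_add unfolding P_def by (intro image_eqI[of _ _ "y + z"]) auto
qed

lemma P_mult: "g \<in> P \<Longrightarrow> h \<in> P \<Longrightarrow> g * h \<in> P"
proof -
  assume "g \<in> P" "h \<in> P"
  then obtain y z where z: "g = \<phi> y" "h = \<phi> z" "Zc y" "Zc z" unfolding P_def by blast
  then obtain l m where "Fl False l y" "Fl False m z" unfolding Zc_def by blast
  then show ?thesis using z Zc_mult[of y z] phi_mult unfolding P_def by (intro image_eqI[of _ _ "y * z"]) auto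
qed

lemma P_0: "0 \<in> P" using P_S[of 0] by simp

lemma P_sum: "(\<And>i. i \<in> B \<Longrightarrow> f i \<in> P) \<Longrightarrow> sum f B \<in> P"
  by (induction B rule: infinite_finite_induct) (auto intro: P_0 P_add)

lemma P_psum: "\<phi> (psum a) \<in> P"
  unfolding P_def using Fl_psum psum_central by (intro imageI) (auto simp: Zc_def scomm_def sgn_mult_def)

lemma sginv_phi: assumes "Zc z" shows "sginv False (\<phi> z)"
proof -
  obtain m where z: "Fl False m z" using assms unfolding Zc_def by blast
  have "\<phi> z * h = h * \<phi> z" if h: "Fl p 0 h" for p h
  proof -
    have "\<phi> (z * h) = \<phi> z * h" "\<phi> (h * z) = h * \<phi> z"
      using phi_mult[OF z h] phi_mult[OF h z] phi_Sg[OF h] by auto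
    then show ?thesis using assms h unfolding Zc_def by metis
  qed
  then show ?thesis using Fl_c1[of _ 0] Fl_w1[of _ 0]
    by (auto simp: sginv_def scomm_def sgn_mult_def) metis+
qed

subsection \<open>Averages of Clifford multiples of permutations\<close>

text \<open>Cyclicity moves c_i to the end, and passing \<open>w u\<close> makes it c_(u i).
  Repetition transports a Clifford generator along its orbit under u.\<close>

lemma A_trace: assumes "i \<in> I" "u permutes I" "Fl q 0 y"
  shows "A (c i * (y * w u)) = A (y * (c (u i) * w u))"
proof -
  have "Fl q 0 (y * w u)" using Fl_mult'[OF assms(3) Fl_w1[OF assms(2), of 0]] by auto
  then have "A (c i * (y * w u)) = A (y * w u * c i)" by (rule Av_trace_c[OF assms(1)])
  then show ?thesis using assms by (simp add: mult.assoc wc)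
qed

lemma A_conj: "u permutes I \<Longrightarrow> Fl q m h \<Longrightarrow> A (w u * h * w (pinv u)) = A h"
  by (rule Av_conj)

lemma self_neg_zero: assumes "Fl p m h" "h = - h" shows "h = 0"
proof -
  have "h + h = 0" using assms(2) by (simp add: eq_neg_iff_add_eq_0)
  then show ?thesis using half[OF assms(1)] by simp
qed

primrec cw :: "nat list \<Rightarrow> 'a" where
  "cw [] = E"
| "cw (j # js) = c j * cw js"

lemma Fl_cw: "set js \<subseteq> I \<Longrightarrow> Fl (odd (length js)) 0 (cw js)"
proof (induction js)
  case (Cons j js)
  then show ?case using Fl_c[of j "odd (length js)" 0 "cw js"] by simp
qed (simp add: Fl_S)

lemma cw_append: "set a \<subseteq> I \<Longrightarrow> set b \<subseteq> I \<Longrightarrow> cw (a @ b) = cw a * cw b"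
  by (induction a) (auto simp: mult.assoc Fl_one[OF Fl_cw])

lemma cw_c: "set js \<subseteq> I \<Longrightarrow> i \<in> I \<Longrightarrow> i \<notin> set js \<Longrightarrow> scomm (odd (length js)) (c i) (cw js)"
proof (induction js)
  case Nil
  then show ?case using scomm_S[OF Fl_c1[of i 0]] by simp
next
  case (Cons j js)
  then have "scomm True (c i) (c j)" by (intro cc) auto
  with Cons show ?case by (auto intro: scomm_mult)
qed

lemma cw_reduce: "set js \<subseteq> I \<Longrightarrow> i \<in> set js \<Longrightarrow>
  \<exists>a js'. cw js * c i = S a * cw js' \<and> Suc (length js') = length js \<and> set js' \<subseteq> I"
proof -
  assume js: "set js \<subseteq> I" "i \<in> set js"
  then obtain a b where ab: "js = a @ i # b" "i \<notin> set b" by (meson split_list_last)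
  then have m: "set a \<subseteq> I" "set b \<subseteq> I" "i \<in> I" using js by auto
  have "cw js * c i = cw a * (c i * (cw b * c i))" using m by (simp add: ab cw_append mult.assoc)
  also have "cw b * c i = sgn_mult (odd (length b)) (c i * cw b)"
    using scomm_sym[OF cw_c[OF m(2,3) ab(2)]] by (simp add: scomm_def)
  also have "c i * \<dots> = - sgn_mult (odd (length b)) (cw b)"
    using c_c_cancel[OF m(3) Fl_cw[OF m(2)]] by (auto simp: sgn_mult_def)
  also have "cw a * \<dots> = S (if odd (length b) then 1 else -1) * cw (a @ b)"
    using m Fl_one[OF Fl_mult[OF Fl_cw[OF m(1)] Fl_cw[OF m(2)]]] by (simp add: sgn_mult_def cw_append S_minus)
  finally show ?thesis using m ab by (intro exI[of _ "if odd (length b) then 1 else -1"] exI[of _ "a @ b"]) auto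
qed

lemma w_cw: "set js \<subseteq> I \<Longrightarrow> u permutes I \<Longrightarrow> w u * cw js = cw (map u js) * w u"
proof (induction js)
  case (Cons j js)
  have "w u * cw (j # js) = c (u j) * (w u * cw js)" using Cons.prems by (simp add: wc flip: mult.assoc)
  with Cons show ?case by (simp add: mult.assoc)
qed (simp add: one_w w_one)

text \<open>The first letter is transported along its orbit under u. If it meets another letter, c_q
  c_q = -1 shortens the word by two; otherwise the average equals its own negative.\<close>

lemma A_cw: "set js \<subseteq> I \<Longrightarrow> even (length js) \<Longrightarrow> u permutes I \<Longrightarrow> \<exists>a. A (cw js * w u) = S a * A (w u)"
proof (induction "length js" arbitrary: js rule: less_induct)
  case less
  show ?case
  proof (cases js)
    case Nil
    then show ?thesis using less by (intro exI[of _ 1]) (simp add: Fl_one[OF Fl_w1[of _ 0]] Fl_one[OF Fl_Av[OF Fl_w1[of _ 0]]])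
  next
    case (Cons j js')
    have m: "j \<in> I" "set js' \<subseteq> I" "odd (length js')" and u: "u permutes I" using less Cons by auto
    have y: "Fl True 0 (cw js')" using Fl_cw[OF m(2)] m(3) by simp
    have reduce: "\<exists>a. A (cw js' * (c q * w u)) = S a * A (w u)" if q: "q \<in> set js'" for q
    proof -
      obtain a js2 where js2: "cw js' * c q = S a * cw js2" "Suc (length js2) = length js'" "set js2 \<subseteq> I"
        using cw_reduce[OF m(2) q] by blast
      have "even (length js2)" using js2(2) m(3) by (metis even_Suc)
      then obtain b where b: "A (cw js2 * w u) = S b * A (w u)"
        using less.hyps[of js2] js2 Cons u by auto
      have "cw js' * (c q * w u) = S a * (cw js2 * w u)" by (simp add: js2(1) flip: mult.assoc)
      then show ?thesis using b by (intro exI[of _ "a * b"]) (simp add: Av_smult S_mult mult.assoc)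
    qed
    have anti: "cw js' * (c q * w u) = - (c q * (cw js' * w u))" if "q \<in> I" "q \<notin> set js'" for q
      using scommD(1)[of "cw js'" "c q"] scomm_sym[OF cw_c[OF m(2) that]] m(3) by (simp flip: mult.assoc)
    \<comment> \<open>t counts the moves left until the transported letter meets one of
      \<open>js'\<close>.\<close>
    have orbit: "q \<in> I \<Longrightarrow> (u ^^ t) q \<in> set js' \<Longrightarrow> q \<notin> set js' \<Longrightarrow> \<exists>a. A (c q * (cw js' * w u)) = S a * A (w u)" for t q
    proof (induction t arbitrary: q)
      case (Suc t)
      have uq: "u q \<in> I" using Suc.prems u by simp
      have eq: "A (c q * (cw js' * w u)) = A (cw js' * (c (u q) * w u))"
        by (rule A_trace[OF Suc.prems(1) u y])
      show ?case
      proof (cases "u q \<in> set js'")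
        case True
        then show ?thesis using reduce eq by simp
      next
        case False
        have "(u ^^ t) (u q) \<in> set js'" using Suc.prems by (simp add: funpow_swap1)
        then obtain a where "A (c (u q) * (cw js' * w u)) = S a * A (w u)" using Suc.IH uq False by blast
        then show ?thesis unfolding eq anti[OF uq False] by (intro exI[of _ "- a"]) (simp add: Av_minus S_minus)
      qed
    qed simp
    show ?thesis
    proof (cases "\<exists>t. (u ^^ t) j \<in> set js'")
      case True
      show ?thesis
      proof (cases "j \<in> set js'")
        case True
        obtain i b where ib: "js' = i @ j # b" "j \<notin> set i" using True by (meson split_list_first)
        then have mm: "set i \<subseteq> I" "set b \<subseteq> I" using m by auto
        have "c j * cw i = sgn_mult (odd (length i)) (cw i * c j)"
          using cw_c[OF mm(1) m(1) ib(2)] by (simp add: scomm_def)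
        then have "cw js = sgn_mult (odd (length i)) (cw i * (c j * (c j * cw b)))"
          using mm m by (simp add: Cons ib cw_append flip: mult.assoc) (simp add: sgn_mult_def mult.assoc)
        also have "\<dots> = sgn_mult (even (length i)) (cw (i @ b))"
          using c_c_cancel[OF m(1) Fl_cw[OF mm(2)]] mm by (simp add: sgn_mult_def cw_append)
        finally have eq: "cw js = sgn_mult (even (length i)) (cw (i @ b))" .
        have "even (length (i @ b))" using m(3) ib by simp
        then obtain d where d: "A (cw (i @ b) * w u) = S d * A (w u)"
          using less.hyps[of "i @ b"] Cons ib mm u by auto
        have "A (cw js * w u) = S (if even (length i) then - d else d) * A (w u)"
          using d by (simp add: eq sgn_mult_def Av_minus S_minus)
        then show ?thesis by blast
      next
        case False
        with True orbit[OF m(1)] show ?thesis by (auto simp: Cons mult.assoc)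
      qed
    next
      case False
      obtain bs v where v: "u = cyc j bs \<circ> v" "distinct (j # bs)" "set bs \<subseteq> I" "v permutes I"
        "\<forall>y\<in>set (j # bs). v y = y" using cycle_decomposition[OF _ u m(1)] by auto
      let ?g = "cyc j bs"
      have g: "?g permutes I" using cyc_permutes[OF m(1) v(3)] .
      have gj: "?g j = u j" using v by simp
      \<comment> \<open>Read from the end, the entries of the cycle are the iterates of u at j,
        because u moves each entry to its predecessor.\<close>
      have orb: "d \<le> length bs \<Longrightarrow> (j # bs) ! (length bs - d) = (u ^^ Suc d) j" for d
      proof (induction d)
        case 0
        then show ?case using v cyc_first[OF v(2)] by (simp add: last_conv_nth)
      next
        case (Suc d)
        let ?t = "length bs - Suc d"
        have "(j # bs) ! Suc ?t = (u ^^ Suc d) j" using Suc by (simp add: Suc_diff_Suc)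
        moreover have "u ((j # bs) ! Suc ?t) = (j # bs) ! ?t"
        proof -
          have "(j # bs) ! Suc ?t \<in> set (j # bs)" using Suc by (intro nth_mem) auto
          then have "v ((j # bs) ! Suc ?t) = (j # bs) ! Suc ?t" using v(5) by blast
          then show ?thesis using v(1) cyc_nth[OF v(2), of ?t] Suc.prems by simp
        qed
        ultimately show ?case by simp
      qed
      have disj: "y \<notin> set (j # bs)" if "y \<in> set js'" for y
      proof
        assume "y \<in> set (j # bs)"
        then obtain t where t: "t < Suc (length bs)" "y = (j # bs) ! t" by (metis in_set_conv_nth length_Cons)
        then have "y = (u ^^ Suc (length bs - t)) j" using orb[of "length bs - t"] by simp
        then show False using False that by blast
      qed
      have gjs: "map ?g js' = js'" using disj by (intro map_idI cyc_outside) auto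
      have comm: "?g \<circ> u = u \<circ> ?g"
      proof -
        have "v \<circ> ?g = ?g \<circ> v"
        proof
          fix y
          show "(v \<circ> ?g) y = (?g \<circ> v) y"
          proof (cases "y \<in> set (j # bs)")
            case True
            have "?g permutes set (j # bs)" by (intro cyc_permutes) auto
            then have "?g y \<in> set (j # bs)" using True permutes_in_image by metis
            then have "v (?g y) = ?g y" "v y = y" using v(5) True by blast+
            then show ?thesis by simp
          next
            case False
            have "v y \<notin> set (j # bs)"
            proof
              assume a: "v y \<in> set (j # bs)"
              then have "v (v y) = v y" using v(5) by blast
              then have "v y = y" using permutes_inj[OF v(4)] by (simp add: inj_eq)
              then show False using a False by simp
            qed
            then show ?thesis using False by (simp add: cyc_outside)
          qed
        qed
        then show ?thesis using v(1) by (metis o_assoc)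
      qed
      have "(u ^^ Suc 0) j \<notin> set js'" using False by blast
      then have uj: "u j \<in> I" "u j \<notin> set js'" using m u by simp_all
      \<comment> \<open>One transport past the odd word \<open>cw js'\<close> gives a minus sign.
        Conjugation by the cycle through j, which commutes with u and fixes the letters of
        \<open>js'\<close>, produces the same term with a plus sign.\<close>
      have "A (cw js * w u) = - A (c (u j) * (cw js' * w u))"
        using A_trace[OF m(1) u y] anti[OF uj] by (simp add: Cons mult.assoc Av_minus)
      moreover have "A (cw js * w u) = A (c (u j) * (cw js' * w u))"
      proof -
        have F: "Fl False 0 (cw js * w u)"
          using Fl_mult'[OF Fl_cw[OF less.prems(1)] Fl_w1[OF u, of 0]] less.prems by auto
        have "w ?g * (cw js * w u) * w (pinv ?g) = cw (map ?g js) * (w ?g * w u) * w (pinv ?g)"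
          using w_cw[OF less.prems(1) g] by (simp flip: mult.assoc)
        also have "w ?g * w u = w u * w ?g" using w_mult g u comm by simp
        also have "cw (map ?g js) * (w u * w ?g) * w (pinv ?g) = cw (map ?g js) * w u"
          using w_cancel_right(1)[OF g Fl_w1[OF u, of 0]] by (simp add: mult.assoc)
        finally show ?thesis using A_conj[OF g F] gjs gj by (simp add: Cons mult.assoc)
      qed
      ultimately have "A (cw js * w u) = - A (cw js * w u)" by simp
      moreover have "Fl False 0 (A (cw js * w u))"
        using Fl_Av[OF Fl_mult'[OF Fl_cw[OF less.prems(1)] Fl_w1[OF u, of 0]]] less.prems by auto
      ultimately have "A (cw js * w u) = 0" using self_neg_zero by blast
      then show ?thesis by (intro exI[of _ 0]) simp
    qed
  qed
qed

text \<open>\<open>ls\<close> collects the letters already split off the Clifford element, so that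
  the induction ends in a word covered by \<open>A_cw\<close>.\<close>

lemma A_Cl: assumes "Cl p f" "u permutes I"
  shows "set ls \<subseteq> I \<Longrightarrow> odd (length ls) = p \<Longrightarrow> \<exists>a. A (cw ls * (f * w u)) = S a * A (w u)"
  using assms(1)
proof (induction arbitrary: ls rule: Cl.induct)
  case (Cl_S b)
  then obtain a where a: "A (cw ls * w u) = S a * A (w u)" using A_cw[OF _ _ assms(2), of ls] by auto
  have "cw ls * (S b * w u) = S b * (cw ls * w u)"
    using Fl_central[OF Fl_cw[OF Cl_S(1)], of b] by (simp flip: mult.assoc)
  then show ?case using a by (intro exI[of _ "b * a"]) (simp add: Av_smult S_mult mult.assoc)
next
  case (Cl_0 p)
  then show ?case by (intro exI[of _ 0]) (simp add: Av_0)
next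
  case (Cl_add p g h)
  then obtain a b where "A (cw ls * (g * w u)) = S a * A (w u)" "A (cw ls * (h * w u)) = S b * A (w u)" by meson
  then show ?case by (intro exI[of _ "a + b"]) (simp add: distrib_left distrib_right Av_add S_add)
next
  case (Cl_c i p h)
  have "set (ls @ [i]) \<subseteq> I" "odd (length (ls @ [i])) = p" using Cl_c by auto
  then obtain a where "A (cw (ls @ [i]) * (h * w u)) = S a * A (w u)" using Cl_c.IH by blast
  moreover have "cw (ls @ [i]) = cw ls * c i" using Cl_c by (simp add: cw_append c_one)
  ultimately show ?case by (auto simp: mult.assoc)
qed

lemma A_even_Cl: "Cl False f \<Longrightarrow> u permutes I \<Longrightarrow> \<exists>a. A (f * w u) = S a * A (w u)"
  using A_Cl[of False f u "[]"] Fl_one[OF Fl_mult[OF Cl_Fl[of False f 0] Fl_w1[of u 0]]] by simp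

subsection \<open>Even cycles\<close>

lemma cyc_step:
  assumes "u = cyc i js \<circ> v" "distinct (i # js)" "\<forall>y\<in>set (i # js). v y = y" "t < length js"
  shows "u ((i # js) ! Suc t) = (i # js) ! t"
proof -
  have "(i # js) ! Suc t \<in> set (i # js)" using assms(4) by (intro nth_mem) simp
  then have "v ((i # js) ! Suc t) = (i # js) ! Suc t" using assms(3) by blast
  then show ?thesis using assms(1) cyc_nth[OF assms(2,4)] by simp
qed

text \<open>Insert c_i c_i = -1 and transport one factor once around the cycle. Each passage past
  the other factor changes the sign; a cycle of even length has an odd number of such
  passages.\<close>

lemma A_even_cycle:
  assumes u: "u permutes I" "u = cyc i js \<circ> v" "distinct (i # js)" "set (i # js) \<subseteq> I"
    "\<forall>y\<in>set (i # js). v y = y" "odd (length js)"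
  shows "A (w u) = 0"
proof -
  let ?b = "\<lambda>t. (i # js) ! t"
  have bI: "?b t \<in> I" if "t \<le> length js" for t using u(4) that nth_mem[of t "i # js"] by auto
  have i: "i \<in> I" using u(4) by simp
  have FlA: "Fl False 0 (A (w u))" by (intro Fl_Av Fl_w1 u)
  have step: "A (c (?b t) * (c i * w u)) = A (c i * (c (u (?b t)) * w u))" if "t \<le> length js" for t
    using A_trace[OF bI[OF that] u(1) Fl_c1[OF i, of 0]] .
  have cii: "A (c i * (c i * w u)) = - A (w u)"
    using c_c_cancel[OF i Fl_w1[OF u(1), of 0]] by (simp add: Av_minus)
  have "t < length js \<Longrightarrow> A (c (?b (Suc t)) * (c i * w u)) = (if even t then - A (w u) else A (w u))" for t
  proof (induction t)
    case 0
    then show ?case using step[of "Suc 0"] cyc_step[OF u(2,3,5), of 0] cii by (simp add: Suc_le_eq)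
  next
    case (Suc t)
    have ne: "?b (Suc t) \<noteq> i" using u(3) Suc.prems by (auto simp: nth_mem)
    have "c i * c (?b (Suc t)) = - (c (?b (Suc t)) * c i)"
      using cc[OF i bI[of "Suc t"]] ne Suc.prems by (intro scommD) auto
    then have "c i * (c (?b (Suc t)) * w u) = - (c (?b (Suc t)) * (c i * w u))" by (simp flip: mult.assoc)
    then show ?case using Suc step[of "Suc (Suc t)"] cyc_step[OF u(2,3,5), of "Suc t"] by (simp add: Av_minus)
  qed
  moreover have len: "length js = Suc (length js - 1)" using u(6) by (cases js) auto
  moreover have "even (length js - 1)" using u(6) by simp
  ultimately have last: "A (c (?b (length js)) * (c i * w u)) = - A (w u)" by (metis lessI)
  have "u i = ?b (length js)" using u(2,3,5) cyc_first[OF u(3)] by (simp add: last_conv_nth)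
  then have "- A (w u) = A (c i * (c (?b (length js)) * w u))" using step[of 0] cii by simp
  also have "c i * (c (?b (length js)) * w u) = - (c (?b (length js)) * (c i * w u))"
  proof -
    have "?b (length js) \<noteq> i" using u(3) len by (metis distinct.simps(2) lessI nth_Cons_Suc nth_mem)
    then have "c i * c (?b (length js)) = - (c (?b (length js)) * c i)"
      using cc[OF i bI[of "length js"]] by (intro scommD) auto
    then show ?thesis by (simp flip: mult.assoc)
  qed
  finally have "A (w u) = - A (w u)" using last by (simp add: Av_minus)
  then show ?thesis using self_neg_zero[OF FlA] by blast
qed

subsection \<open>Leading terms of the power sums\<close>

primrec Tl :: "nat \<Rightarrow> nat list \<Rightarrow> 'a" where
  "Tl i [] = E"
| "Tl i (j # js) = T j i * Tl i js"

text \<open>Clifford factor of \<open>Tl\<close> once all transpositions stand on the right: moving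
  (j i) there replaces c_i by c_j in the later factors, so that consecutive letters become
  paired.\<close>

primrec Fc :: "nat \<Rightarrow> nat list \<Rightarrow> 'a" where
  "Fc q [] = E"
| "Fc q (j # js) = (E - c j * c q) * Fc j js"

lemma Cl_pair: "i \<in> I \<Longrightarrow> j \<in> I \<Longrightarrow> Cl False (E - c j * c i)"
  by (intro Cl_diff Cl_S Cl_mult'[OF Cl_c1 Cl_c1]) auto

lemma Cl_Fc: "set (q # js) \<subseteq> I \<Longrightarrow> Cl False (Fc q js)"
  by (induction js arbitrary: q) (auto intro!: Cl_S Cl_mult'[OF Cl_pair])

lemma w_Cl: "Cl p b \<Longrightarrow> u permutes I \<Longrightarrow> \<exists>b'. Cl p b' \<and> w u * b = b' * w u"
proof (induction rule: Cl.induct)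
  case (Cl_S a)
  then show ?case using S_w by (auto intro: Cl.Cl_S)
next
  case (Cl_0 p)
  then show ?case by (intro exI[of _ 0]) (auto intro: Cl.Cl_0)
next
  case (Cl_add p g h)
  then obtain g' h' where "Cl p g'" "w u * g = g' * w u" "Cl p h'" "w u * h = h' * w u" by blast
  then show ?case by (intro exI[of _ "g' + h'"]) (auto simp: distrib_left distrib_right intro: Cl.Cl_add)
next
  case (Cl_c i p h)
  then obtain h' where h': "Cl p h'" "w u * h = h' * w u" by blast
  have "w u * (c i * h) = c (u i) * (w u * h)" using Cl_c by (simp add: wc flip: mult.assoc)
  also have "\<dots> = c (u i) * h' * w u" by (simp add: h' mult.assoc)
  finally show ?case using Cl.Cl_c[OF _ h'(1), of "u i"] Cl_c by auto
qed

text \<open>Covers lists with repeated letters too. Evenness of the Clifford factor is all that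
  \<open>A_even_Cl\<close> asks for.\<close>

lemma Tl_Cl: "i \<in> I \<Longrightarrow> set js \<subseteq> I \<Longrightarrow> \<exists>f. Cl False f \<and> Tl i js = f * w (cyc i js)"
proof (induction js)
  case Nil
  then show ?case by (intro exI[of _ E]) (auto simp: w_id w_id[unfolded id_def] Cl_S simp flip: S_mult)
next
  case (Cons j js)
  then obtain f where f: "Cl False f" "Tl i js = f * w (cyc i js)" by auto
  let ?s = "transpose j i"
  have s: "?s permutes I" using Cons by simp
  obtain f' where f': "Cl False f'" "w ?s * f = f' * w ?s" using w_Cl[OF f(1) s] by blast
  have "Tl i (j # js) = (E - c j * c i) * (w ?s * f) * w (cyc i js)"
    by (simp add: T_def f(2) mult.assoc)
  also have "\<dots> = (E - c j * c i) * f' * (w ?s * w (cyc i js))" by (simp add: f'(2) mult.assoc)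
  also have "w ?s * w (cyc i js) = w (cyc i (j # js))"
    using Cons s cyc_permutes[of i I js] by (simp add: w_mult)
  finally have "Tl i (j # js) = (E - c j * c i) * f' * w (cyc i (j # js))" .
  moreover have "Cl False ((E - c j * c i) * f')" using Cons by (intro Cl_mult'[OF Cl_pair f'(1)]) auto
  ultimately show ?case by blast
qed

lemma w_Fc: "set (q # js) \<subseteq> I \<Longrightarrow> u permutes I \<Longrightarrow> w u * Fc q js = Fc (u q) (map u js) * w u"
proof (induction js arbitrary: q)
  case (Cons j js)
  have "w u * (c j * c q) = c (u j) * c (u q) * w u"
    using Cons.prems by (simp flip: mult.assoc add: wc) (simp add: mult.assoc wc)
  then have "w u * Fc q (j # js) = (E - c (u j) * c (u q)) * (w u * Fc j js)"
    using Cons.prems by (simp add: right_diff_distrib left_diff_distrib one_w w_one flip: mult.assoc)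
  then show ?case using Cons by (simp add: mult.assoc)
qed (simp add: one_w w_one)

lemma Tl_Fc: "distinct (i # js) \<Longrightarrow> set (i # js) \<subseteq> I \<Longrightarrow> Tl i js = Fc i js * w (cyc i js)"
proof (induction js)
  case Nil
  then show ?case by (simp add: w_id w_id[unfolded id_def] flip: S_mult)
next
  case (Cons j js)
  let ?s = "transpose j i"
  have s: "?s permutes I" using Cons by simp
  have "map ?s js = js" using Cons.prems by (intro map_idI) (auto simp: transpose_def)
  then have "w ?s * Fc i js = Fc j js * w ?s" using w_Fc[of i js ?s] Cons.prems s by simp
  then have "Tl i (j # js) = (E - c j * c i) * Fc j js * (w ?s * w (cyc i js))"
    using Cons by (simp add: T_def mult.assoc) (simp flip: mult.assoc)
  also have "w ?s * w (cyc i js) = w (cyc i (j # js))"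
    using Cons s cyc_permutes[of i I js] by (simp add: w_mult)
  finally show ?case by (simp add: comp_def)
qed

lemma Fc_snoc: "set (q # js) \<subseteq> I \<Longrightarrow> j \<in> I \<Longrightarrow> Fc q (js @ [j]) = Fc q js * (E - c j * c (last (q # js)))"
proof (induction js arbitrary: q)
  case Nil
  then show ?case using Fl_one[OF Cl_Fl[OF Cl_pair[of q j]]] Fl_one'[OF Cl_Fl[OF Cl_pair[of q j]]] by simp
next
  case (Cons a js)
  then show ?case by (simp add: mult.assoc)
qed

lemma Fc_c: "set (q # js) \<subseteq> I \<Longrightarrow> j \<in> I \<Longrightarrow> j \<notin> set (q # js) \<Longrightarrow> scomm False (c j) (Fc q js)"
proof (induction js arbitrary: q)
  case Nil
  then show ?case using scomm_S[OF Fl_c1[of j 0]] by simp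
next
  case (Cons a js)
  have "scomm False (c j) (c a * c q)"
    using Cons.prems by (intro scomm_mult[of True _ _ True] cc) auto
  then have "scomm False (c j) (E - c a * c q)"
    using Cons.prems by (intro scomm_diff scomm_S[OF Fl_c1[of j 0]]) auto
  then show ?case using Cons by (auto intro: scomm_mult)
qed

text \<open>Every factor contributes 2. For the last one, cyclicity turns c_j c_l into c_l c_l = -1,
  since u sends j to the letter l before it.\<close>

lemma A_Fc: "distinct (q # js) \<Longrightarrow> set (q # js) \<subseteq> I \<Longrightarrow> u permutes I \<Longrightarrow>
  (\<And>t. t < length js \<Longrightarrow> u ((q # js) ! Suc t) = (q # js) ! t) \<Longrightarrow>
  A (Fc q js * w u) = S (2 ^ length js) * A (w u)"
proof (induction js rule: rev_induct)
  case Nil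
  then show ?case using Fl_one[OF Fl_w1[of u 0]] Fl_one[OF Fl_Av[OF Fl_w1[of u 0]]] by simp
next
  case (snoc j js)
  let ?l = "last (q # js)"
  have mem: "set (q # js) \<subseteq> I" "j \<in> I" "j \<notin> set (q # js)" "?l \<in> I"
    using snoc.prems(1,2) by (auto simp: last_in_set)
  have "u ((q # js) ! Suc t) = (q # js) ! t" if "t < length js" for t
    using snoc.prems(4)[of t] that by (auto simp: nth_append nth_Cons' split: if_splits)
  then have IH: "A (Fc q js * w u) = S (2 ^ length js) * A (w u)"
    using snoc.prems by (intro snoc.IH) auto
  have uj: "u j = ?l" using snoc.prems(4)[of "length js"] by (auto simp: nth_append last_conv_nth nth_Cons')
  have Ff: "Fl False 0 (Fc q js)" by (rule Cl_Fl[OF Cl_Fc[OF mem(1)]])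
  have y: "Fl True 0 (Fc q js * c ?l)"
    by (rule Fl_mult'[OF Ff Fl_c1[OF mem(4), of 0]]) auto
  have comm: "Fc q js * c j = c j * Fc q js" by (rule scommD(2)[OF scomm_sym[OF Fc_c[OF mem(1,2,3)]]])
  have "A (Fc q js * (c j * c ?l) * w u) = A (c j * (Fc q js * c ?l * w u))"
    using comm by (simp flip: mult.assoc)
  also have "\<dots> = A (Fc q js * c ?l * (c (u j) * w u))"
    by (rule A_trace[OF mem(2) snoc.prems(3) y])
  also have "Fc q js * c ?l * (c (u j) * w u) = Fc q js * (c ?l * (c ?l * w u))" by (simp add: uj mult.assoc)
  also have "\<dots> = - (Fc q js * w u)"
    using c_c_cancel[OF mem(4) Fl_w1[OF snoc.prems(3), of 0]] by simp
  finally have "A (Fc q js * (c j * c ?l) * w u) = - A (Fc q js * w u)" by (simp add: Av_minus)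
  moreover have "Fc q (js @ [j]) * w u = Fc q js * w u - Fc q js * (c j * c ?l) * w u"
    unfolding Fc_snoc[OF mem(1,2)] using Fl_one'[OF Ff] by (simp add: right_diff_distrib left_diff_distrib)
  ultimately have "A (Fc q (js @ [j]) * w u) = A (Fc q js * w u) + A (Fc q js * w u)" by (simp add: Av_diff)
  also have "\<dots> = S 2 * A (Fc q js * w u)"
    using S_add[of 1 1] Fl_one[OF Fl_Av[OF Fl_mult[OF Ff Fl_w1[OF snoc.prems(3), of 0]]]] by (simp add: distrib_right)
  finally show ?case by (simp add: IH S_mult mult.assoc)
qed

lemma A_Tl:
  assumes "distinct (i # js)" "set (i # js) \<subseteq> I" "v permutes I" "\<forall>y\<in>set (i # js). v y = y"
  shows "A (Tl i js * w v) = S (2 ^ length js) * A (w (cyc i js \<circ> v))"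
proof -
  have c: "cyc i js permutes I" using assms by (intro cyc_permutes) auto
  have "Tl i js * w v = Fc i js * w (cyc i js \<circ> v)"
    using Tl_Fc[OF assms(1,2)] w_mult[OF c assms(3)] by (simp add: mult.assoc)
  then show ?thesis
    using A_Fc[OF assms(1,2) permutes_compose[OF assms(3) c]] cyc_step[OF refl assms(1,4)] by simp
qed

lemma w_Tl: "set (i # js) \<subseteq> I \<Longrightarrow> u permutes I \<Longrightarrow> w u * Tl i js = Tl (u i) (map u js) * w u"
proof (induction js)
  case (Cons j js)
  have "w u * Tl i (j # js) = T (u j) (u i) * (w u * Tl i js)"
    using Cons.prems by (simp add: w_T flip: mult.assoc)
  then show ?case using Cons by (simp add: mult.assoc)
qed (simp add: one_w w_one)

lemma Fl_Tl: "set (i # js) \<subseteq> I \<Longrightarrow> Fl False 0 (Tl i js)"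
  by (induction js) (auto intro: Fl_S Fl_mult'[OF Fl_T[of _ _ 0]])

text \<open>Conjugation by a permutation of the fixed points of v that carries one list to the
  other; it commutes with v.\<close>

lemma A_Tl_cong:
  assumes "distinct (i # js)" "set (i # js) \<subseteq> I" "\<forall>y\<in>set (i # js). v y = y"
    and "distinct (l # ls)" "set (l # ls) \<subseteq> I" "\<forall>y\<in>set (l # ls). v y = y"
    and "length ls = length js" "v permutes I"
  shows "A (Tl l ls * w v) = A (Tl i js * w v)"
proof -
  let ?B = "{y \<in> I. v y = y}"
  have len: "length (i # js) = length (l # ls)" using assms(7) by simp
  have sB: "set (i # js) \<subseteq> ?B" "set (l # ls) \<subseteq> ?B" using assms by blast+
  obtain g where "g permutes ?B \<and> map g (i # js) = l # ls"
    using permutes_extending_list[OF assms(1,4) len sB] ..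
  then have g: "g permutes ?B" "map g (i # js) = l # ls" by (simp_all only: simp_thms)
  have gI: "g permutes I" using g(1) by (rule permutes_subset) auto
  have comm: "g \<circ> v = v \<circ> g"
  proof
    fix y
    show "(g \<circ> v) y = (v \<circ> g) y"
    proof (cases "y \<in> ?B")
      case True
      then have "g y \<in> ?B" using permutes_in_image[OF g(1)] by blast
      with True show ?thesis by simp
    next
      case False
      have "v y \<notin> ?B"
      proof
        assume "v y \<in> ?B"
        then have "v y = y" using permutes_inj[OF assms(8)] by (simp add: inj_eq)
        with False \<open>v y \<in> ?B\<close> show False by simp
      qed
      with False show ?thesis using g(1) by (simp add: permutes_not_in)
    qed
  qed
  have "w g * (Tl i js * w v) * w (pinv g) = Tl (g i) (map g js) * (w g * w v) * w (pinv g)"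
    using w_Tl[OF assms(2) gI] by (simp flip: mult.assoc)
  also have "w g * w v = w v * w g" using w_mult gI assms(8) comm by simp
  also have "Tl (g i) (map g js) * (w v * w g) * w (pinv g) = Tl l ls * w v"
    using w_cancel_right(1)[OF gI Fl_w1[OF assms(8), of 0]] g(2) by (simp add: mult.assoc)
  finally show ?thesis
    using A_conj[OF gI Fl_mult[OF Fl_Tl[OF assms(2)] Fl_w1[OF assms(8), of 0]]] by simp
qed

section \<open>Expansion of the power sums and induction on the moved points\<close>

definition lists_below :: "nat \<Rightarrow> nat \<Rightarrow> nat list set" where
  "lists_below m l = {ls. set ls \<subseteq> {1..<l} \<and> length ls = m}"

lemma finite_lists_below: "finite (lists_below m l)"
  unfolding lists_below_def by (rule finite_lists_length_eq) simp

lemma M_power: "l \<in> I \<Longrightarrow> pw (M l) m = S (k ^ m) * (\<Sum>ls\<in>lists_below m l. Tl l ls)"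
proof (induction m)
  case 0
  have "lists_below 0 l = {[]}" by (auto simp: lists_below_def)
  then show ?case by (simp flip: S_mult)
next
  case (Suc m)
  have "(\<Sum>ls\<in>lists_below (Suc m) l. Tl l ls) = (\<Sum>(j, ls)\<in>{1..<l} \<times> lists_below m l. T j l * Tl l ls)"
    by (rule sum.reindex_bij_witness[of _ "\<lambda>(j, ls). j # ls" "\<lambda>ls. (hd ls, tl ls)"])
      (auto simp: lists_below_def length_Suc_conv)
  also have "\<dots> = (\<Sum>j\<in>{1..<l}. T j l) * (\<Sum>ls\<in>lists_below m l. Tl l ls)"
    by (simp add: sum_product sum.cartesian_product)
  finally have "(\<Sum>ls\<in>lists_below (Suc m) l. Tl l ls) = (\<Sum>j\<in>{1..<l}. T j l) * (\<Sum>ls\<in>lists_below m l. Tl l ls)" .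
  moreover have "(\<Sum>j\<in>{1..<l}. T j l) * S a = S a * (\<Sum>j\<in>{1..<l}. T j l)" for a
    using Fl_central[OF Fl_sum[of "{1..<l}" False 0 "\<lambda>j. T j l"]] Fl_T[OF Suc.prems less_mem[OF Suc.prems]] by simp
  ultimately show ?case using Suc
    by (simp add: M_def S_mult mult.assoc) (simp flip: mult.assoc)
qed

lemma pw_sq: "Fl p m y \<Longrightarrow> pw (y * y) a = pw y (2 * a)"
  by (induction a) (auto simp: mult.assoc)

lemma phi_psum_expand: "\<phi> (psum a) = S (k ^ (2 * a)) * (\<Sum>(l, ls)\<in>Sigma I (lists_below (2 * a)). Tl l ls)"
  unfolding phi_psum
  by (simp add: pw_sq[OF Fl_M] M_power sum_distrib_left[symmetric] sum.Sigma finite_lists_below cong: sum.cong)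

text \<open>After u is split as a cycle times v, the average for v is multiplied by the image of a
  power sum. Up to a common power of k, the terms whose cycle is disjoint from v all give the same
  positive multiple of the wanted average, and the others move fewer points. Division by the total
  coefficient requires k to be nonzero.\<close>

lemma A_perm_in_P:
  assumes "k \<noteq> 0 \<or> n \<le> 2" "u permutes I"
  shows "A (w u) \<in> P"
  using assms(2)
proof (induction "card (moved u)" arbitrary: u rule: less_induct)
  case less
  note u = less.prems
  show ?case
  proof (cases "u = id")
    case True
    have "A E = E"
      by (rule Av_fix[OF Fl_S[of 0]]) (auto simp: sginv_def intro!: scomm_S[OF Fl_c1[of _ 0]] scomm_S[OF Fl_w1[of _ 0]])
    then show ?thesis using True P_S[of 1] by (simp add: w_id)
  next
    case False
    then obtain i where i: "u i \<noteq> i" by (auto simp: fun_eq_iff)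
    then have iI: "i \<in> I" using u by (auto simp: permutes_def)
    obtain js v where d: "u = cyc i js \<circ> v" "distinct (i # js)" "set js \<subseteq> I" "v permutes I"
      "\<forall>y\<in>set (i # js). v y = y" using cycle_decomposition[OF _ u iI] by auto
    have sub: "set (i # js) \<subseteq> I" using d(3) iI by simp
    show ?thesis
    proof (cases "odd (length js)")
      case True
      then show ?thesis using A_even_cycle[OF u d(1,2) sub d(5)] P_0 by simp
    next
      case even: False
      have js: "js \<noteq> []" using d i by auto
      obtain a where a: "length js = 2 * a" using even by (auto elim: evenE)
      have "card (set (i # js)) = Suc (length js)" using d(2) distinct_card[of "i # js"] by simp
      then have card_js: "card (set (i # js)) = 2 * a + 1" using a by simp
      have "length js \<noteq> 0" using js by simp
      \<comment> \<open>A nontrivial cycle of odd length has at least three letters. So n <= 2 is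
        impossible here, and k is nonzero.\<close>
      then have "3 \<le> 2 * a + 1" using a by presburger
      also have "\<dots> \<le> card I" using card_mono[OF _ sub] card_js by simp
      finally have k: "k \<noteq> 0" using assms(1) by auto
      have fin: "finite (moved f)" if "f permutes I" for f :: "nat \<Rightarrow> nat"
        using moved_subset[OF that] finite_subset by blast
      have "moved u = set (i # js) \<union> moved v"
      proof -
        have mv: "u y \<noteq> y" if y: "y \<in> set (i # js)" for y
        proof -
          obtain t where t: "t < length (i # js)" "y = (i # js) ! t" using y by (metis in_set_conv_nth)
          show ?thesis
          proof (cases t)
            case 0
            then show ?thesis using t i by simp
          next
            case (Suc s)
            then have "u y = (i # js) ! s" using cyc_step[OF d(1,2,5), of s] t by simp
            moreover have "(i # js) ! s \<noteq> (i # js) ! Suc s"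
              using d(2) t Suc nth_eq_iff_index_eq[of "i # js" s "Suc s"] by simp
            ultimately show ?thesis using t Suc by simp
          qed
        qed
        have uv: "u y = v y" if "y \<notin> set (i # js)" for y
        proof -
          have "v y \<notin> set (i # js)"
          proof
            assume m: "v y \<in> set (i # js)"
            then have "v (v y) = v y" using d(5) by blast
            then have "v y = y" using permutes_inj[OF d(4)] by (simp add: inj_eq)
            with m that show False by simp
          qed
          then show ?thesis using d(1) cyc_outside[of "v y" i js] by simp
        qed
        have "y \<in> moved u \<longleftrightarrow> y \<in> set (i # js) \<or> y \<in> moved v" for y
          using mv[of y] uv[of y] unfolding moved_def mem_Collect_eq by metis
        note mem = this
        show ?thesis
        proof (rule Set.set_eqI)
          show "y \<in> moved u \<longleftrightarrow> y \<in> set (i # js) \<union> moved v" for y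
            unfolding Un_iff by (rule mem)
        qed
      qed
      moreover have "set (i # js) \<inter> moved v = {}" using d(5) by (auto simp: moved_def)
      ultimately have card_u: "card (moved u) = 2 * a + 1 + card (moved v)"
        using card_Un_disjoint[OF _ fin[OF d(4)], of "set (i # js)"] card_js by simp
      have vP: "A (w v) \<in> P" using card_u by (intro less.hyps[OF _ d(4)]) simp
      let ?L = "Sigma I (lists_below (2 * a))"
      \<comment> \<open>Terms that give a genuine cycle, disjoint from the points moved by
        v.\<close>
      define good where "good p \<longleftrightarrow> distinct (fst p # snd p) \<and> (\<forall>y\<in>set (fst p # snd p). v y = y)"
        for p :: "nat \<times> nat list"
      have L: "set (l # ls) \<subseteq> I" "length ls = 2 * a" if "(l, ls) \<in> ?L" for l ls
        using that less_mem[of l] by (auto simp: lists_below_def)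
      have finL: "finite ?L" by (intro finite_SigmaI finite_lists_below) simp
      have is_good: "A (Tl l ls * w v) = S (2 ^ (2 * a)) * A (w u)" if "(l, ls) \<in> ?L" "good (l, ls)" for l ls
      proof -
        have "A (Tl l ls * w v) = A (Tl i js * w v)"
          using that L[OF that(1)] a by (intro A_Tl_cong d sub) (auto simp: good_def)
        then show ?thesis using A_Tl[OF d(2) sub d(4,5)] a d(1) by simp
      qed
      \<comment> \<open>A repeated letter, or one moved by v, leaves fewer than 2a + 1 + card (moved
        v) points that can move.\<close>
      have is_bad: "A (Tl l ls * w v) \<in> P" if l: "(l, ls) \<in> ?L" "\<not> good (l, ls)" for l ls
      proof -
        have lI: "l \<in> I" "set ls \<subseteq> I" using L(1)[OF l(1)] by auto
        have c: "cyc l ls permutes I" using lI by (rule cyc_permutes)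
        have cv: "cyc l ls \<circ> v permutes I" using permutes_compose[OF d(4) c] .
        obtain f where f: "Cl False f" "Tl l ls = f * w (cyc l ls)" using Tl_Cl[OF lI] by blast
        have eq: "Tl l ls * w v = f * w (cyc l ls \<circ> v)" using w_mult[OF c d(4)] f(2) by (simp add: mult.assoc)
        have msub: "moved (cyc l ls \<circ> v) \<subseteq> set (l # ls) \<union> moved v"
          using cyc_outside[of _ l ls] by (auto simp: moved_def)
        have "card (set (l # ls) \<union> moved v) < 2 * a + 1 + card (moved v)"
        proof (cases "distinct (l # ls)")
          case True
          then obtain y where y: "y \<in> set (l # ls) \<inter> moved v" using l(2) by (auto simp: good_def moved_def)
          have "card (set (l # ls) \<union> moved v) + card (set (l # ls) \<inter> moved v) = card (set (l # ls)) + card (moved v)"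
            using card_Un_Int[OF _ fin[OF d(4)], of "set (l # ls)"] by simp
          moreover have "card (set (l # ls) \<inter> moved v) > 0" using y card_gt_0_iff[of "set (l # ls) \<inter> moved v"] by auto
          moreover have "card (set (l # ls)) \<le> 2 * a + 1" using card_length[of "l # ls"] L(2)[OF l(1)] by simp
          ultimately show ?thesis by linarith
        next
          case False
          then have "card (set (l # ls)) \<noteq> length (l # ls)" using card_distinct by blast
          then have "card (set (l # ls)) < 2 * a + 1" using card_length[of "l # ls"] L(2)[OF l(1)] by simp
          then show ?thesis using card_Un_le[of "set (l # ls)" "moved v"] by linarith
        qed
        then have "card (moved (cyc l ls \<circ> v)) < card (moved u)"
          using card_mono[OF _ msub] fin[OF d(4)] card_u by simp
        then have "A (w (cyc l ls \<circ> v)) \<in> P" by (intro less.hyps cv)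
        moreover obtain b where "A (f * w (cyc l ls \<circ> v)) = S b * A (w (cyc l ls \<circ> v))"
          using A_even_Cl[OF f(1) cv] by blast
        ultimately show ?thesis unfolding eq by (simp add: P_mult P_S)
      qed
      \<comment> \<open>\<open>M l\<close> involves smaller indices only, so the largest letter of
        the cycle has to serve as base point.\<close>
      have "\<exists>p\<in>?L. good p"
      proof -
        let ?O = "set (i # js)"
        let ?l = "Max ?O" and ?ls = "sorted_list_of_set (set (i # js) - {Max (set (i # js))})"
        have fO: "finite ?O" "?O \<noteq> {}" by auto
        have lO: "?l \<in> ?O" using Max_in[OF fO] .
        have set_ls: "set ?ls = ?O - {?l}" by simp
        have len: "length ?ls = 2 * a" using card_js lO by (simp add: card_Diff_singleton del: set_simps)
        have "set ?ls \<subseteq> {1..<?l}"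
        proof
          fix y assume "y \<in> set ?ls"
          then have y: "y \<in> ?O" "y \<noteq> ?l" using set_ls by auto
          then have "y < ?l" using Max_ge[OF fO(1) y(1)] by linarith
          then show "y \<in> {1..<?l}" using y(1) sub by (auto simp: atLeastAtMost_iff)
        qed
        then have "(?l, ?ls) \<in> ?L" using lO sub len by (auto simp: lists_below_def)
        moreover have "good (?l, ?ls)"
          unfolding good_def fst_conv snd_conv using set_ls lO d(5) by auto
        ultimately show ?thesis by blast
      qed
      then have N: "card {p \<in> ?L. good p} \<noteq> 0" using finL by auto
      let ?N = "of_nat (card {p \<in> ?L. good p}) :: complex"
      have psi_inv: "sginv False (\<phi> (psum a))"
        using Fl_psum psum_central by (intro sginv_phi) (auto simp: Zc_def scomm_def sgn_mult_def)
      have "\<phi> (psum a) * A (w v) = A (\<phi> (psum a) * w v)"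
        using Av_mult[OF phi_Fl[OF Fl_psum] psi_inv] by simp
      also have "\<dots> = S (k ^ (2 * a)) * (\<Sum>(l, ls)\<in>?L. A (Tl l ls * w v))"
        by (simp add: phi_psum_expand mult.assoc sum_distrib_right Av_smult Av_sum case_prod_unfold)
      also have "(\<Sum>(l, ls)\<in>?L. A (Tl l ls * w v)) =
          (\<Sum>(l, ls)\<in>{p \<in> ?L. good p}. A (Tl l ls * w v)) + (\<Sum>(l, ls)\<in>{p \<in> ?L. \<not> good p}. A (Tl l ls * w v))"
        using finL by (subst sum.union_disjoint[symmetric]) (auto intro!: sum.cong)
      also have "(\<Sum>(l, ls)\<in>{p \<in> ?L. good p}. A (Tl l ls * w v)) = (\<Sum>p\<in>{p \<in> ?L. good p}. S (2 ^ (2 * a)) * A (w u))"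
        using is_good by (intro sum.cong refl) auto
      also have "\<dots> = S ?N * (S (2 ^ (2 * a)) * A (w u))"
      proof -
        have F: "Fl False 0 (S (2 ^ (2 * a)) * A (w u))" by (intro Fl_smult Fl_Av Fl_w1 u)
        have "finite B \<Longrightarrow> (\<Sum>p\<in>B. S (2 ^ (2 * a)) * A (w u)) = S (of_nat (card B)) * (S (2 ^ (2 * a)) * A (w u))"
          for B :: "(nat \<times> nat list) set"
          by (induction B rule: finite_induct) (auto simp: S_add distrib_right Fl_one[OF F])
        then show ?thesis using finL by simp
      qed
      finally have eq: "\<phi> (psum a) * A (w v) = S (k ^ (2 * a)) * (S ?N * (S (2 ^ (2 * a)) * A (w u)) +
          (\<Sum>(l, ls)\<in>{p \<in> ?L. \<not> good p}. A (Tl l ls * w v)))" .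
      \<comment> \<open>The power of k from the Jucys-Murphy elements, the number of good terms, and
        a 2 for each Clifford factor.\<close>
      let ?c = "k ^ (2 * a) * ?N * 2 ^ (2 * a)"
      let ?R = "S (k ^ (2 * a)) * (\<Sum>(l, ls)\<in>{p \<in> ?L. \<not> good p}. A (Tl l ls * w v))"
      have R: "?R \<in> P" using is_bad by (intro P_mult P_S P_sum) auto
      have "S ?c * A (w u) = \<phi> (psum a) * A (w v) + S (-1) * ?R"
        using Fl_one[OF Fl_sum] unfolding eq
        by (simp add: S_mult mult.assoc distrib_left S_minus) (simp flip: S_mult mult.assoc)
      then have "S ?c * A (w u) \<in> P" using P_add[OF P_mult[OF P_psum vP] P_mult[OF P_S R]] by simp
      then have mem: "S (1 / ?c) * (S ?c * A (w u)) \<in> P" by (rule P_mult[OF P_S])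
      have "1 / ?c * ?c = 1" using k N by simp
      then have "S (1 / ?c) * S ?c = E" by (simp only: S_mult[symmetric])
      then have "S (1 / ?c) * (S ?c * A (w u)) = A (w u)"
        using Fl_one[OF Fl_Av[OF Fl_w1[OF u, of 0]]] by (simp only: mult.assoc[symmetric])
      with mem show ?thesis by (simp only:)
    qed
  qed
qed

text \<open>An invariant is its own average. Averaged term by term, its normal form in degree 0
  becomes a combination of averages of permutations, once conjugation by \<open>w u\<close> has
  moved the coefficient to the left.\<close>

lemma sginv_in_P:
  assumes "k \<noteq> 0 \<or> n \<le> 2" "Fl False 0 y" "sginv False y"
  shows "y \<in> P"
proof -
  obtain b where b: "\<forall>u \<alpha>. Cl False (b u \<alpha>)" "y = NF 0 b"
    using normal_form[OF assms(2)] by (auto simp: Lt_def)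
  have "A (w u * (xp \<alpha> * b u \<alpha>)) \<in> P" if u: "u \<in> Perms" and "\<alpha> \<in> mi 0" for u \<alpha>
  proof -
    have u': "u permutes I" using u by simp
    have "\<alpha> = (\<lambda>_. 0)" using that(2) by (auto simp: mi_def fun_eq_iff)
    moreover have "count_list [] = (\<lambda>_ :: nat. 0)" by (rule ext) simp
    ultimately have "xp \<alpha> = E" using xw_xp[of "[]"] by simp
    then have "xp \<alpha> * b u \<alpha> = b u \<alpha>" using Fl_one[OF Cl_Fl[of False "b u \<alpha>" 0]] b(1) by simp
    moreover have F: "Fl False 0 (b u \<alpha> * w u)" by (rule Fl_mult'[OF Cl_Fl[of False _ 0] Fl_w1[OF u', of 0]]) (use b(1) in auto)
    have "w u * (b u \<alpha> * w u) * w (pinv u) = w u * b u \<alpha>"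
      using w_cancel_right(1)[OF u' Fl_mult[OF Fl_w1[OF u', of 0] Cl_Fl[of False "b u \<alpha>" 0]]] b(1)
      by (simp add: mult.assoc)
    ultimately have "A (w u * (xp \<alpha> * b u \<alpha>)) = A (b u \<alpha> * w u)" using A_conj[OF u' F] by simp
    moreover obtain d where "A (b u \<alpha> * w u) = S d * A (w u)" using A_even_Cl[OF _ u'] b(1) by blast
    ultimately show ?thesis using P_mult[OF P_S A_perm_in_P[OF assms(1) u']] by simp
  qed
  then have "A y \<in> P" unfolding b(2) NF_def Av_sum by (intro P_sum) auto
  then show ?thesis using Av_fix[OF assms(2,3)] by simp
qed

end

section \<open>The product of all the algebras\<close>

text \<open>
  All quotients live in one type, on which the ring laws are available as type class axioms.
  A single algebra embeds as a corner.
\<close>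

typedef hc_prod = "{F :: nat \<times> complex \<Rightarrow> hc_free set. \<forall>p. F p \<in> carrier (HCl (fst p) (snd p))}"
  by (intro exI[of _ "\<lambda>p. ring.zero (HCl (fst p) (snd p))"])
    (simp add: ring.ring_simprules[OF ring_HCl])

setup_lifting type_definition_hc_prod

instantiation hc_prod :: ring
begin

lift_definition zero_hc_prod :: hc_prod is "\<lambda>p. \<zero>\<^bsub>HCl (fst p) (snd p)\<^esub>"
  by (simp add: ring.ring_simprules[OF ring_HCl])

lift_definition plus_hc_prod :: "hc_prod \<Rightarrow> hc_prod \<Rightarrow> hc_prod" is
  "\<lambda>F G p. F p \<oplus>\<^bsub>HCl (fst p) (snd p)\<^esub> G p"
  by (simp add: ring.ring_simprules[OF ring_HCl])

lift_definition times_hc_prod :: "hc_prod \<Rightarrow> hc_prod \<Rightarrow> hc_prod" is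
  "\<lambda>F G p. F p \<otimes>\<^bsub>HCl (fst p) (snd p)\<^esub> G p"
  by (simp add: ring.ring_simprules[OF ring_HCl])

lift_definition uminus_hc_prod :: "hc_prod \<Rightarrow> hc_prod" is "\<lambda>F p. \<ominus>\<^bsub>HCl (fst p) (snd p)\<^esub> F p"
  by (simp add: ring.ring_simprules[OF ring_HCl])

lift_definition minus_hc_prod :: "hc_prod \<Rightarrow> hc_prod \<Rightarrow> hc_prod" is
  "\<lambda>F G p. F p \<ominus>\<^bsub>HCl (fst p) (snd p)\<^esub> G p"
  by (simp add: ring.ring_simprules[OF ring_HCl])

instance
proof
  fix a b d :: hc_prod
  show "a + b + d = a + (b + d)"
    by transfer (simp add: fun_eq_iff ring.ring_simprules(7)[OF ring_HCl])
  show "a + b = b + a"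
    by transfer (simp add: fun_eq_iff ring.ring_simprules(10)[OF ring_HCl])
  show "0 + a = a"
    by transfer (simp add: fun_eq_iff ring.ring_simprules[OF ring_HCl])
  show "- a + a = 0"
    by transfer (simp add: fun_eq_iff ring.ring_simprules[OF ring_HCl])
  show "a - b = a + - b"
    by transfer (simp add: fun_eq_iff a_minus_def)
  show "a * b * d = a * (b * d)"
    by transfer (simp add: fun_eq_iff ring.ring_simprules[OF ring_HCl])
  show "(a + b) * d = a * d + b * d"
    by transfer (simp add: fun_eq_iff ring.ring_simprules[OF ring_HCl])
  show "a * (b + d) = a * b + a * d"
    by transfer (simp add: fun_eq_iff ring.ring_simprules[OF ring_HCl])
qed

end

lift_definition emb :: "nat \<Rightarrow> complex \<Rightarrow> hc_free set \<Rightarrow> hc_prod" is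
  "\<lambda>n k h p. if p = (n, k) \<and> h \<in> carrier (HCl n k) then h else \<zero>\<^bsub>HCl (fst p) (snd p)\<^esub>"
  by (simp add: ring.ring_simprules[OF ring_HCl])

definition comp_at :: "nat \<Rightarrow> complex \<Rightarrow> hc_prod \<Rightarrow> hc_free set" where
  "comp_at n k F = Rep_hc_prod F (n, k)"

lemma comp_emb: "h \<in> carrier (HCl n k) \<Longrightarrow> comp_at n k (emb n k h) = h"
  by (simp add: comp_at_def emb.rep_eq)

lemma emb_ops:
  assumes "g \<in> carrier (HCl n k)" "h \<in> carrier (HCl n k)"
  shows "emb n k (g \<oplus>\<^bsub>HCl n k\<^esub> h) = emb n k g + emb n k h"
    "emb n k (g \<otimes>\<^bsub>HCl n k\<^esub> h) = emb n k g * emb n k h"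
    "emb n k (g \<ominus>\<^bsub>HCl n k\<^esub> h) = emb n k g - emb n k h"
    "emb n k (\<ominus>\<^bsub>HCl n k\<^esub> g) = - emb n k g"
    "emb n k \<zero>\<^bsub>HCl n k\<^esub> = 0"
  using assms by (transfer, auto simp: fun_eq_iff ring.ring_simprules[OF ring_HCl])+

lemma emb_inj: "g \<in> carrier (HCl n k) \<Longrightarrow> h \<in> carrier (HCl n k) \<Longrightarrow> emb n k g = emb n k h \<longleftrightarrow> g = h"
  by (metis comp_emb)

section \<open>The concrete algebra satisfies the abstract relations\<close>

definition J :: "nat \<Rightarrow> complex \<Rightarrow> hc_free \<Rightarrow> hc_prod" where "J n k f = emb n k (cls n k f)"

lemma cls_carrier: "f \<in> carrier (free_alg n) \<Longrightarrow> cls n k f \<in> carrier (HCl n k)"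
  by (simp add: HCl_cls)

lemma J_add: "f \<in> carrier (free_alg n) \<Longrightarrow> g \<in> carrier (free_alg n) \<Longrightarrow> J n k (f + g) = J n k f + J n k g"
  and J_mult: "f \<in> carrier (free_alg n) \<Longrightarrow> g \<in> carrier (free_alg n) \<Longrightarrow> J n k (f * g) = J n k f * J n k g"
  by (simp_all add: J_def cls_carrier emb_ops flip: cls_ops)

lemma J_eq_iff: "f \<in> carrier (free_alg n) \<Longrightarrow> g \<in> carrier (free_alg n) \<Longrightarrow>
  J n k f = J n k g \<longleftrightarrow> f - g \<in> hc_ideal n k"
  by (simp add: J_def emb_inj cls_carrier cls_eq)

lemma free_zero: "0 \<in> carrier (free_alg n)"
  by (simp add: free_alg_simps)

lemma J_0: "J n k 0 = 0"
  using J_add[OF free_zero free_zero, of n k] by simp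

lemma J_minus: "f \<in> carrier (free_alg n) \<Longrightarrow> J n k (- f) = - J n k f"
  using J_add[of f n "- f" k] free_uminus[of f n] by (simp add: J_0 eq_neg_iff_add_eq_0 add.commute)

lemma J_diff: "f \<in> carrier (free_alg n) \<Longrightarrow> g \<in> carrier (free_alg n) \<Longrightarrow> J n k (f - g) = J n k f - J n k g"
  using J_add[of f n "- g" k] free_uminus[of g n] by (simp add: J_minus)

lemma J_rel: "f - g \<in> hc_rels n k \<Longrightarrow> f \<in> carrier (free_alg n) \<Longrightarrow> g \<in> carrier (free_alg n) \<Longrightarrow> J n k f = J n k g"
  using ring.genideal_self[OF ring_free_alg hc_rels_carrier, of n k]
  by (auto simp: J_eq_iff hc_ideal_def[symmetric])

lemma scal_commute: "scal a * f = f * scal a"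
proof (induction f rule: poly_ind)
  case (2 u b f)
  then show ?case by (simp add: distrib_left distrib_right scal_def mult_single mult.commute)
qed simp

lemma scal_add: "scal (a + b) = scal a + scal b" and scal_mult: "scal (a * b) = scal a * scal b"
  and scal_1: "scal 1 = 1"
  by (simp_all add: scal_def single_add mult_single)

lemma gens_carrier: "i \<in> {1..n} \<Longrightarrow> xg i \<in> carrier (free_alg n)" "i \<in> {1..n} \<Longrightarrow> cg i \<in> carrier (free_alg n)"
  "u permutes {1..n} \<Longrightarrow> wg u \<in> carrier (free_alg n)"
  by (auto intro!: free_gen simp: gens_def)

lemmas free_closed = free_add free_mult free_uminus free_diff free_scal free_one gens_carrier free_zero

lemma hc_alg_J: "hc_alg n k (\<lambda>a. J n k (scal a)) (\<lambda>i. J n k (xg i)) (\<lambda>i. J n k (cg i)) (\<lambda>u. J n k (wg u))"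
proof -
  note cl = free_closed[where n = n]
  have sw: "transpose i (i + 1) permutes {1..n}" if "1 \<le> i" "i + 1 \<le> n" for i
    using that by (intro permutes_swap_id) (auto simp: atLeastAtMost_iff)
  have mem: "i \<in> {1..n}" "i + 1 \<in> {1..n}" if "1 \<le> i" "i + 1 \<le> n" for i
    using that by (auto simp: atLeastAtMost_iff)
  have one: "J n k (scal 1) * J n k f = J n k f" if "f \<in> carrier (free_alg n)" for f
    using J_mult[of "scal 1" n f k] that free_scal by (simp add: scal_1 free_one)
  have cen: "J n k (scal a) * J n k f = J n k f * J n k (scal a)" if "f \<in> carrier (free_alg n)" for a f
    using J_mult[of "scal a" n f k] J_mult[of f n "scal a" k] that free_scal[of a n] by (simp add: scal_commute)
  show ?thesis
  proof unfold_locales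
    fix a b
    show "J n k (scal (a + b)) = J n k (scal a) + J n k (scal b)" "J n k (scal (a * b)) = J n k (scal a) * J n k (scal b)"
      by (simp_all add: scal_add scal_mult J_add J_mult cl)
  next
    show "J n k (wg id) = J n k (scal 1)"
      using J_rel[OF hc_rels.W_one] permutes_id by (simp add: scal_1 cl)
  next
    fix u v assume "u permutes {1..n}" "v permutes {1..n}"
    then show "J n k (wg u) * J n k (wg v) = J n k (wg (u \<circ> v))"
      using J_rel[OF hc_rels.W_mult, of u n v k] permutes_compose[of v _ u] by (simp add: J_mult cl)
  next
    fix i j assume ij: "i \<in> {1..n}" "j \<in> {1..n}"
    show "J n k (xg i) * J n k (xg j) = J n k (xg j) * J n k (xg i)"
      using J_rel[OF hc_rels.XX[OF ij]] ij by (simp add: J_mult cl)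
    show "scomm (i = j) (J n k (xg i)) (J n k (cg j))"
      using J_rel[OF hc_rels.XC[OF ij]] J_rel[OF hc_rels.XC_same[OF ij(1)]] ij
      by (cases "i = j") (simp_all add: J_mult J_minus cl scommI)
    show "scomm True (J n k (cg i)) (J n k (cg j))" if "i \<noteq> j"
      using J_rel[OF hc_rels.CC[OF ij that]] ij by (simp add: J_mult J_minus cl scommI)
    show "J n k (cg i) * J n k (cg i) = - J n k (scal 1)"
      using J_rel[OF hc_rels.C_square[OF ij(1)]] ij by (simp add: J_mult J_minus cl scal_1)
  next
    fix u i assume u: "u permutes {1..n}" and i: "i \<in> {1..n}"
    have "u i \<in> {1..n}" using permutes_in_image[OF u] i by simp
    then show "J n k (wg u) * J n k (cg i) = J n k (cg (u i)) * J n k (wg u)"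
      using J_rel[OF hc_rels.WC[OF u i]] u i by (simp add: J_mult cl)
  next
    fix i assume i: "1 \<le> i" "i + 1 \<le> n"
    have "J n k (sg i (i + 1) * xg i - xg (i + 1) * sg i (i + 1)) = J n k (scal k * (- 1 + cg i * cg (i + 1)))"
      by (rule J_rel[OF hc_rels.SX[OF i]]) (intro cl sw mem i)+
    then have "J n k (sg i (i + 1)) * J n k (xg i) - J n k (xg (i + 1)) * J n k (sg i (i + 1)) =
       J n k (scal k) * (- J n k (scal 1) + J n k (cg i) * J n k (cg (i + 1)))"
      using mem[OF i] sw[OF i] J_add[of "- 1" n "cg i * cg (i + 1)" k]
      by (simp add: J_diff J_mult J_minus cl scal_1)
    then show "J n k (sg i (i + 1)) * J n k (xg i) = J n k (xg (i + 1)) * J n k (sg i (i + 1)) +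
       J n k (scal k) * (- J n k (scal 1) + J n k (cg i) * J n k (cg (i + 1)))"
      by (simp add: algebra_simps)
  next
    fix i j assume i: "1 \<le> i" "i + 1 \<le> n" and j: "j \<in> {1..n}" "j \<noteq> i" "j \<noteq> i + 1"
    show "J n k (sg i (i + 1)) * J n k (xg j) = J n k (xg j) * J n k (sg i (i + 1))"
      using J_rel[OF hc_rels.SX_far[OF i j]] sw[OF i] j(1) by (simp add: J_mult cl)
  qed (auto intro!: one cen cl)
qed

section \<open>Parity of words and the concrete filtration\<close>

definition word_parity :: "bool \<Rightarrow> hc_free \<Rightarrow> bool" where
  "word_parity p f \<longleftrightarrow> (\<forall>u\<in>Poly_Mapping.keys f. odd_word u = p)"

lemma parity_add: "word_parity p f \<Longrightarrow> word_parity p g \<Longrightarrow> word_parity p (f + g)"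
  using keys_add[of f g] by (auto simp: word_parity_def)

lemma parity_mult: "word_parity p f \<Longrightarrow> word_parity q g \<Longrightarrow> word_parity (p \<noteq> q) (f * g)"
  by (auto simp: word_parity_def odd_word_add dest!: keys_mult')

lemma parity_gens: "word_parity False (xg i)" "word_parity True (cg i)" "word_parity False (wg u)"
  "word_parity False (scal a)" "word_parity p 0"
  by (auto simp: word_parity_def gen_def scal_def odd_word_def zero_hc_word_def)

lemma hc_even_iff: "h \<in> hc_even n k \<longleftrightarrow> (\<exists>f\<in>carrier (free_alg n). word_parity False f \<and> h = cls n k f)"
  and hc_odd_iff: "h \<in> hc_odd n k \<longleftrightarrow> (\<exists>f\<in>carrier (free_alg n). word_parity True f \<and> h = cls n k f)"
  by (auto simp: hc_even_def hc_odd_def word_parity_def)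

lemma poly_mapping_sum_singles:
  "f = (\<Sum>u\<in>Poly_Mapping.keys f. Poly_Mapping.single u (Poly_Mapping.lookup f u))"
proof (rule poly_mapping_eqI)
  fix v
  have "Poly_Mapping.lookup (\<Sum>u\<in>Poly_Mapping.keys f. Poly_Mapping.single u (Poly_Mapping.lookup f u)) v =
    (\<Sum>u\<in>Poly_Mapping.keys f. if v = u then Poly_Mapping.lookup f u else 0)"
    by (simp add: lookup_sum lookup_single when_def eq_commute)
  then show "Poly_Mapping.lookup f v =
    Poly_Mapping.lookup (\<Sum>u\<in>Poly_Mapping.keys f. Poly_Mapping.single u (Poly_Mapping.lookup f u)) v"
    by (simp add: in_keys_iff)
qed

locale hc_concrete =
  fixes n :: nat and k :: complex
begin

sublocale hc_alg n k "\<lambda>a. J n k (scal a)" "\<lambda>i. J n k (xg i)" "\<lambda>i. J n k (cg i)" "\<lambda>u. J n k (wg u)"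
  by (rule hc_alg_J)

lemma Fl_J: "Fl p m h \<Longrightarrow> \<exists>f\<in>carrier (free_alg n). word_parity p f \<and> h = J n k f"
proof (induction rule: Fl.induct)
  case (Fl_S m a)
  then show ?case using free_scal parity_gens(4) by blast
next
  case (Fl_0 p m)
  then show ?case by (intro bexI[of _ 0]) (simp_all add: J_0 parity_gens free_zero)
next
  case (Fl_add p m g h)
  then obtain f f' where "f \<in> carrier (free_alg n)" "word_parity p f" "g = J n k f"
    "f' \<in> carrier (free_alg n)" "word_parity p f'" "h = J n k f'" by blast
  then show ?case by (intro bexI[of _ "f + f'"]) (auto simp: J_add intro: parity_add free_add)
next
  case (Fl_x i p m h)
  then obtain f where "f \<in> carrier (free_alg n)" "word_parity p f" "h = J n k f" by blast
  then show ?case using Fl_x(1) parity_mult[OF parity_gens(1), of p f i]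
    by (intro bexI[of _ "xg i * f"]) (auto simp: J_mult gens_carrier intro: free_mult)
next
  case (Fl_c i p m h)
  then obtain f where "f \<in> carrier (free_alg n)" "word_parity p f" "h = J n k f" by blast
  then show ?case using Fl_c(1) parity_mult[OF parity_gens(2), of p f i]
    by (intro bexI[of _ "cg i * f"]) (auto simp: J_mult gens_carrier intro: free_mult)
next
  case (Fl_w u p m h)
  then obtain f where "f \<in> carrier (free_alg n)" "word_parity p f" "h = J n k f" by blast
  then show ?case using Fl_w(1) parity_mult[OF parity_gens(3), of p f u]
    by (intro bexI[of _ "wg u * f"]) (auto simp: J_mult gens_carrier intro: free_mult)
qed

lemma J_Fl_single: "set l \<subseteq> gens n \<Longrightarrow> Fl (odd (length (filter odd_letter l))) (length l) (J n k (Poly_Mapping.single (Word l) a))"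
proof (induction l)
  case Nil
  then show ?case using Fl_S[of 0 a] by (simp add: scal_def zero_hc_word_def)
next
  case (Cons g l)
  have "Poly_Mapping.single (Word (g # l)) a = gen g * Poly_Mapping.single (Word l) a"
    by (simp add: gen_def mult_single plus_hc_word_def)
  moreover have "gen g \<in> carrier (free_alg n)" "Poly_Mapping.single (Word l) a \<in> carrier (free_alg n)"
    using Cons.prems free_gen free_single[of "Word l"] by auto
  ultimately have eq: "J n k (Poly_Mapping.single (Word (g # l)) a) = J n k (gen g) * J n k (Poly_Mapping.single (Word l) a)"
    by (simp add: J_mult)
  have IH: "Fl (odd (length (filter odd_letter l))) (length l) (J n k (Poly_Mapping.single (Word l) a))"
    using Cons by simp
  have "g \<in> gens n" using Cons.prems by simp
  then consider i where "g = GX i" "i \<in> I" | i where "g = GC i" "i \<in> I" | u where "g = GW u" "u permutes I"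
    by (auto simp: gens_def)
  then show ?case
  proof cases
    case 1
    then show ?thesis using Fl_x[OF _ IH] eq by simp
  next
    case 2
    then show ?thesis using Fl_mono[OF Fl_c[OF _ IH], of i "Suc (length l)"] eq by simp
  next
    case 3
    then show ?thesis using Fl_mono[OF Fl_w[OF _ IH], of u "Suc (length l)"] eq by simp
  qed
qed

lemma J_Fl: assumes "f \<in> carrier (free_alg n)" "word_parity p f" shows "\<exists>m. Fl p m (J n k f)"
proof -
  let ?K = "Poly_Mapping.keys f"
  \<comment> \<open>The sum of all word lengths is a crude common bound for the degrees.\<close>
  let ?m = "\<Sum>u\<in>?K. length (letters u)"
  have J: "J n k (\<Sum>u\<in>A. Poly_Mapping.single u (Poly_Mapping.lookup f u)) =
      (\<Sum>u\<in>A. J n k (Poly_Mapping.single u (Poly_Mapping.lookup f u))) \<and>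
      (\<Sum>u\<in>A. Poly_Mapping.single u (Poly_Mapping.lookup f u)) \<in> carrier (free_alg n)" if "A \<subseteq> ?K" "finite A" for A
    using that(2,1)
  proof (induction A rule: finite_induct)
    case (insert u A)
    have "Poly_Mapping.single u (Poly_Mapping.lookup f u) \<in> carrier (free_alg n)"
      using insert assms(1) by (intro free_single) (auto simp: free_alg_simps)
    with insert show ?case by (auto simp: J_add intro: free_add)
  qed (simp add: J_0 free_zero)
  have "Fl p ?m (J n k (Poly_Mapping.single u (Poly_Mapping.lookup f u)))" if u: "u \<in> ?K" for u
  proof (rule Fl_mono)
    have "set (letters u) \<subseteq> gens n" using assms(1) u by (auto simp: free_alg_simps)
    moreover have "odd (length (filter odd_letter (letters u))) = p" using assms(2) u by (auto simp: word_parity_def odd_word_def)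
    ultimately show "Fl p (length (letters u)) (J n k (Poly_Mapping.single u (Poly_Mapping.lookup f u)))"
      using J_Fl_single[of "letters u" "Poly_Mapping.lookup f u"] by simp
    show "length (letters u) \<le> ?m" using u by (intro member_le_sum) auto
  qed
  then have "Fl p ?m (\<Sum>u\<in>?K. J n k (Poly_Mapping.single u (Poly_Mapping.lookup f u)))" by (rule Fl_sum)
  then have "Fl p ?m (J n k f)"
    using J[OF order_refl finite_keys] unfolding poly_mapping_sum_singles[symmetric] by simp
  then show ?thesis ..
qed

text \<open>Homogeneity of the ideal makes the two parities independent in the actual algebra, which
  the abstract locale left open.\<close>

lemma Fl_direct: assumes "Fl False m g" "Fl True l h" "g + h = 0" shows "g = 0"
proof -
  obtain f f' where f: "f \<in> carrier (free_alg n)" "word_parity False f" "g = J n k f"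
    "f' \<in> carrier (free_alg n)" "word_parity True f'" "h = J n k f'"
    using Fl_J[OF assms(1)] Fl_J[OF assms(2)] by blast
  have "J n k (f + f') = J n k 0" using assms(3) f by (simp add: J_add J_0)
  then have "f + f' \<in> hc_ideal n k" using J_eq_iff[OF free_add[OF f(1,4)] free_zero] by simp
  then have "f \<in> hc_ideal n k" using even_odd_zero[OF f(1,4)] f(2,5) by (auto simp: word_parity_def)
  then show ?thesis using J_eq_iff[OF f(1) free_zero] f(3) J_0 by simp
qed

section \<open>Existence of the projection and of the evaluation\<close>

lemma factor_J:
  assumes "hc_rep n k V sc opr" "v \<in> V"
  obtains \<Psi> where "\<And>f. f \<in> carrier (free_alg n) \<Longrightarrow> \<Psi> (J n k f) = hc_rep.ev sc opr f v"
proof -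
  obtain \<Psi> where *: "\<And>f. f \<in> carrier (free_alg n) \<Longrightarrow> \<Psi> (cls n k f) = hc_rep.ev sc opr f v"
    using hc_rep.factor[OF assms] by blast
  have "(\<Psi> \<circ> comp_at n k) (J n k f) = hc_rep.ev sc opr f v" if "f \<in> carrier (free_alg n)" for f
    using *[OF that] that by (simp add: J_def comp_emb cls_carrier)
  then show thesis using that by blast
qed

text \<open>Both maps evaluate a representation at a vector: \<phi> applies left multiplication,
  with \<open>M i\<close> in place of \<open>x i\<close>, to the unit, and \<psi> applies the
  induced module to its generator.\<close>

lemma ex_univ: "\<exists>\<phi> \<psi>. hc_univ n k (\<lambda>a. J n k (scal a)) (\<lambda>i. J n k (xg i)) (\<lambda>i. J n k (cg i)) (\<lambda>u. J n k (wg u)) \<phi> \<psi>"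
proof -
  interpret RM: hc_rep n k "{v. E * v = v}" "\<lambda>a v. J n k (scal a) * v" oprM by (rule rep_M)
  interpret RV: hc_rep n k indV scV oprV by (rule rep_V)
  let ?v = "delta (point (\<lambda>_. 0) E)"
  have E: "E \<in> {v. E * v = v}" by (simp flip: S_mult)
  have "unital (point (\<lambda>_. 0) E)" by (auto simp: unital_def point_def simp flip: S_mult)
  then have v: "?v \<in> indV" by (rule delta_mem)
  obtain \<phi> where \<phi>: "\<And>f. f \<in> carrier (free_alg n) \<Longrightarrow> \<phi> (J n k f) = RM.ev f E"
    using factor_J[OF rep_M E] by blast
  obtain \<psi> where \<psi>: "\<And>f. f \<in> carrier (free_alg n) \<Longrightarrow> \<psi> (J n k f) = RV.ev f ?v"
    using factor_J[OF rep_V v] by blast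
  have g: "GX i \<in> gens n" "GC i \<in> gens n" if "i \<in> I" for i using that by (auto simp: gens_def)
  have gw: "GW u \<in> gens n" if "u permutes I" for u using that by (auto simp: gens_def)
  have J: "\<exists>f\<in>carrier (free_alg n). h = J n k f" if "Fl p m h" for p m h using Fl_J[OF that] by blast
  have phi: "\<phi> (J n k (gen y) * h) = oprM y (\<phi> h)" "\<psi> (J n k (gen y) * h) = oprV y (\<psi> h)"
    if "y \<in> gens n" "Fl p m h" for y p m h
  proof -
    obtain f where f: "f \<in> carrier (free_alg n)" "h = J n k f" using J[OF \<open>Fl p m h\<close>] by blast
    have y: "gen y \<in> carrier (free_alg n)" using free_gen that by blast
    have "J n k (gen y) * h = J n k (gen y * f)" using f y by (simp add: J_mult)
    then show "\<phi> (J n k (gen y) * h) = oprM y (\<phi> h)" "\<psi> (J n k (gen y) * h) = oprV y (\<psi> h)"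
      using f y E v that(1) by (simp_all add: \<phi> \<psi> free_mult RM.ev_mult RV.ev_mult RM.ev_gen RV.ev_gen RM.ev_V RV.ev_V
          del: mem_Collect_eq)
  qed
  have "hc_univ n k (\<lambda>a. J n k (scal a)) (\<lambda>i. J n k (xg i)) (\<lambda>i. J n k (cg i)) (\<lambda>u. J n k (wg u)) \<phi> \<psi>"
  proof unfold_locales
    fix a
    show "\<phi> (J n k (scal a)) = J n k (scal a)"
      by (simp add: \<phi> free_scal RM.ev_scal flip: S_mult)
    show "\<psi> (J n k (scal a)) = delta (point (\<lambda>_. 0) (J n k (scal a)))"
      by (auto simp: \<psi> free_scal RV.ev_scal scV_def scf_def delta_def point_def fun_eq_iff simp flip: S_mult)
  next
    fix p m a h q l h' assume "Fl p m h" "Fl q l h'"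
    then obtain f f' where f: "f \<in> carrier (free_alg n)" "h = J n k f" "f' \<in> carrier (free_alg n)" "h' = J n k f'"
      using J by meson
    then show "\<phi> (h + h') = \<phi> h + \<phi> h'" "\<psi> (h + h') = \<psi> h + \<psi> h'"
      by (simp_all add: \<phi> \<psi> free_add RM.ev_add RV.ev_add flip: J_add)
  next
    fix p m a h assume "Fl p m h"
    then obtain f where f: "f \<in> carrier (free_alg n)" "h = J n k f" using J by meson
    then show "\<phi> (J n k (scal a) * h) = J n k (scal a) * \<phi> h"
      using E by (simp add: \<phi> free_mult free_scal RM.ev_mult RM.ev_scal flip: J_mult del: mem_Collect_eq)
  next
    fix i p m h assume "i \<in> I" "Fl p m h"
    then show "\<phi> (J n k (xg i) * h) = M i * \<phi> h" "\<phi> (J n k (cg i) * h) = J n k (cg i) * \<phi> h"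
      "\<psi> (J n k (xg i) * h) = opX i (\<psi> h)" "\<psi> (J n k (cg i) * h) = opC i (\<psi> h)"
      using phi[OF g(1)] phi[OF g(2)] by (simp_all add: oprM_def oprV_def)
  next
    fix u p m h assume "u permutes I" "Fl p m h"
    then show "\<phi> (J n k (wg u) * h) = J n k (wg u) * \<phi> h" "\<psi> (J n k (wg u) * h) = opW u (\<psi> h)"
      using phi[OF gw] by (simp_all add: oprM_def oprV_def)
  qed
  then show ?thesis by blast
qed

end

section \<open>The map \<open>\<zeta>\<close>\<close>

context hc_concrete
begin

abbreviation em :: "hc_free set \<Rightarrow> hc_prod" where "em \<equiv> emb n k"
abbreviation H :: "hc_free set ring" where "H \<equiv> HCl n k"

lemma Fl_em: "Fl p m h \<Longrightarrow> \<exists>g\<in>carrier H. h = em g"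
  using Fl_J cls_carrier unfolding J_def by blast

lemma even_carrier: "h \<in> hc_even n k \<Longrightarrow> h \<in> carrier H" and odd_carrier: "h \<in> hc_odd n k \<Longrightarrow> h \<in> carrier H"
  by (auto simp: hc_even_iff hc_odd_iff cls_carrier)

lemma even_Fl: "h \<in> hc_even n k \<Longrightarrow> \<exists>m. Fl False m (em h)"
  using J_Fl by (auto simp: hc_even_iff J_def)

lemma odd_Fl: "h \<in> hc_odd n k \<Longrightarrow> \<exists>m. Fl True m (em h)"
  using J_Fl by (auto simp: hc_odd_iff J_def)

lemma Fl_even: assumes "Fl False m (em h)" "h \<in> carrier H" shows "h \<in> hc_even n k"
proof -
  obtain f where f: "f \<in> carrier (free_alg n)" "word_parity False f" "em h = J n k f" using Fl_J[OF assms(1)] by blast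
  then have "h = cls n k f" using emb_inj[OF assms(2) cls_carrier[OF f(1)]] by (simp add: J_def)
  then show ?thesis using f hc_even_iff by blast
qed

lemma Fl_odd: assumes "Fl True m (em h)" "h \<in> carrier H" shows "h \<in> hc_odd n k"
proof -
  obtain f where f: "f \<in> carrier (free_alg n)" "word_parity True f" "em h = J n k f" using Fl_J[OF assms(1)] by blast
  then have "h = cls n k f" using emb_inj[OF assms(2) cls_carrier[OF f(1)]] by (simp add: J_def)
  then show ?thesis using f hc_odd_iff by blast
qed

lemma em_decomp: assumes "h \<in> carrier H"
  obtains g g' l m where "Fl False l g" "Fl True m g'" "em h = g + g'"
proof -
  obtain h0 h1 where h: "h0 \<in> hc_even n k" "h1 \<in> hc_odd n k" "h = h0 \<oplus>\<^bsub>H\<^esub> h1"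
    using decomp_exists[OF assms] by blast
  then have "em h = em h0 + em h1" by (simp add: emb_ops even_carrier odd_carrier)
  then show thesis using even_Fl[OF h(1)] odd_Fl[OF h(2)] that by blast
qed

lemma em_one: "em \<one>\<^bsub>H\<^esub> = E"
proof -
  have "cls n k \<one>\<^bsub>free_alg n\<^esub> = \<one>\<^bsub>H\<^esub>" by (rule ring_hom_one[OF cls_hom])
  then show ?thesis by (simp add: J_def scal_1 free_alg_simps)
qed

lemma Dirac_carrier: "Dirac n k \<in> carrier H" and em_Dirac: "em (Dirac n k) = Dd"
proof -
  note cl = free_closed[where n = n]
  let ?T = "{(i, j). i \<in> I \<and> j \<in> I \<and> i < j}"
  have fin: "finite ?T" by (rule finite_subset[of _ "I \<times> I"]) auto
  have sum: "sum f A \<in> carrier (free_alg n) \<and> J n k (sum f A) = (\<Sum>a\<in>A. J n k (f a))"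
    if "finite A" "\<And>a. a \<in> A \<Longrightarrow> f a \<in> carrier (free_alg n)" for f :: "'b \<Rightarrow> hc_free" and A
    using that by (induction A rule: finite_induct) (auto simp: J_add J_0 free_zero intro: free_add)
  let ?x = "\<lambda>i. xg i * cg i"
  let ?s = "\<lambda>(i, j). sg i j * (scal (complex_of_real (sqrt 2 / 2)) * (cg i - cg j))"
  have x: "?x i \<in> carrier (free_alg n)" "J n k (?x i) = J n k (xg i) * J n k (cg i)" if "i \<in> I" for i
    using that by (auto simp: J_mult cl)
  let ?r = "complex_of_real (sqrt 2 / 2)"
  have s: "?s a \<in> carrier (free_alg n)"
    "J n k (?s a) = J n k (scal ?r) * (case a of (i, j) \<Rightarrow> J n k (sg i j) * (J n k (cg i) - J n k (cg j)))"
    if "a \<in> ?T" for a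
  proof -
    obtain i j where a: "a = (i, j)" "i \<in> I" "j \<in> I" using \<open>a \<in> ?T\<close> by auto
    have w: "transpose i j permutes I" using a by (intro swap_permutes)
    show "?s a \<in> carrier (free_alg n)" using a w by (auto intro!: cl)
    have "J n k (?s a) = J n k (sg i j) * (J n k (scal ?r) * (J n k (cg i) - J n k (cg j)))"
      using a w by (simp add: J_mult J_diff cl del: of_real_divide)
    then show "J n k (?s a) = J n k (scal ?r) * (case a of (i, j) \<Rightarrow> J n k (sg i j) * (J n k (cg i) - J n k (cg j)))"
      using a S_w[OF w, of ?r] by (simp flip: mult.assoc del: of_real_divide)
  qed
  let ?k = "complex_of_real (sqrt 2) * k"
  \<comment> \<open>The normalizing factors sqrt 2 and sqrt 2 / 2 of the Dirac element multiply to
    1.\<close>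
  have rk: "?k * ?r = k"
  proof -
    have "complex_of_real (sqrt 2) * ?r = complex_of_real (sqrt 2 * (sqrt 2 / 2))" by (simp only: of_real_mult)
    also have "sqrt 2 * (sqrt 2 / 2) = (1 :: real)" by simp
    finally have "complex_of_real (sqrt 2) * ?r = 1" by (simp only: of_real_1)
    then show ?thesis by (simp only: mult.assoc mult.left_commute[of _ k] mult.commute[of k] mult_1_left)
        (simp only: mult.commute mult.left_commute mult_1_left mult_1_right)
  qed
  let ?D = "sum ?x I + scal ?k * sum ?s ?T"
  have D: "?D \<in> carrier (free_alg n)"
    using sum[of I ?x] sum[OF fin, of ?s] x(1) s(1) by (auto intro!: cl)
  have "J n k ?D = (\<Sum>i\<in>I. J n k (xg i) * J n k (cg i)) + J n k (scal ?k) * (\<Sum>a\<in>?T. J n k (?s a))"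
    using sum[of I ?x] sum[OF fin, of ?s] x s(1) by (simp add: J_add J_mult cl cong: sum.cong)
  also have "(\<Sum>a\<in>?T. J n k (?s a)) =
      J n k (scal ?r) * (\<Sum>(i, j)\<in>?T. J n k (sg i j) * (J n k (cg i) - J n k (cg j)))"
    unfolding sum_distrib_left by (intro sum.cong refl s)
  also have "J n k (scal ?k) * \<dots> = J n k (scal k) * (\<Sum>(i, j)\<in>?T. J n k (sg i j) * (J n k (cg i) - J n k (cg j)))"
    by (simp only: mult.assoc[symmetric] S_mult[symmetric] rk)
  finally have "J n k ?D = Dd" by (simp only: Dd_eq)
  then show "Dirac n k \<in> carrier H" "em (Dirac n k) = Dd"
    using D cls_carrier[OF D] by (simp_all only: Dirac_def J_def)
qed

lemma dmap_em:
  assumes "h0 \<in> hc_even n k" "h1 \<in> hc_odd n k"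
  shows "dmap n k (h0 \<oplus>\<^bsub>H\<^esub> h1) \<in> carrier H"
    "em (dmap n k (h0 \<oplus>\<^bsub>H\<^esub> h1)) = (Dd * em h0 - em h0 * Dd) + (Dd * em h1 + em h1 * Dd)"
  unfolding dmap_eq[OF assms]
  using assms Dirac_carrier
  by (simp_all add: emb_ops em_Dirac even_carrier odd_carrier ring.ring_simprules[OF ring_HCl])

text \<open>Together with \<open>Fl_Seg\<close> this identifies the generated subalgebra with degree
  0 of the filtration.\<close>

lemma Seg_em: "y \<in> carrier (Seg n k) \<Longrightarrow> y \<in> carrier H \<and> (\<exists>g g'. Fl False 0 g \<and> Fl True 0 g' \<and> em y = g + g')"
proof -
  let ?G = "range (\<lambda>a. cls n k (scal a)) \<union> (\<lambda>w. cls n k (wg w)) ` {w. w permutes I} \<union> (\<lambda>i. cls n k (cg i)) ` I"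
  assume "y \<in> carrier (Seg n k)"
  then have "y \<in> generate_ring H ?G" by (simp add: Seg_def)
  then show ?thesis
  proof (induction rule: generate_ring.induct)
    case one
    then show ?case using em_one Fl_S[of 0 1] Fl_0[of True 0]
      by (intro conjI exI[of _ E] exI[of _ 0]) (auto simp: ring.ring_simprules[OF ring_HCl])
  next
    case (incl h)
    have "h \<in> carrier H \<and> (Fl False 0 (em h) \<or> Fl True 0 (em h))"
    proof -
      consider a where "h = cls n k (scal a)" | u where "h = cls n k (wg u)" "u permutes I"
        | i where "h = cls n k (cg i)" "i \<in> I" using incl by auto
      then show ?thesis
      proof cases
        case 1
        then show ?thesis using Fl_S[of 0 a] cls_carrier[OF free_scal] by (simp add: J_def)
      next
        case 2
        then show ?thesis using Fl_w1[of u 0] cls_carrier[OF gens_carrier(3)] by (simp add: J_def)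
      next
        case 3
        then show ?thesis using Fl_c1[of i 0] cls_carrier[OF gens_carrier(2)] by (simp add: J_def)
      qed
    qed
    then show ?case using Fl_0 by (metis add.left_neutral add.right_neutral)
  next
    case (a_inv h)
    then obtain g g' where g: "Fl False 0 g" "Fl True 0 g'" "em h = g + g'" and h: "h \<in> carrier H" by blast
    have "em (\<ominus>\<^bsub>H\<^esub> h) = - g + - g'" using g h emb_ops(4)[OF h h] by simp
    then show ?case using Fl_minus[OF g(1)] Fl_minus[OF g(2)] h
      by (auto simp: ring.ring_simprules[OF ring_HCl])
  next
    case (eng_add h1 h2)
    then obtain g g' f f' where g: "Fl False 0 g" "Fl True 0 g'" "em h1 = g + g'"
      "Fl False 0 f" "Fl True 0 f'" "em h2 = f + f'" by blast
    have h: "h1 \<in> carrier H" "h2 \<in> carrier H" using eng_add by auto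
    have "em (h1 \<oplus>\<^bsub>H\<^esub> h2) = (g + f) + (g' + f')" using g emb_ops(1)[OF h] by simp
    then show ?case using Fl_add[OF g(1,4)] Fl_add[OF g(2,5)] ring.ring_simprules(1)[OF ring_HCl h] by blast
  next
    case (eng_mult h1 h2)
    then obtain g g' f f' where g: "Fl False 0 g" "Fl True 0 g'" "em h1 = g + g'"
      "Fl False 0 f" "Fl True 0 f'" "em h2 = f + f'" by blast
    have "Fl False 0 (g * f + g' * f')" "Fl True 0 (g * f' + g' * f)"
      using Fl_mult[OF g(1,4)] Fl_mult[OF g(2,5)] Fl_mult[OF g(1,5)] Fl_mult[OF g(2,4)] by (auto intro: Fl_add)
    moreover have h: "h1 \<in> carrier H" "h2 \<in> carrier H" using eng_mult by auto
    moreover have "em (h1 \<otimes>\<^bsub>H\<^esub> h2) = (g * f + g' * f') + (g * f' + g' * f)"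
      using g emb_ops(2)[OF h] by (simp add: algebra_simps)
    ultimately show ?case using ring.ring_simprules(5)[OF ring_HCl h] by blast
  qed
qed

lemma Fl_Seg: "Fl p 0 h \<Longrightarrow> \<exists>y\<in>carrier (Seg n k). y \<in> carrier H \<and> em y = h"
proof (induction p "0 :: nat" h rule: Fl.induct)
  case (Fl_S a)
  have "cls n k (scal a) \<in> carrier (Seg n k)" unfolding Seg_def by (simp, rule generate_ring.incl) auto
  then show ?case using cls_carrier[OF free_scal] by (intro bexI[of _ "cls n k (scal a)"]) (auto simp: J_def)
next
  case (Fl_0 p)
  have "cls n k (scal 0) \<in> carrier (Seg n k)" unfolding Seg_def by (simp, rule generate_ring.incl) auto
  then show ?case using cls_carrier[OF free_scal, of n k 0] S_0
    by (intro bexI[of _ "cls n k (scal 0)"]) (auto simp: J_def)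
next
  case (Fl_add p g h)
  then obtain y z where "y \<in> carrier (Seg n k)" "y \<in> carrier H" "em y = g"
    "z \<in> carrier (Seg n k)" "z \<in> carrier H" "em z = h" by blast
  then show ?case
    by (intro bexI[of _ "y \<oplus>\<^bsub>H\<^esub> z"])
      (auto simp: emb_ops ring.ring_simprules[OF ring_HCl] Seg_def intro: generate_ring.eng_add)
next
  case (Fl_c i p h)
  then obtain y where y: "y \<in> carrier (Seg n k)" "y \<in> carrier H" "em y = h" by blast
  have "cls n k (cg i) \<in> carrier (Seg n k)" unfolding Seg_def by (simp, rule generate_ring.incl) (use Fl_c in auto)
  then show ?case using y cls_carrier[OF gens_carrier(2)[OF Fl_c(1)], of k]
    by (intro bexI[of _ "cls n k (cg i) \<otimes>\<^bsub>H\<^esub> y"])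
      (auto simp: emb_ops ring.ring_simprules[OF ring_HCl] Seg_def J_def intro: generate_ring.eng_mult)
next
  case (Fl_w u p h)
  then obtain y where y: "y \<in> carrier (Seg n k)" "y \<in> carrier H" "em y = h" by blast
  have "cls n k (wg u) \<in> carrier (Seg n k)" unfolding Seg_def by (simp, rule generate_ring.incl) (use Fl_w in auto)
  then show ?case using y cls_carrier[OF gens_carrier(3)[OF Fl_w(1)], of k]
    by (intro bexI[of _ "cls n k (wg u) \<otimes>\<^bsub>H\<^esub> y"])
      (auto simp: emb_ops ring.ring_simprules[OF ring_HCl] Seg_def J_def intro: generate_ring.eng_mult)
qed

text \<open>Translates the even center into the language of the averaging argument.\<close>

lemma ZSeg0_iff: "y \<in> carrier (ZSeg0 n k) \<longleftrightarrow> y \<in> carrier H \<and> Fl False 0 (em y) \<and> sginv False (em y)"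
proof
  assume "y \<in> carrier (ZSeg0 n k)"
  then have y: "y \<in> carrier (Seg n k)" "y \<in> hc_even n k"
    and comm: "\<And>h. h \<in> carrier (Seg n k) \<Longrightarrow> y \<otimes>\<^bsub>H\<^esub> h = h \<otimes>\<^bsub>H\<^esub> y"
    by (auto simp: ZSeg0_def ring_center_def Seg_def)
  have yH: "y \<in> carrier H" using even_carrier[OF y(2)] .
  obtain g g' where g: "Fl False 0 g" "Fl True 0 g'" "em y = g + g'" using Seg_em[OF y(1)] by blast
  obtain m where m: "Fl False m (em y)" using even_Fl[OF y(2)] by blast
  \<comment> \<open>\<open>em y\<close> is even of unknown degree, and of degree 0 with unknown
    parity. Directness removes the odd part and combines the two facts.\<close>
  have "(g - em y) + g' = 0" using g(3) by simp
  moreover have "Fl False m (g - em y)" by (intro Fl_diff Fl_mono[OF g(1)] m) simp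
  ultimately have "g - em y = 0" using Fl_direct g(2) by blast
  then have F: "Fl False 0 (em y)" using g(1) by simp
  have c: "em y * h = h * em y" if h: "Fl p 0 h" for p h
  proof -
    obtain z where z: "z \<in> carrier (Seg n k)" "z \<in> carrier H" "em z = h" using Fl_Seg[OF h] by blast
    have "em (y \<otimes>\<^bsub>H\<^esub> z) = em (z \<otimes>\<^bsub>H\<^esub> y)" using comm[OF z(1)] by simp
    then show ?thesis using z yH by (simp add: emb_ops)
  qed
  have "sginv False (em y)"
    using c[OF Fl_c1[of _ 0]] c[OF Fl_w1[of _ 0]] by (auto simp: sginv_def intro!: scommI(2))
  with F yH show "y \<in> carrier H \<and> Fl False 0 (em y) \<and> sginv False (em y)" by blast
next
  assume y: "y \<in> carrier H \<and> Fl False 0 (em y) \<and> sginv False (em y)"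
  obtain z where z: "z \<in> carrier (Seg n k)" "z \<in> carrier H" "em z = em y" using Fl_Seg y by blast
  then have "y = z" using y emb_inj by blast
  moreover have "y \<otimes>\<^bsub>H\<^esub> h = h \<otimes>\<^bsub>H\<^esub> y" if h: "h \<in> carrier (Seg n k)" for h
  proof -
    obtain g g' where g: "h \<in> carrier H" "Fl False 0 g" "Fl True 0 g'" "em h = g + g'" using Seg_em[OF h] by blast
    have "em y * g = g * em y" "em y * g' = g' * em y"
      using sginv_Sg[OF g(2), of False "em y"] sginv_Sg[OF g(3), of False "em y"] y by (auto simp: scomm_def sgn_mult_def)
    then have "em (y \<otimes>\<^bsub>H\<^esub> h) = em (h \<otimes>\<^bsub>H\<^esub> y)" using y g by (simp add: emb_ops distrib_left distrib_right)
    then show ?thesis using emb_inj y g(1) ring.ring_simprules(5)[OF ring_HCl] by metis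
  qed
  ultimately show "y \<in> carrier (ZSeg0 n k)"
    using z y Fl_even[of 0 y] by (auto simp: ZSeg0_def ring_center_def Seg_def)
qed

end

locale hc_concrete_univ = hc_concrete n k +
  hc_univ n k "\<lambda>a. J n k (scal a)" "\<lambda>i. J n k (xg i)" "\<lambda>i. J n k (cg i)" "\<lambda>u. J n k (wg u)" \<phi> \<psi>
  for n k \<phi> \<psi>
begin

text \<open>A central element has no odd part: x_1 ... x_n is even, so the odd component commutes
  with it separately, and \<open>odd_commuting_zero\<close> applies.\<close>

lemma ZH_iff: "z \<in> carrier (ZH n k) \<longleftrightarrow> z \<in> carrier H \<and> Zc (em z)"
proof
  assume "z \<in> carrier (ZH n k)"
  then have zH: "z \<in> carrier H" and comm: "\<And>h. h \<in> carrier H \<Longrightarrow> z \<otimes>\<^bsub>H\<^esub> h = h \<otimes>\<^bsub>H\<^esub> z"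
    by (auto simp: ZH_def ring_center_def)
  have c: "em z * h = h * em z" if h: "Fl p m h" for p m h
  proof -
    obtain g where g: "g \<in> carrier H" "h = em g" using Fl_em[OF h] by blast
    have "em (z \<otimes>\<^bsub>H\<^esub> g) = em (g \<otimes>\<^bsub>H\<^esub> z)" using comm[OF g(1)] by simp
    then show ?thesis using g zH by (simp add: emb_ops)
  qed
  obtain z0 z1 l m where z: "Fl False l z0" "Fl True m z1" "em z = z0 + z1" using em_decomp[OF zH] .
  let ?X = "xp ones"
  have X: "Fl False n ?X" by (rule Fl_xp[OF ones_mi])
  have "(?X * z0 - z0 * ?X) + (?X * z1 - z1 * ?X) = 0"
    using c[OF X] unfolding z(3) by (simp add: algebra_simps)
  moreover have e: "Fl False (n + l) (?X * z0 - z0 * ?X)" and o: "Fl True (n + m) (?X * z1 - z1 * ?X)"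
    using z X by (auto intro!: Fl_diff Fl_mult'[OF X] Fl_mult'[OF _ X])
  ultimately have "?X * z1 = z1 * ?X" using Fl_direct[OF e o] by simp
  then have "z1 = 0" using odd_commuting_zero[OF z(2)] by blast
  then show "z \<in> carrier H \<and> Zc (em z)" using z c zH by (auto simp: Zc_def)
next
  assume z: "z \<in> carrier H \<and> Zc (em z)"
  have "z \<otimes>\<^bsub>H\<^esub> h = h \<otimes>\<^bsub>H\<^esub> z" if h: "h \<in> carrier H" for h
  proof -
    obtain g g' l m where g: "Fl False l g" "Fl True m g'" "em h = g + g'" using em_decomp[OF h] .
    have "em z * g = g * em z" "em z * g' = g' * em z" using z g unfolding Zc_def by blast+
    then have "em (z \<otimes>\<^bsub>H\<^esub> h) = em (h \<otimes>\<^bsub>H\<^esub> z)" using z h g(3) by (simp add: emb_ops distrib_left distrib_right)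
    then show ?thesis using emb_inj z h ring.ring_simprules(5)[OF ring_HCl] by metis
  qed
  then show "z \<in> carrier (ZH n k)" using z by (auto simp: ZH_def ring_center_def)
qed

text \<open>Every term of d(h) contains \<open>Dd\<close> as a factor, and the multiplicative \<phi>
  sends it to 0.\<close>

lemma phi_dmap: assumes "h \<in> carrier H" shows "dmap n k h \<in> carrier H \<and> \<phi> (em (dmap n k h)) = 0"
proof -
  obtain h0 h1 where h: "h0 \<in> hc_even n k" "h1 \<in> hc_odd n k" "h = h0 \<oplus>\<^bsub>H\<^esub> h1"
    using decomp_exists[OF assms] by blast
  obtain l m where g: "Fl False l (em h0)" "Fl True m (em h1)" using even_Fl[OF h(1)] odd_Fl[OF h(2)] by blast
  have F: "Fl True (1 + l) (Dd * em h0)" "Fl True (1 + l) (em h0 * Dd)"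
    "Fl False (1 + m) (Dd * em h1)" "Fl False (1 + m) (em h1 * Dd)"
    by (rule Fl_mult'[OF Fl_D g(1)] Fl_mult'[OF g(1) Fl_D] Fl_mult'[OF Fl_D g(2)] Fl_mult'[OF g(2) Fl_D]; simp)+
  have z: "\<phi> (Dd * em h0) = 0" "\<phi> (em h0 * Dd) = 0" "\<phi> (Dd * em h1) = 0" "\<phi> (em h1 * Dd) = 0"
    using phi_mult[OF Fl_D g(1)] phi_mult[OF g(1) Fl_D] phi_mult[OF Fl_D g(2)] phi_mult[OF g(2) Fl_D] phi_D by auto
  have "\<phi> ((Dd * em h0 + - (em h0 * Dd)) + (Dd * em h1 + em h1 * Dd)) =
      (\<phi> (Dd * em h0) + - \<phi> (em h0 * Dd)) + (\<phi> (Dd * em h1) + \<phi> (em h1 * Dd))"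
    by (simp only: phi_add[OF Fl_add[OF F(1) Fl_minus[OF F(2)]] Fl_add[OF F(3,4)]]
        phi_add[OF F(1) Fl_minus[OF F(2)]] phi_add[OF F(3,4)] phi_minus[OF F(2)])
  then show ?thesis using dmap_em[OF h(1,2)] h(3) z by simp
qed

text \<open>Applying \<phi> to z - y forces the value of y. For existence, the invariant from
  \<open>dirac_cohomology\<close> is recognized as the value of \<phi> in the same way.\<close>

lemma is_zeta_iff: assumes z: "z \<in> carrier (ZH n k)"
  shows "is_zeta n k z y \<longleftrightarrow> y \<in> carrier H \<and> em y = \<phi> (em z)"
proof
  assume "is_zeta n k z y"
  then obtain h where y: "y \<in> carrier (ZSeg0 n k)" and h: "h \<in> carrier H" "z \<ominus>\<^bsub>H\<^esub> y = dmap n k h"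
    unfolding is_zeta_def by blast
  have z': "z \<in> carrier H" "Zc (em z)" using z ZH_iff by auto
  then obtain m where m: "Fl False m (em z)" unfolding Zc_def by blast
  have y': "y \<in> carrier H" "Fl False 0 (em y)" using y ZSeg0_iff by auto
  have "em z + - em y = em (dmap n k h)" using emb_ops(3)[OF z'(1) y'(1)] h(2) by simp
  then have "\<phi> (em z + - em y) = 0" using phi_dmap[OF h(1)] by simp
  then show "y \<in> carrier H \<and> em y = \<phi> (em z)"
    using phi_add[OF m Fl_minus[OF y'(2)]] phi_minus[OF y'(2)] phi_Sg[OF y'(2)] y'(1) by simp
next
  assume y: "y \<in> carrier H \<and> em y = \<phi> (em z)"
  have z': "z \<in> carrier H" "Zc (em z)" using z ZH_iff by auto
  then obtain m where m: "Fl False m (em z)" unfolding Zc_def by blast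
  have c: "em z * h = h * em z" if "Fl p l h" for p l h using z'(2) that unfolding Zc_def by blast
  have "sginv False (em z)"
    using c[OF Fl_c1[of _ 0]] c[OF Fl_w1[of _ 0]] by (auto simp: sginv_def intro!: scommI(2))
  then obtain e l v where e: "Fl True l e" "Fl False 0 v" "sginv False v" "em z = v + (Dd * e + e * Dd)"
    using dirac_cohomology[OF m _ c[OF Fl_D, symmetric]] by blast
  obtain e' where e': "e' \<in> carrier H" "e = em e'" using Fl_em[OF e(1)] by blast
  have odd: "e' \<in> hc_odd n k" using Fl_odd e(1) e' by blast
  \<comment> \<open>\<open>dmap\<close> is computed from a decomposition by parity, so the odd
    primitive is completed by the even component 0.\<close>
  have even: "\<zero>\<^bsub>H\<^esub> \<in> hc_even n k"
    using Fl_even[of 0 "\<zero>\<^bsub>H\<^esub>"] Fl_0 emb_ops(5)[OF e'(1) e'(1)] ring.ring_simprules(2)[OF ring_HCl] by simp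
  have dm: "dmap n k e' \<in> carrier H" "em (dmap n k e') = Dd * e + e * Dd"
    using dmap_em[OF even odd] e' emb_ops(5)[OF e'(1) e'(1)]
    by (simp_all add: ring.ring_simprules[OF ring_HCl])
  have "\<phi> (em (dmap n k e')) = 0" using phi_dmap[OF e'(1)] by blast
  moreover have "Fl False (1 + l) (Dd * e + e * Dd)"
    by (intro Fl_add Fl_mult'[OF Fl_D e(1)] Fl_mult'[OF e(1) Fl_D]) auto
  ultimately have "\<phi> (em z) = v" using phi_add[OF e(2)] phi_Sg[OF e(2)] e(4) dm(2) by simp
  then have yv: "em y = v" using y by simp
  then have yS: "y \<in> carrier (ZSeg0 n k)" using ZSeg0_iff y e by blast
  have "em (z \<ominus>\<^bsub>H\<^esub> y) = em (dmap n k e')" using emb_ops(3)[OF z'(1)] y yv e(4) dm(2) by simp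
  then have "z \<ominus>\<^bsub>H\<^esub> y = dmap n k e'"
    using emb_inj[OF _ dm(1)] ring.ring_simprules(4)[OF ring_HCl z'(1)] y by blast
  then show "is_zeta n k z y" unfolding is_zeta_def using yS e'(1) by blast
qed

lemma zeta_em: assumes z: "z \<in> carrier (ZH n k)"
  shows "\<exists>!y. is_zeta n k z y" "zeta n k z \<in> carrier (ZSeg0 n k)" "em (zeta n k z) = \<phi> (em z)"
proof -
  obtain m where m: "Fl False m (em z)" using z ZH_iff unfolding Zc_def by blast
  obtain y where y: "y \<in> carrier H" "\<phi> (em z) = em y" using Fl_em[OF phi_Fl[OF m]] by blast
  show ex: "\<exists>!y. is_zeta n k z y"
    unfolding is_zeta_iff[OF z] using y emb_inj by metis
  have "is_zeta n k z (zeta n k z)" unfolding zeta_def by (rule theI'[OF ex])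
  then show "zeta n k z \<in> carrier (ZSeg0 n k)" "em (zeta n k z) = \<phi> (em z)"
    using is_zeta_iff[OF z] by (auto simp: is_zeta_def)
qed

lemma zeta_eqI: "z \<in> carrier (ZH n k) \<Longrightarrow> y \<in> carrier H \<Longrightarrow> em y = \<phi> (em z) \<Longrightarrow> zeta n k z = y"
  using zeta_em ZSeg0_iff emb_inj by metis

lemma zeta_theorem:
  assumes "k \<noteq> 0 \<or> n \<le> 2"
  shows "(\<forall>z \<in> carrier (ZH n k). \<exists>!y. is_zeta n k z y) \<and>
    zeta n k \<in> ring_hom (ZH n k) (ZSeg0 n k) \<and>
    (\<forall>a. \<forall>z \<in> carrier (ZH n k). zeta n k (hc_smult n k a z) = hc_smult n k a (zeta n k z)) \<and>
    zeta n k ` carrier (ZH n k) = carrier (ZSeg0 n k)"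
proof (intro conjI ballI allI)
  have cl: "z \<in> carrier H" if "z \<in> carrier (ZH n k)" for z using that ZH_iff by blast
  have cl': "zeta n k z \<in> carrier H" if "z \<in> carrier (ZH n k)" for z using zeta_em(2)[OF that] ZSeg0_iff by blast
  have Fl: "\<exists>m. Fl False m (em z)" if "z \<in> carrier (ZH n k)" for z using that ZH_iff by (auto simp: Zc_def)
  have closed: "y \<otimes>\<^bsub>H\<^esub> z \<in> carrier (ZH n k)" "y \<oplus>\<^bsub>H\<^esub> z \<in> carrier (ZH n k)"
    if "y \<in> carrier (ZH n k)" "z \<in> carrier (ZH n k)" for y z
    using that Zc_mult Zc_add ring.ring_simprules(1,5)[OF ring_HCl] by (auto simp: ZH_iff emb_ops)
  have mult: "zeta n k (y \<otimes>\<^bsub>H\<^esub> z) = zeta n k y \<otimes>\<^bsub>H\<^esub> zeta n k z"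
    and add: "zeta n k (y \<oplus>\<^bsub>H\<^esub> z) = zeta n k y \<oplus>\<^bsub>H\<^esub> zeta n k z"
    if yz: "y \<in> carrier (ZH n k)" "z \<in> carrier (ZH n k)" for y z
  proof -
    obtain l m where lm: "Fl False l (em y)" "Fl False m (em z)" using Fl yz by blast
    have "em (zeta n k y \<otimes>\<^bsub>H\<^esub> zeta n k z) = \<phi> (em (y \<otimes>\<^bsub>H\<^esub> z))"
      using yz lm by (simp add: emb_ops cl cl' zeta_em phi_mult)
    then show "zeta n k (y \<otimes>\<^bsub>H\<^esub> z) = zeta n k y \<otimes>\<^bsub>H\<^esub> zeta n k z"
      using yz by (intro zeta_eqI closed ring.ring_simprules(5)[OF ring_HCl] cl')
    have "em (zeta n k y \<oplus>\<^bsub>H\<^esub> zeta n k z) = \<phi> (em (y \<oplus>\<^bsub>H\<^esub> z))"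
      using yz lm by (simp add: emb_ops cl cl' zeta_em phi_add)
    then show "zeta n k (y \<oplus>\<^bsub>H\<^esub> z) = zeta n k y \<oplus>\<^bsub>H\<^esub> zeta n k z"
      using yz by (intro zeta_eqI closed ring.ring_simprules(1)[OF ring_HCl] cl')
  qed
  \<comment> \<open>Scalars are central and fixed by zeta, which reduces compatibility with scalar
    multiples to multiplicativity.\<close>
  have S: "cls n k (scal a) \<in> carrier (ZH n k)" for a
    unfolding ZH_iff using cls_carrier[OF free_scal] Zc_S[of a] by (simp add: J_def)
  have zS: "zeta n k (cls n k (scal a)) = cls n k (scal a)" for a
    using phi_S[of a] cls_carrier[OF free_scal] by (intro zeta_eqI S) (simp_all add: J_def)
  show "\<exists>!y. is_zeta n k z y" if "z \<in> carrier (ZH n k)" for z by (rule zeta_em(1)[OF that])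
  have one: "\<one>\<^bsub>H\<^esub> = cls n k (scal 1)"
    using ring_hom_one[OF cls_hom, of n k] by (simp add: scal_1 free_alg_simps)
  show "zeta n k \<in> ring_hom (ZH n k) (ZSeg0 n k)"
  proof (rule ring_hom_memI)
    show "zeta n k z \<in> carrier (ZSeg0 n k)" if "z \<in> carrier (ZH n k)" for z by (rule zeta_em(2)[OF that])
    show "zeta n k (y \<otimes>\<^bsub>ZH n k\<^esub> z) = zeta n k y \<otimes>\<^bsub>ZSeg0 n k\<^esub> zeta n k z"
      "zeta n k (y \<oplus>\<^bsub>ZH n k\<^esub> z) = zeta n k y \<oplus>\<^bsub>ZSeg0 n k\<^esub> zeta n k z"
      if "y \<in> carrier (ZH n k)" "z \<in> carrier (ZH n k)" for y z
      using mult[OF that] add[OF that] by (simp_all add: ZH_def ZSeg0_def)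
    show "zeta n k \<one>\<^bsub>ZH n k\<^esub> = \<one>\<^bsub>ZSeg0 n k\<^esub>"
      using zS[of 1] by (simp add: ZH_def ZSeg0_def one)
  qed
  show "zeta n k (hc_smult n k a z) = hc_smult n k a (zeta n k z)" if "z \<in> carrier (ZH n k)" for a z
    unfolding hc_smult_def using mult[OF S that] zS by simp
  show "zeta n k ` carrier (ZH n k) = carrier (ZSeg0 n k)"
  proof
    show "zeta n k ` carrier (ZH n k) \<subseteq> carrier (ZSeg0 n k)" using zeta_em(2) by blast
    show "carrier (ZSeg0 n k) \<subseteq> zeta n k ` carrier (ZH n k)"
    proof
      fix y assume "y \<in> carrier (ZSeg0 n k)"
      then have y: "y \<in> carrier H" "Fl False 0 (em y)" "sginv False (em y)" using ZSeg0_iff by auto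
      then have "em y \<in> P" using sginv_in_P[OF assms] by blast
      then obtain v where v: "Zc v" "em y = \<phi> v" unfolding P_def by blast
      then obtain z where z: "z \<in> carrier H" "v = em z" using Fl_em unfolding Zc_def by blast
      then have "z \<in> carrier (ZH n k)" using v ZH_iff by blast
      then show "y \<in> zeta n k ` carrier (ZH n k)" using zeta_eqI[of z y] y(1) v z by blast
    qed
  qed
qed

end

theorem corollary7p21:
  fixes n :: nat and k :: complex
  assumes "k \<noteq> 0 \<or> n \<le> 2"
  shows "(\<forall>z \<in> carrier (ZH n k). \<exists>!y. is_zeta n k z y) \<and>
    zeta n k \<in> ring_hom (ZH n k) (ZSeg0 n k) \<and>
    (\<forall>a. \<forall>z \<in> carrier (ZH n k). zeta n k (hc_smult n k a z) = hc_smult n k a (zeta n k z)) \<and>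
    zeta n k ` carrier (ZH n k) = carrier (ZSeg0 n k)"
proof -
  obtain \<phi> \<psi> where "hc_univ n k (\<lambda>a. J n k (scal a)) (\<lambda>i. J n k (xg i)) (\<lambda>i. J n k (cg i)) (\<lambda>u. J n k (wg u)) \<phi> \<psi>"
    using hc_concrete.ex_univ by blast
  then interpret hc_concrete_univ n k \<phi> \<psi>
    by (rule hc_concrete_univ.intro)
  show ?thesis by (rule zeta_theorem[OF assms])
qed

end
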